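(* Let $0<\theta<\pi/2$. Then (i) $\mathbb{D}_\theta$ is a continuous operator on $(L^2(\mathbb{R}))^4$ and $\mathbb{D}_\theta\big((L^2(\mathbb{R}))^4\big)\subset (L^2_0(\mathbb{R}))^4$; (ii) as an operator on $(L^2_0(\mathbb{R}))^4$, $\mathbb{D}_\theta$ is the sum of an operator of norm $\le 1/\sqrt{2}$ and a compact operator.
   Context: Fix $a>0$ and $k>0$. All square roots are principal ($\mathrm{Arg}\in(-\pi,\pi]$), $R(w,z):=(w^2+z^2)^{1/2}$ for $w,z\in\mathbb{C}$, and $h(x_1,x_2)=\frac{ikx_1}{2}\frac{H_1^{(1)}(kR(x_1,x_2))}{R(x_1,x_2)}$. For $0<\theta<\pi/2$ let $\tau_\theta(s)=-a+(s+a)e^{i\theta}$ for $s<-a$, $\tau_\theta(s)=s$ for $|s|\le a$, $\tau_\theta(s)=a+(s-a)e^{i\theta}$ for $s>a$. Let $S\psi(t)=\psi(-t)$ and $D_\theta\psi(t)=\int_{\mathbb{R}}h(\tau_\theta(t)-a,\,a-\tau_\theta(s))\psi(s)\tau_\theta'(s)\,\mathrm{d}s$ for $t>a$, $D_\theta\psi(t)=0$ for $t\le a$. Let $L^2_0(\mathbb{R})=\{\psi\in L^2(\mathbb{R}):\psi=0\text{ a.e. on }(-a,a)\}$. Define $\mathbb{D}_\theta$ on $(L^2(\mathbb{R}))^4$ componentwise by $(\mathbb{D}_\theta\Phi)^j=S D_\theta\varphi^{j-1}+D_\theta S\varphi^{j+1}$ for $\Phi=\{\varphi^0,\varphi^1,\varphi^2,\varphi^3\}$,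 indices mod 4. *)

theory Defs
  imports "HOL-Analysis.Analysis" "HOL-Library.Numeral_Type"
begin

text \<open>Power series of J_1 (entire), and Y_1 via the standard series (DLMF 10.8.1)
  with the principal logarithm Ln (Arg in (-pi,pi]).\<close>

definition besselJ1 :: "complex \<Rightarrow> complex" where
  "besselJ1 z = (\<Sum>m. (-1) ^ m * (z / 2) ^ (2 * m + 1) / of_nat (fact m * fact (m + 1)))"

definition besselY1 :: "complex \<Rightarrow> complex" where
  "besselY1 z =
     of_real (2 / pi) * besselJ1 z * Ln (z / 2) - of_real (2 / pi) / z
     - of_real (1 / pi) * (\<Sum>m. (-1) ^ m
          * of_real (Digamma (real (m + 1)) + Digamma (real (m + 2)))
          * (z / 2) ^ (2 * m + 1) / of_nat (fact m * fact (m + 1)))"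

definition hankel1 :: "complex \<Rightarrow> complex" where
  "hankel1 z = besselJ1 z + \<i> * besselY1 z"

definition Rad :: "complex \<Rightarrow> complex \<Rightarrow> complex" where
  "Rad w z = csqrt (w ^ 2 + z ^ 2)"

definition hker :: "real \<Rightarrow> complex \<Rightarrow> complex \<Rightarrow> complex" where
  "hker k x1 x2 = \<i> * of_real k * x1 / 2 * hankel1 (of_real k * Rad x1 x2) / Rad x1 x2"

definition tau :: "real \<Rightarrow> real \<Rightarrow> real \<Rightarrow> complex" where
  "tau a \<theta> s =
     (if s < -a then of_real (-a) + of_real (s + a) * cis \<theta>
      else if s \<le> a then of_real s
      else of_real a + of_real (s - a) * cis \<theta>)"

text \<open>Derivative of tau (defined everywhere except s = +-a, a null set; the value
  there is immaterial).\<close>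
definition tau' :: "real \<Rightarrow> real \<Rightarrow> real \<Rightarrow> complex" where
  "tau' a \<theta> s = (if \<bar>s\<bar> \<le> a then 1 else cis \<theta>)"

definition Sop :: "(real \<Rightarrow> complex) \<Rightarrow> real \<Rightarrow> complex" where
  "Sop \<psi> t = \<psi> (- t)"

definition Dop :: "real \<Rightarrow> real \<Rightarrow> real \<Rightarrow> (real \<Rightarrow> complex) \<Rightarrow> real \<Rightarrow> complex" where
  "Dop a k \<theta> \<psi> t =
     (if t > a then
        (LINT s|lborel. hker k (tau a \<theta> t - of_real a) (of_real a - tau a \<theta> s) * \<psi> s * tau' a \<theta> s)
      else 0)"

text \<open>Quadruples indexed by the type 4 (integers mod 4).\<close>
definition DDop :: "real \<Rightarrow> real \<Rightarrow> real \<Rightarrow> (4 \<Rightarrow> real \<Rightarrow> complex) \<Rightarrow> 4 \<Rightarrow> real \<Rightarrow> complex" where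
  "DDop a k \<theta> \<Phi> j = (\<lambda>t. Sop (Dop a k \<theta> (\<Phi> (j - 1))) t + Dop a k \<theta> (Sop (\<Phi> (j + 1))) t)"

section \<open>L^2 spaces (functions, equality understood almost everywhere)\<close>

definition L2 :: "(real \<Rightarrow> complex) set" where
  "L2 = {f. f \<in> borel_measurable lborel \<and> integrable lborel (\<lambda>x. (cmod (f x))\<^sup>2)}"

definition L2_0 :: "real \<Rightarrow> (real \<Rightarrow> complex) set" where
  "L2_0 a = {f \<in> L2. AE x in lborel. x \<in> {-a<..<a} \<longrightarrow> f x = 0}"

definition vnorm :: "(4 \<Rightarrow> real \<Rightarrow> complex) \<Rightarrow> real" where
  "vnorm \<Phi> = sqrt (\<Sum>j\<in>UNIV. LINT x|lborel. (cmod (\<Phi> j x))\<^sup>2)"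

definition vspace :: "(real \<Rightarrow> complex) set \<Rightarrow> (4 \<Rightarrow> real \<Rightarrow> complex) set" where
  "vspace V = {\<Phi>. \<forall>j. \<Phi> j \<in> V}"

definition bounded_linear_on ::
  "(4 \<Rightarrow> real \<Rightarrow> complex) set \<Rightarrow> ((4 \<Rightarrow> real \<Rightarrow> complex) \<Rightarrow> (4 \<Rightarrow> real \<Rightarrow> complex)) \<Rightarrow> bool" where
  "bounded_linear_on W T \<longleftrightarrow>
     (\<forall>\<Phi>\<in>W. T \<Phi> \<in> W) \<and>
     (\<forall>\<Phi>\<in>W. \<forall>\<Psi>\<in>W. \<forall>c::complex. \<forall>j. AE t in lborel.
         T (\<lambda>i x. c * \<Phi> i x + \<Psi> i x) j t = c * T \<Phi> j t + T \<Psi> j t) \<and>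
     (\<exists>C. \<forall>\<Phi>\<in>W. vnorm (T \<Phi>) \<le> C * vnorm \<Phi>)"

definition compact_op_on ::
  "(4 \<Rightarrow> real \<Rightarrow> complex) set \<Rightarrow> ((4 \<Rightarrow> real \<Rightarrow> complex) \<Rightarrow> (4 \<Rightarrow> real \<Rightarrow> complex)) \<Rightarrow> bool" where
  "compact_op_on W T \<longleftrightarrow> bounded_linear_on W T \<and>
     (\<forall>\<Phi>s::nat \<Rightarrow> 4 \<Rightarrow> real \<Rightarrow> complex. (\<forall>n. \<Phi>s n \<in> W) \<longrightarrow> (\<exists>B. \<forall>n. vnorm (\<Phi>s n) \<le> B) \<longrightarrow>
        (\<exists>r \<Psi>. strict_mono r \<and> \<Psi> \<in> W \<and>
           (\<lambda>n. vnorm (\<lambda>j x. T (\<Phi>s (r n)) j x - \<Psi> j x)) \<longlonglongrightarrow> 0))"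

end

theory Submission
  imports Defs "HOL-Complex_Analysis.Complex_Analysis" "HOL-Real_Asymp.Real_Asymp"
begin

text \<open>
  Put $u = t - a > 0$. In the complexified coordinates $R^2 = u^2 e^{2i\theta} + (p + v e^{i\theta})^2$
  with $p, v \ge 0$ and $p + v = |s - a|$, so $|R|$ is comparable to $u + |s-a|$ and
  $\mathrm{Im}\, R \ge \eta |R|$ for large $|R|$. The kernel of $D_\theta$ therefore decays exponentially
  away from the corner, once $H_1^{(1)}(z)$ is known to be $O(|z| e^{-\mathrm{Im}\, z/2})$. Near the corner
  it equals $u / (\pi(u^2 + (s-a)^2))$ for $s > a$, up to a bounded term. Splitting off this homogeneous
  part, damped by $e^{-k\rho}$, leaves a kernel bounded by $C e^{-c(u + |s-a|)}$ and continuous in $t$,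
  hence a compact operator. The homogeneous part has norm at most $1/\sqrt 2$ by Schur's test with the
  weight $|s-a|^{-1/2}$, and the two contributions to each component of $\mathbb{D}_\theta\Phi$ have
  disjoint supports and see disjoint parts of $\Phi$.

  The decay of $H_1^{(1)}$ has to be extracted from the power series. On the imaginary axis, both the
  series and $x \int_1^\infty e^{-xu}\sqrt{u^2-1}\,du$ solve the modified Bessel equation and are
  $o(I_1)$ at infinity, so they are proportional; analytic continuation gives the upper half-plane.
\<close>


section \<open>Power series of Bessel type\<close>

text \<open>Since H_1^{(1)}(z) behaves like -2i/(pi z) at 0, the kernel behaves like u e^{i\<theta>}
  \<tau>'(s) / (pi R^2) at the corner. For s > a the phases of all three factors cancel, and the
  limit is positive and free of \<theta>; that is why the bound 1/sqrt 2 does not depend on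
  \<theta>. On (-a, a) the phases do not cancel and the singularity at s = a from the left remains,
  so part (ii) concerns functions vanishing there, while part (i) rests on a cruder majorant. The
  undamped homogeneous kernel decays only algebraically, so the difference would too; the damping
  cures this without touching the singularity, and dropping it later only enlarges a positive
  kernel. The constant is 1/pi times the integral of x^{-1/2}/(1+x^2) over the half-line.
  Compactness is shown with sequences: norm continuity of the rows in t lets convergence at rational
  t spread to all t. The factor between the Hankel function and the Laplace integral is never
  evaluated, since only decay is used.\<close>

text \<open>A bound by C / m! instead of a radius of convergence: it gives an entire series, and
  termwise differentiation and index shifts keep it with the same C.\<close>

definition exp_bounded :: "(nat \<Rightarrow> real) \<Rightarrow> bool" where
  "exp_bounded c \<longleftrightarrow> (\<exists>C. \<forall>m. \<bar>c m\<bar> \<le> C / fact m)"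

text \<open>Real coefficients with a polymorphic variable: the differential equations are compared
  on the positive reals, while the Hankel function needs complex arguments;
  \<open>pser_of_real\<close> joins the two.\<close>

definition pser :: "(nat \<Rightarrow> real) \<Rightarrow> 'a::{real_normed_field,banach} \<Rightarrow> 'a" where
  "pser c y = (\<Sum>m. of_real (c m) * y ^ m)"

lemma exp_bounded_summable_norm:
  fixes y :: "'a::{real_normed_field,banach}"
  assumes "exp_bounded c"
  shows "summable (\<lambda>m. norm (of_real (c m) * y ^ m))"
proof -
  obtain C where C: "\<And>m. \<bar>c m\<bar> \<le> C / fact m"
    using assms by (auto simp: exp_bounded_def)
  have "summable (\<lambda>m. C * (inverse (fact m) * norm y ^ m))"
    by (intro summable_mult summable_exp)
  then show ?thesis
  proof (rule summable_comparison_test[rotated], intro exI allI impI)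
    fix m
    have "\<bar>c m\<bar> * norm y ^ m \<le> C / fact m * norm y ^ m"
      by (intro mult_right_mono C) simp
    then show "norm (norm (of_real (c m) * y ^ m)) \<le> C * (inverse (fact m) * norm y ^ m)"
      by (simp add: norm_mult norm_power field_simps)
  qed
qed

lemma exp_bounded_summable:
  fixes y :: "'a::{real_normed_field,banach}"
  shows "exp_bounded c \<Longrightarrow> summable (\<lambda>m. of_real (c m) * y ^ m)"
  by (rule summable_norm_cancel[OF exp_bounded_summable_norm])

lemma exp_bounded_diffs:
  assumes "exp_bounded c" shows "exp_bounded (diffs c)"
proof -
  obtain C where C: "\<And>m. \<bar>c m\<bar> \<le> C / fact m"
    using assms by (auto simp: exp_bounded_def)
  have "\<bar>diffs c m\<bar> \<le> C / fact m" for m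
  proof -
    have "\<bar>diffs c m\<bar> = real (Suc m) * \<bar>c (Suc m)\<bar>"
      by (simp add: diffs_def abs_mult)
    also have "\<dots> \<le> real (Suc m) * (C / fact (Suc m))"
      by (intro mult_left_mono C) simp
    also have "\<dots> = C / fact m"
      by (simp add: divide_simps)
    finally show ?thesis .
  qed
  then show ?thesis by (auto simp: exp_bounded_def)
qed

lemma exp_bounded_Suc:
  assumes "exp_bounded c" shows "exp_bounded (\<lambda>m. c (Suc m))"
proof -
  obtain C where C: "\<And>m. \<bar>c m\<bar> \<le> C / fact m"
    using assms by (auto simp: exp_bounded_def)
  have "0 \<le> C" using C[of 0] by simp
  have "\<bar>c (Suc m)\<bar> \<le> C / fact m" for m
  proof -
    have "\<bar>c (Suc m)\<bar> \<le> C / fact (Suc m)" by (rule C)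
    also have "\<dots> \<le> C / fact m"
      using \<open>0 \<le> C\<close> by (intro divide_left_mono fact_mono) auto
    finally show ?thesis .
  qed
  then show ?thesis by (auto simp: exp_bounded_def)
qed

lemma pser_sums:
  fixes y :: "'a::{real_normed_field,banach}"
  shows "exp_bounded c \<Longrightarrow> (\<lambda>m. of_real (c m) * y ^ m) sums pser c y"
  unfolding pser_def by (intro summable_sums exp_bounded_summable)

lemma has_field_derivative_pser:
  fixes y :: "'a::{real_normed_field,banach}"
  assumes "exp_bounded c"
  shows "(pser c has_field_derivative pser (diffs c) y) (at y)"
proof -
  have "diffs (\<lambda>m. of_real (c m) :: 'a) = (\<lambda>m. of_real (diffs c m))"
    by (simp add: diffs_def fun_eq_iff)
  with termdiffs_strong_converges_everywhere[of "\<lambda>m. of_real (c m)" y]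
       exp_bounded_summable[OF assms] show ?thesis
    unfolding pser_def[abs_def] by metis
qed

lemma continuous_on_pser:
  fixes S :: "'a::{real_normed_field,banach} set"
  shows "exp_bounded c \<Longrightarrow> continuous_on S (pser c)"
  by (meson DERIV_isCont continuous_at_imp_continuous_on has_field_derivative_pser)

lemma pser_of_real:
  "exp_bounded c \<Longrightarrow> pser c (of_real y :: 'a::{real_normed_field,banach}) = of_real (pser c y)"
  using sums_unique2[OF pser_sums, of c "of_real y :: 'a"] sums_of_real[OF pser_sums[of c y], where 'a='a]
  by simp

lemma pser_shift:
  fixes y :: "'a::{real_normed_field,banach}"
  assumes "exp_bounded c"
  shows "pser c y = of_real (c 0) + y * pser (\<lambda>m. c (Suc m)) y"
proof -
  have "(\<lambda>m. y * (of_real (c (Suc m)) * y ^ m)) sums (y * pser (\<lambda>m. c (Suc m)) y)"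
    by (intro sums_mult pser_sums exp_bounded_Suc assms)
  then have "(\<lambda>m. of_real (c (Suc m)) * y ^ Suc m) sums (y * pser (\<lambda>m. c (Suc m)) y)"
    by (simp add: mult_ac)
  then have "(\<lambda>m. of_real (c m) * y ^ m) sums (y * pser (\<lambda>m. c (Suc m)) y + of_real (c 0))"
    by (subst (asm) sums_Suc_iff) simp
  from sums_unique2[OF pser_sums[OF assms] this] show ?thesis by simp
qed

lemma exp_bounded_lincomb:
  assumes "exp_bounded c" "exp_bounded d"
  shows "exp_bounded (\<lambda>m. \<alpha> * c m + \<beta> * d m)"
proof -
  obtain C D where CD: "\<And>m. \<bar>c m\<bar> \<le> C / fact m" "\<And>m. \<bar>d m\<bar> \<le> D / fact m"
    using assms by (auto simp: exp_bounded_def)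
  have "\<bar>\<alpha> * c m + \<beta> * d m\<bar> \<le> (\<bar>\<alpha>\<bar> * C + \<bar>\<beta>\<bar> * D) / fact m" for m
  proof -
    have "\<bar>\<alpha> * c m + \<beta> * d m\<bar> \<le> \<bar>\<alpha>\<bar> * \<bar>c m\<bar> + \<bar>\<beta>\<bar> * \<bar>d m\<bar>"
      using abs_triangle_ineq[of "\<alpha> * c m" "\<beta> * d m"] by (simp add: abs_mult)
    also have "\<dots> \<le> \<bar>\<alpha>\<bar> * (C / fact m) + \<bar>\<beta>\<bar> * (D / fact m)"
      by (intro add_mono mult_left_mono CD) auto
    finally show ?thesis by (simp add: add_divide_distrib)
  qed
  then show ?thesis by (auto simp: exp_bounded_def)
qed

lemma pser_lincomb:
  fixes y :: "'a::{real_normed_field,banach}"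
  assumes "exp_bounded c" "exp_bounded d"
  shows "pser (\<lambda>m. \<alpha> * c m + \<beta> * d m) y = of_real \<alpha> * pser c y + of_real \<beta> * pser d y"
proof -
  have "(\<lambda>m. of_real \<alpha> * (of_real (c m) * y ^ m) + of_real \<beta> * (of_real (d m) * y ^ m)) sums
      (of_real \<alpha> * pser c y + of_real \<beta> * pser d y)"
    by (intro sums_add sums_mult pser_sums assms)
  then have "(\<lambda>m. of_real (\<alpha> * c m + \<beta> * d m) * y ^ m) sums (of_real \<alpha> * pser c y + of_real \<beta> * pser d y)"
    by (simp add: algebra_simps)
  from sums_unique2[OF pser_sums[OF exp_bounded_lincomb[OF assms]] this] show ?thesis .
qed

text \<open>In the variable $y = z^2/4$ the modified Bessel operator
  $f \mapsto x^2 f'' + x f' - (x^2+1) f$ acting on $f(x) = (x/2)\,p(y)$ becomes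
  $(y^2 p')' - y p$ up to a factor.\<close>

lemma pser_bessel_operator:
  fixes y :: "'a::{real_normed_field,banach}"
  assumes c: "exp_bounded c" and e: "exp_bounded e"
    and rel: "\<And>m. e m = real (m + 1) * real (m + 2) * c (Suc m)"
  shows "((\<lambda>y. y\<^sup>2 * pser (diffs c) y) has_field_derivative y * pser e y) (at y)"
proof -
  \<comment> \<open>Subtracting 2 p' removes the constant term, so \<open>pser_shift\<close> can
    factor out y; what remains is y p'', as in (y^2 p')' = y (y p'' + 2 p').\<close>
  define g where "g = (\<lambda>m. 1 * e m + (- 2) * diffs c m)"
  have bd: "exp_bounded (diffs c)" using c by (rule exp_bounded_diffs)
  have g: "exp_bounded g" unfolding g_def by (rule exp_bounded_lincomb[OF e bd])
  have "(\<lambda>m. g (Suc m)) = diffs (diffs c)" "g 0 = 0"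
    by (auto simp: g_def rel diffs_def fun_eq_iff algebra_simps)
  then have "pser g y = y * pser (diffs (diffs c)) y" using pser_shift[OF g, of y] by simp
  then have eq: "pser e y = y * pser (diffs (diffs c)) y + 2 * pser (diffs c) y"
    using pser_lincomb[OF e bd, of 1 "- 2" y] by (simp add: g_def)
  show ?thesis
    by (rule derivative_eq_intros has_field_derivative_pser bd refl)+
       (simp add: eq algebra_simps power2_eq_square)
qed

text \<open>With these coefficients $I_1(x) = (x/2)\,p(x^2/4)$.\<close>

definition jcoeff :: "nat \<Rightarrow> real" where
  "jcoeff m = 1 / (fact m * fact (Suc m))"

definition digsum :: "nat \<Rightarrow> real" where
  "digsum m = Digamma (real (m + 1)) + Digamma (real (m + 2))"

definition ycoeff :: "nat \<Rightarrow> real" where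
  "ycoeff m = digsum m * jcoeff m"

section \<open>Coefficients of the logarithmic solution\<close>

text \<open>From psi(m+1) = H_m - gamma and two-sided bounds on gamma. These bounds involve H_m with
  m positive only, so m = 0 is settled by 0 < gamma < 1.\<close>

lemma Digamma_bounds:
  "Digamma (real (m + 1)) \<le> ln (real (m + 1))" (is ?A)
  "ln (real (m + 1)) - 1 / real (m + 1) \<le> Digamma (real (m + 1))" (is ?B)
proof -
  have D: "Digamma (real (m + 1)) = harm m - euler_mascheroni"
    using Digamma_of_nat[of m, where 'a=real] by simp
  have "?A \<and> ?B"
  proof (cases m)
    case 0
    have "euler_mascheroni < (1::real)"
      using euler_mascheroni_upper[of 0] ln2_ge_two_thirds by (simp add: harm_def)
    then show ?thesis using euler_mascheroni_pos by (simp add: 0)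
  next
    case (Suc n)
    have "harm m - ln (real (m + 1)) + 1 / real (2 * (m + 1)) \<le> (euler_mascheroni::real)"
      using euler_mascheroni_lower[of n] by (simp add: Suc add_ac)
    moreover have "(euler_mascheroni::real) \<le> harm m - ln (real (m + 1)) + 1 / real (2 * m)"
      using euler_mascheroni_upper[of n] by (simp add: Suc add_ac)
    moreover have "1 / real (2 * m) \<le> 1 / real (m + 1)"
      using Suc by (simp add: field_simps)
    moreover have "0 \<le> 1 / real (2 * (m + 1))" by simp
    ultimately show ?thesis unfolding D by linarith
  qed
  then show ?A ?B by auto
qed

lemma digsum_eq: "digsum m = 2 * Digamma (real (m + 1)) + 1 / real (m + 1)"
  using Digamma_plus1[of "real (m + 1)"] by (simp add: digsum_def add_ac)

lemma digsum_Suc: "digsum (Suc m) = digsum m + 1 / real (m + 1) + 1 / real (m + 2)"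
  using Digamma_plus1[of "real (m + 1)"] Digamma_plus1[of "real (m + 2)"]
  by (simp add: digsum_def add_ac)

text \<open>The form 2 psi(m+1) + 1/(m+1) recentres the one-sided error of
  \<open>Digamma_bounds\<close>: it becomes symmetric, with half-width 1/(m+1).\<close>

lemma digsum_bounds: "\<bar>digsum m - 2 * ln (real (m + 1))\<bar> \<le> 1 / real (m + 1)"
  using Digamma_bounds[of m] unfolding digsum_eq abs_le_iff by linarith

lemma exp_bounded_jcoeff: "exp_bounded jcoeff"
proof -
  have "\<bar>jcoeff m\<bar> \<le> 1 / fact m" for m
    using fact_ge_1[of "Suc m", where 'a=real] by (simp add: jcoeff_def divide_simps del: fact_Suc)
  then show ?thesis by (auto simp: exp_bounded_def)
qed

lemma exp_bounded_ycoeff: "exp_bounded ycoeff"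
proof -
  have "\<bar>ycoeff m\<bar> \<le> 3 / fact m" for m
  proof -
    have "ln (real (m + 1)) \<le> real (m + 1)" "0 \<le> ln (real (m + 1))"
      by (auto intro: ln_bound order.trans[OF ln_le_minus_one])
    moreover have "1 / real (m + 1) \<le> real (m + 1)"
      using mult_mono[of 1 "real (m + 1)" 1 "real (m + 1)"] by (simp add: divide_simps)
    ultimately have "\<bar>digsum m\<bar> \<le> 3 * real (m + 1)"
      using digsum_bounds[of m] by (smt (verit))
    then have "\<bar>ycoeff m\<bar> \<le> 3 * real (m + 1) * (1 / (fact m * fact (Suc m)))"
      unfolding ycoeff_def jcoeff_def abs_mult by (intro mult_mono) auto
    also have "\<dots> = 3 / (fact m * fact m)" by (simp add: divide_simps)
    also have "\<dots> \<le> 3 / fact m"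
      using fact_ge_1[of m, where 'a=real] by (simp add: divide_simps)
    finally show ?thesis .
  qed
  then show ?thesis by (auto simp: exp_bounded_def)
qed

lemma jcoeff_Suc: "real (m + 1) * real (m + 2) * jcoeff (Suc m) = jcoeff m"
  by (simp add: jcoeff_def divide_simps)

text \<open>The surplus factor 2m+3 = (m+1) + (m+2) comes from the increment of the digamma sum; it
  is the derivative of (m+1)(m+2) in the index that Frobenius' method predicts for a logarithmic
  solution.\<close>

lemma ycoeff_Suc:
  "real (m + 1) * real (m + 2) * ycoeff (Suc m) = ycoeff m + real (2 * m + 3) * jcoeff (Suc m)"
proof -
  have *: "real (m + 1) * real (m + 2) * (1 / real (m + 1) + 1 / real (m + 2)) = real (2 * m + 3)"
    by (simp add: divide_simps)
  have "real (m + 1) * real (m + 2) * ycoeff (Suc m)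
      = digsum m * (real (m + 1) * real (m + 2) * jcoeff (Suc m))
        + (real (m + 1) * real (m + 2) * (1 / real (m + 1) + 1 / real (m + 2))) * jcoeff (Suc m)"
    unfolding ycoeff_def digsum_Suc by (simp add: algebra_simps)
  then show ?thesis unfolding jcoeff_Suc * by (simp add: ycoeff_def)
qed

lemma pser_jcoeff_ode:
  fixes y :: "'a::{real_normed_field,banach}"
  shows "((\<lambda>y. y\<^sup>2 * pser (diffs jcoeff) y) has_field_derivative y * pser jcoeff y) (at y)"
  by (rule pser_bessel_operator[OF exp_bounded_jcoeff exp_bounded_jcoeff jcoeff_Suc[symmetric]])

text \<open>With P the regular series, the extra terms 2 y P' + P are exactly what the product rule
  produces from P times \<open>ln y\<close>, and the -1 accounts for the pole 1/(2y). In
  \<open>kfun_ode\<close> they cancel and leave the homogeneous equation.\<close>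

lemma pser_ycoeff_ode:
  fixes y :: "'a::{real_normed_field,banach}"
  shows "((\<lambda>y. y\<^sup>2 * pser (diffs ycoeff) y) has_field_derivative
     y * pser ycoeff y + 2 * y * pser (diffs jcoeff) y + pser jcoeff y - 1) (at y)"
proof -
  define f where "f = (\<lambda>m. 1 * jcoeff (Suc m) + 2 * diffs jcoeff m)"
  define e where "e = (\<lambda>m. 1 * ycoeff m + 1 * f m)"
  have j: "exp_bounded (\<lambda>m. jcoeff (Suc m))" "exp_bounded (diffs jcoeff)"
    by (intro exp_bounded_diffs exp_bounded_Suc exp_bounded_jcoeff)+
  have f: "exp_bounded f" unfolding f_def by (rule exp_bounded_lincomb[OF j])
  have e: "exp_bounded e" unfolding e_def by (rule exp_bounded_lincomb[OF exp_bounded_ycoeff f])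
  have "pser f y = of_real 1 * pser (\<lambda>m. jcoeff (Suc m)) y + of_real 2 * pser (diffs jcoeff) y"
    unfolding f_def by (rule pser_lincomb[OF j])
  moreover have "pser e y = of_real 1 * pser ycoeff y + of_real 1 * pser f y"
    unfolding e_def by (rule pser_lincomb[OF exp_bounded_ycoeff f])
  moreover have "pser jcoeff y = 1 + y * pser (\<lambda>m. jcoeff (Suc m)) y"
    using pser_shift[OF exp_bounded_jcoeff, of y] by (simp add: jcoeff_def)
  ultimately have "y * pser e y = y * pser ycoeff y + 2 * y * pser (diffs jcoeff) y + pser jcoeff y - 1"
    by (simp add: algebra_simps)
  moreover have "((\<lambda>y. y\<^sup>2 * pser (diffs ycoeff) y) has_field_derivative y * pser e y) (at y)"
    by (rule pser_bessel_operator[OF exp_bounded_ycoeff e])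
       (simp only: ycoeff_Suc, simp add: e_def f_def diffs_def algebra_simps)
  ultimately show ?thesis by simp
qed

text \<open>$K_1(x) = (x/2)\,k(x^2/4)$.\<close>

definition kfun :: "real \<Rightarrow> real" where
  "kfun y = 1 / (2 * y) + (pser jcoeff y * ln y - pser ycoeff y) / 2"

definition kfun' :: "real \<Rightarrow> real" where
  "kfun' y = - 1 / (2 * y\<^sup>2) + (pser (diffs jcoeff) y * ln y + pser jcoeff y / y - pser (diffs ycoeff) y) / 2"

lemma kfun_deriv: "0 < y \<Longrightarrow> (kfun has_real_derivative kfun' y) (at y)"
  unfolding kfun_def[abs_def] kfun'_def
  by (rule derivative_eq_intros has_field_derivative_pser exp_bounded_jcoeff exp_bounded_ycoeff refl | simp)+
     (simp add: power2_eq_square divide_simps)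

lemma kfun_ode:
  assumes "0 < y"
  shows "((\<lambda>y. y\<^sup>2 * kfun' y) has_real_derivative y * kfun y) (at y)"
proof -
  have "((\<lambda>y. - 1 / 2 + ((y\<^sup>2 * pser (diffs jcoeff) y) * ln y + y * pser jcoeff y
          - y\<^sup>2 * pser (diffs ycoeff) y) / 2) has_real_derivative y * kfun y) (at y)"
    using assms
    apply -
    apply (rule pser_jcoeff_ode pser_ycoeff_ode derivative_eq_intros has_field_derivative_pser
        exp_bounded_jcoeff refl | simp)+
    by (simp add: kfun_def power2_eq_square divide_simps, simp add: algebra_simps)
  moreover have "\<forall>\<^sub>F x in nhds y. - 1 / 2 + ((x\<^sup>2 * pser (diffs jcoeff) x) * ln x + x * pser jcoeff x
          - x\<^sup>2 * pser (diffs ycoeff) x) / 2 = x\<^sup>2 * kfun' x"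
    using eventually_nhds_in_open[of "{0<..}" y] assms
    by (auto elim!: eventually_mono simp: kfun'_def power2_eq_square divide_simps) (simp add: algebra_simps)
  ultimately show ?thesis
    by (subst (asm) DERIV_cong_ev) (auto)
qed

section \<open>Growth of the regular solution, recessiveness of the logarithmic one\<close>

lemma jcoeff_pos: "0 < jcoeff m"
  by (simp add: jcoeff_def)

lemma pser_ge_first:
  fixes y :: real
  assumes "exp_bounded c" "\<And>m. 0 \<le> c m" "0 \<le> y"
  shows "c 0 \<le> pser c y"
proof -
  have "0 \<le> pser (\<lambda>m. c (Suc m)) y"
    unfolding pser_def using exp_bounded_summable[OF exp_bounded_Suc[OF assms(1)], of y] assms
    by (intro suminf_nonneg) auto
  then show ?thesis using pser_shift[OF assms(1), of y] assms(3) by simp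
qed

text \<open>The first two terms of a series of nonnegative terms. The 1 makes division by the
  regular solution safe, and the linear growth makes bounded functions negligible against
  it.\<close>

lemma pser_jcoeff_ge:
  assumes "0 \<le> (y::real)" shows "1 + y / 2 \<le> pser jcoeff y"
proof -
  have "jcoeff (Suc 0) \<le> pser (\<lambda>m. jcoeff (Suc m)) y"
    using pser_ge_first[OF exp_bounded_Suc[OF exp_bounded_jcoeff], of y] assms
    by (simp add: jcoeff_pos less_imp_le)
  then have "y * (1 / 2) \<le> y * pser (\<lambda>m. jcoeff (Suc m)) y"
    using assms by (intro mult_left_mono) (auto simp: jcoeff_def)
  then show ?thesis
    using pser_shift[OF exp_bounded_jcoeff, of y] by (simp add: jcoeff_def)
qed

text \<open>The bound $I_0 - I_1/r \le I_1$ (here $r = \sqrt y$), by AM-GM applied to neighbouring terms.\<close>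

lemma pser_diffs_jcoeff_le:
  assumes "0 < (y::real)"
  shows "y * pser (diffs jcoeff) y \<le> sqrt y * pser jcoeff y"
proof -
  define r where "r = sqrt y"
  have r: "0 < r" "y = r\<^sup>2" using assms by (auto simp: r_def)
  have 1: "(\<lambda>m. y * (diffs jcoeff m * y ^ m)) sums (y * pser (diffs jcoeff) y)"
    using sums_mult[OF pser_sums[OF exp_bounded_diffs[OF exp_bounded_jcoeff], of y], of y]
    by simp
  have j: "(\<lambda>m. jcoeff m * y ^ m) sums pser jcoeff y"
    using pser_sums[OF exp_bounded_jcoeff, of y] by simp
  then have "(\<lambda>m. jcoeff (Suc m) * y ^ Suc m) sums (pser jcoeff y - 1)"
    by (subst sums_Suc_iff) (simp add: jcoeff_def)
  from sums_mult[OF sums_add[OF j this], of "r / 2"]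
  have 2: "(\<lambda>m. r / 2 * (jcoeff m * y ^ m + jcoeff (Suc m) * y ^ Suc m)) sums
      (r / 2 * (pser jcoeff y + (pser jcoeff y - 1)))" .
  have "y * pser (diffs jcoeff) y \<le> r / 2 * (pser jcoeff y + (pser jcoeff y - 1))"
  proof (rule sums_le[OF _ 1 2])
    fix m
    define n where "n = real (m + 1)"
    have n: "0 < n" by (simp add: n_def)
    have J: "jcoeff m = n * (n + 1) * jcoeff (Suc m)"
      using jcoeff_Suc[of m] by (simp add: n_def add_ac)
    have "0 \<le> (n - r)\<^sup>2" by simp
    then have "n * (2 * r) \<le> n\<^sup>2 + r\<^sup>2" by (simp add: power2_diff algebra_simps)
    then have "r / 2 * (n * (2 * r)) \<le> r / 2 * (n * (n + 1) + r\<^sup>2)"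
      using r n by (intro mult_left_mono) (auto simp: power2_eq_square algebra_simps)
    then have "n * y \<le> r / 2 * (n * (n + 1) + y)"
      by (simp add: r(2) power2_eq_square algebra_simps)
    then have "(n * y) * (jcoeff (Suc m) * y ^ m) \<le> (r / 2 * (n * (n + 1) + y)) * (jcoeff (Suc m) * y ^ m)"
      using assms jcoeff_pos[of "Suc m"] by (intro mult_right_mono) auto
    moreover have "diffs jcoeff m = n * jcoeff (Suc m)" by (simp add: diffs_def n_def)
    ultimately show "y * (diffs jcoeff m * y ^ m) \<le> r / 2 * (jcoeff m * y ^ m + jcoeff (Suc m) * y ^ Suc m)"
      by (simp add: J algebra_simps add_divide_distrib)
  qed
  also have "\<dots> \<le> r * pser jcoeff y" using r by (simp add: field_simps)
  finally show ?thesis by (simp add: r_def)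
qed

text \<open>Since $\psi(m+1) \approx \ln (m+1)$, the elementary bounds $1 - 1/t \le \ln t \le t - 1$ at
  $t = (m+1)/\sqrt y$ sum to multiples of $I_0$ and $I_1$; so the coefficients of the second
  solution are exactly those that make it recessive at infinity.\<close>

lemma kfun_numerator_bound:
  assumes "0 < (y::real)"
  shows "\<bar>pser jcoeff y * ln y - pser ycoeff y\<bar> \<le> (3 * sqrt y + 1) / y * pser jcoeff y"
proof -
  define r where "r = sqrt y"
  have r: "0 < r" "y = r\<^sup>2" using assms by (auto simp: r_def)
  define P where "P = pser jcoeff y"
  \<comment> \<open>In Bessel terms, I is I_0(2r) and P is I_1(2r) / r.\<close>
  define I where "I = P + y * pser (diffs jcoeff) y"
  define w where "w = (\<lambda>m. jcoeff m * y ^ m)"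
  have w0: "0 \<le> w m" for m using assms jcoeff_pos[of m] by (simp add: w_def)
  have wP: "w sums P"
    using pser_sums[OF exp_bounded_jcoeff, of y] by (simp add: w_def P_def)
  have "(\<lambda>m. y * (diffs jcoeff m * y ^ m)) sums (y * pser (diffs jcoeff) y)"
    using sums_mult[OF pser_sums[OF exp_bounded_diffs[OF exp_bounded_jcoeff], of y], of y]
    by simp
  then have "(\<lambda>m. real (Suc m) * w (Suc m)) sums (y * pser (diffs jcoeff) y)"
    by (simp add: diffs_def w_def mult_ac)
  then have "(\<lambda>m. real m * w m) sums (y * pser (diffs jcoeff) y)"
    by (subst (asm) sums_Suc_iff) simp
  from sums_add[OF this wP] have wI: "(\<lambda>m. real (m + 1) * w m) sums I"
    by (simp add: I_def algebra_simps)
  then have "(\<lambda>m. real (Suc m + 1) * w (Suc m)) sums (I - 1)"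
    by (subst sums_Suc_iff) (simp add: w_def jcoeff_def)
  from sums_mult[OF this, of "1 / y"]
  have "(\<lambda>m. 1 / y * (real (Suc m + 1) * w (Suc m))) sums ((I - 1) / y)" by simp
  \<comment> \<open>The recurrence of the coefficients turns w_m / (m+1) into (m+2) w_{m+1} / y, so
    this sum too is expressed by I.\<close>
  moreover have "1 / y * (real (Suc m + 1) * w (Suc m)) = w m / real (m + 1)" for m
    unfolding w_def jcoeff_Suc[of m, symmetric] using assms by (simp add: divide_simps)
  ultimately have wI': "(\<lambda>m. w m / real (m + 1)) sums ((I - 1) / y)" by simp
  have wQ: "(\<lambda>m. digsum m * w m) sums pser ycoeff y"
    using pser_sums[OF exp_bounded_ycoeff, of y] by (simp add: w_def ycoeff_def mult_ac)
  have wD: "(\<lambda>m. (ln y - digsum m) * w m) sums (P * ln y - pser ycoeff y)"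
    using sums_diff[OF sums_mult[OF wP, of "ln y"] wQ] by (simp add: algebra_simps)
  have lny: "ln y = 2 * ln r" using r by (simp add: ln_realpow)
  have I_le: "I \<le> (r + 1) * P"
    using pser_diffs_jcoeff_le[OF assms] by (simp add: I_def P_def r_def algebra_simps)
  have P1: "1 \<le> P" using pser_jcoeff_ge[of y] assms by (simp add: P_def)
  have upper: "(\<lambda>m. (2 * r + 1) * (w m / real (m + 1)) - 2 * w m) sums ((2 * r + 1) * ((I - 1) / y) - 2 * P)"
    by (intro sums_diff sums_mult wI' wP)
  have lower: "(\<lambda>m. 2 * w m - 2 / r * (real (m + 1) * w m) - w m / real (m + 1)) sums
      (2 * P - 2 / r * I - (I - 1) / y)"
    by (intro sums_diff sums_mult wI wI' wP)
  have dig: "\<bar>digsum m - 2 * ln (real (m + 1))\<bar> \<le> 1 / real (m + 1)" for m by (rule digsum_bounds)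
  have "P * ln y - pser ycoeff y \<le> (2 * r + 1) * ((I - 1) / y) - 2 * P"
  proof (rule sums_le[OF _ wD upper])
    fix m
    have "ln (r / real (m + 1)) \<le> r / real (m + 1) - 1"
      using r by (intro ln_le_minus_one) simp
    then have "ln r - ln (real (m + 1)) \<le> r / real (m + 1) - 1"
      using r by (simp add: ln_div)
    then have "ln y - digsum m \<le> 2 * (r / real (m + 1)) - 2 + 1 / real (m + 1)"
      using dig[of m] lny by linarith
    from mult_right_mono[OF this w0[of m]]
    show "(ln y - digsum m) * w m \<le> (2 * r + 1) * (w m / real (m + 1)) - 2 * w m"
      by (simp add: field_simps)
  qed
  also have "\<dots> \<le> (2 * r + 1) * ((r + 1) * P / y) - 2 * P"
    using r I_le assms by (intro diff_right_mono mult_left_mono divide_right_mono) auto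
  \<comment> \<open>Because y = r^2, the term 2 r^2 / y of the product cancels against -2, which
    leaves a factor of order 1 / r in front of P.\<close>
  also have "\<dots> = (3 * r + 1) / y * P"
    using r by (simp add: field_simps power2_eq_square)
  finally have up: "P * ln y - pser ycoeff y \<le> (3 * r + 1) / y * P" .
  have "2 * P - 2 / r * I - (I - 1) / y \<le> P * ln y - pser ycoeff y"
  proof (rule sums_le[OF _ lower wD])
    fix m
    have "ln (real (m + 1) / r) \<le> real (m + 1) / r - 1"
      using r by (intro ln_le_minus_one) simp
    then have "ln (real (m + 1)) - ln r \<le> real (m + 1) / r - 1"
      using r by (simp add: ln_div)
    then have "2 - 2 * (real (m + 1) / r) - 1 / real (m + 1) \<le> ln y - digsum m"
      using dig[of m] lny by linarith
    from mult_right_mono[OF this w0[of m]]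
    show "2 * w m - 2 / r * (real (m + 1) * w m) - w m / real (m + 1) \<le> (ln y - digsum m) * w m"
      by (simp add: field_simps)
  qed
  moreover have "2 * P - 2 / r * ((r + 1) * P) - (r + 1) * P / y \<le> 2 * P - 2 / r * I - (I - 1) / y"
    using r I_le assms by (intro diff_mono mult_left_mono divide_right_mono) auto
  moreover have "2 * P - 2 / r * ((r + 1) * P) - (r + 1) * P / y = - ((3 * r + 1) / y * P)"
    using r by (simp add: field_simps power2_eq_square)
  ultimately have "- ((3 * r + 1) / y * P) \<le> P * ln y - pser ycoeff y" by linarith
  with up show ?thesis by (simp add: abs_le_iff P_def r_def)
qed

text \<open>The numerator bound is already a multiple of the regular solution, so dividing leaves a
  quantity of order y^{-1/2}.\<close>

lemma kfun_ratio_tendsto: "((\<lambda>y. kfun y / pser jcoeff y) \<longlongrightarrow> 0) at_top"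
proof (rule Lim_null_comparison)
  show "\<forall>\<^sub>F y in at_top. norm (kfun y / pser jcoeff y) \<le> 1 / (2 * y) + (3 * sqrt y + 1) / y"
    using eventually_gt_at_top[of 0]
  proof eventually_elim
    case (elim y)
    define P where "P = pser jcoeff y"
    have P: "1 \<le> P" using pser_jcoeff_ge[of y] elim by (simp add: P_def)
    have *: "\<bar>A + X / 2\<bar> \<le> A + B" if "0 \<le> A" "\<bar>X\<bar> \<le> B" "0 \<le> B" for A X B :: real
      using that by linarith
    have "\<bar>P * ln y - pser ycoeff y\<bar> \<le> (3 * sqrt y + 1) / y * P"
      using kfun_numerator_bound[OF elim] by (simp add: P_def)
    moreover have "0 \<le> (3 * sqrt y + 1) / y * P" using elim P by simp
    ultimately have "\<bar>kfun y\<bar> \<le> 1 / (2 * y) + (3 * sqrt y + 1) / y * P"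
      using elim * [of "1 / (2 * y)"] by (simp only: kfun_def flip: P_def) simp
    also have "1 / (2 * y) \<le> 1 / (2 * y) * P" using elim P by (simp add: field_simps)
    finally have "\<bar>kfun y\<bar> \<le> (1 / (2 * y) + (3 * sqrt y + 1) / y) * P" by (simp add: distrib_right)
    then show ?case using P by (simp add: field_simps flip: P_def)
  qed
  show "((\<lambda>y. 1 / (2 * y) + (3 * sqrt y + 1) / y) \<longlongrightarrow> 0) at_top"
    by real_asymp
qed

section \<open>The Laplace integral for $K_1$\<close>

lemma integrable_exp_neg_abs:
  assumes "0 < (c::real)"
  shows "integrable lborel (\<lambda>x. exp (- c * \<bar>x\<bar>))"
proof -
  have *: "set_integrable lborel (einterval 0 \<infinity>) (\<lambda>x. exp (- c * x))"
  proof (rule interval_integral_FTC_nonneg(1)[where F = "\<lambda>x. - exp (- c * x) / c" and A = "- 1 / c" and B = 0])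
    show "((\<lambda>x. - exp (- c * x) / c) has_real_derivative exp (- c * x)) (at x)" for x
      using assms by (auto intro!: derivative_eq_intros)
    have "((\<lambda>x. - exp (- c * x) / c) \<longlongrightarrow> - exp (- c * 0) / c) (at_right 0)"
      by (intro tendsto_intros) (use assms in auto)
    then show "(((\<lambda>x. - exp (- c * x) / c) \<circ> real_of_ereal) \<longlongrightarrow> - 1 / c) (at_right 0)"
      unfolding zero_ereal_def by (simp add: ereal_tendsto_simps)
    have "((\<lambda>x. - exp (- c * x) / c) \<longlongrightarrow> 0) at_top"
      using assms by real_asymp
    then show "(((\<lambda>x. - exp (- c * x) / c) \<circ> real_of_ereal) \<longlongrightarrow> 0) (at_left \<infinity>)"
      by (simp add: ereal_tendsto_simps)
  qed auto
  have e: "einterval 0 \<infinity> = {0<..}" by (auto simp: einterval_def)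
  have pos: "integrable lborel (\<lambda>x. indicator {0<..} x * exp (- c * x))"
    using * by (simp add: set_integrable_def e)
  have neg: "integrable lborel (\<lambda>x. indicator {0<..} (- x) * exp (- c * (- x)))"
    using lborel_integrable_real_affine[OF pos, of "-1" 0] by simp
  have "integrable lborel (\<lambda>x. indicator {0<..} x * exp (- c * x) + indicator {0<..} (- x) * exp (- c * (- x)))"
    by (rule Bochner_Integration.integrable_add[OF pos neg])
  then show ?thesis
  proof (rule integrable_cong_AE_imp)
    show "AE x in lborel. indicator {0<..} x * exp (- c * x) + indicator {0<..} (- x) * exp (- c * (- x))
        = exp (- c * \<bar>x\<bar>)"
      using AE_lborel_singleton[of 0] by eventually_elim (auto simp: indicator_def)
  qed auto
qed

lemma power_le_fact_exp: "0 \<le> t \<Longrightarrow> t ^ n \<le> fact n * exp (t::real)"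
proof -
  assume t: "0 \<le> t"
  have "(\<Sum>m\<in>{n}. inverse (fact m) * t ^ m) \<le> (\<Sum>m. inverse (fact m) * t ^ m)"
    using t by (intro sum_le_suminf summable_exp) auto
  then show ?thesis
    by (simp add: exp_def divide_inverse[symmetric] field_simps scaleR_conv_of_real)
qed

text \<open>For n = 0 this is K_1(w) / w on Re w > 0; the power u^n arises from n differentiations
  under the integral, each contributing -u.\<close>

definition lapl :: "nat \<Rightarrow> complex \<Rightarrow> complex" where
  "lapl n w = (LINT u|lborel. indicator {1..} u *\<^sub>R (of_real (u ^ n * sqrt (u\<^sup>2 - 1)) * exp (- w * of_real u)))"

text \<open>Half of the decay absorbs the power u^{n+1}; the result depends on w only through
  \<delta>, so one majorant serves a whole half-plane.\<close>

lemma lapl_integrand_bound: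
  assumes "0 < \<delta>" "\<delta> \<le> Re w"
  shows "norm (indicator {1..} u *\<^sub>R (of_real (u ^ n * sqrt (u\<^sup>2 - 1)) * exp (- w * of_real u)))
     \<le> (2 / \<delta>) ^ (n + 1) * fact (n + 1) * exp (- (\<delta> / 2) * \<bar>u\<bar>)"
proof (cases "1 \<le> u")
  case True
  have "sqrt (u\<^sup>2 - 1) \<le> u" using True by (intro real_le_lsqrt) auto
  then have "u ^ n * sqrt (u\<^sup>2 - 1) \<le> u ^ (n + 1)" using True by (simp add: mult_left_mono)
  also have "\<dots> = (2 / \<delta>) ^ (n + 1) * (\<delta> / 2 * u) ^ (n + 1)"
    using assms by (simp add: field_simps)
  also have "\<dots> \<le> (2 / \<delta>) ^ (n + 1) * (fact (n + 1) * exp (\<delta> / 2 * u))"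
    using True assms by (intro mult_left_mono power_le_fact_exp) auto
  finally have 1: "u ^ n * sqrt (u\<^sup>2 - 1) \<le> (2 / \<delta>) ^ (n + 1) * fact (n + 1) * exp (\<delta> / 2 * u)"
    by (simp add: mult_ac)
  have "exp (- (Re w * u)) \<le> exp (- (\<delta> * u))" using True assms by simp
  then have "u ^ n * sqrt (u\<^sup>2 - 1) * exp (- (Re w * u))
      \<le> ((2 / \<delta>) ^ (n + 1) * fact (n + 1) * exp (\<delta> / 2 * u)) * exp (- (\<delta> * u))"
    by (rule mult_mono[OF 1]) (use True assms in auto)
  also have "\<dots> = (2 / \<delta>) ^ (n + 1) * fact (n + 1) * exp (\<delta> / 2 * u + - (\<delta> * u))"
    by (simp only: exp_add mult_ac)
  also have "\<delta> / 2 * u + - (\<delta> * u) = - (\<delta> / 2) * \<bar>u\<bar>" using True by simp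
  finally show ?thesis using True by (simp add: norm_mult abs_mult del: of_real_mult of_real_power)
qed (use assms in auto)

lemma lapl_integrable:
  assumes "0 < Re w"
  shows "integrable lborel (\<lambda>u. indicator {1..} u *\<^sub>R (of_real (u ^ n * sqrt (u\<^sup>2 - 1)) * exp (- w * of_real u)))"
proof (rule Bochner_Integration.integrable_bound)
  show "integrable lborel (\<lambda>u. (2 / Re w) ^ (n + 1) * fact (n + 1) * exp (- (Re w / 2) * \<bar>u\<bar>))"
    using assms by (intro integrable_mult_right integrable_exp_neg_abs) auto
  show "AE u in lborel. norm (indicator {1..} u *\<^sub>R (of_real (u ^ n * sqrt (u\<^sup>2 - 1)) * exp (- w * of_real u)))
      \<le> norm ((2 / Re w) ^ (n + 1) * fact (n + 1) * exp (- (Re w / 2) * \<bar>u\<bar>))"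
    using lapl_integrand_bound[OF assms order_refl] assms by (intro AE_I2) (simp add: abs_mult)
qed measurable

lemma lapl_bound:
  assumes "0 < \<delta>" "\<delta> \<le> Re w"
  shows "norm (lapl n w) \<le> (2 / \<delta>) ^ (n + 1) * fact (n + 1) * (LINT u|lborel. exp (- (\<delta> / 2) * \<bar>u\<bar>))"
proof -
  have "norm (lapl n w) \<le> (LINT u|lborel. (2 / \<delta>) ^ (n + 1) * fact (n + 1) * exp (- (\<delta> / 2) * \<bar>u\<bar>))"
    unfolding lapl_def
    using assms by (intro Bochner_Integration.integral_norm_bound_integral lapl_integrable
        integrable_mult_right integrable_exp_neg_abs lapl_integrand_bound) auto
  then show ?thesis by simp
qed

lemma norm_exp_minus_one_le: "cmod (exp z - 1) \<le> exp (cmod z) * cmod z"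
proof -
  have "cmod (exp z - exp 0) \<le> exp (cmod z) * cmod (z - 0)"
  proof (rule field_differentiable_bound[of "cball 0 (cmod z)" exp exp])
    show "cmod (exp w) \<le> exp (cmod z)" if "w \<in> cball 0 (cmod z)" for w
      using that abs_Re_le_cmod[of w] by (auto simp: abs_le_iff)
  qed (auto intro!: derivative_eq_intros)
  then show ?thesis by simp
qed

lemma lapl_deriv:
  assumes "0 < Re w"
  shows "(lapl n has_field_derivative - lapl (Suc n) w) (at w)"
proof -
  \<comment> \<open>Within distance \<delta> of w the real part stays above \<delta>, so a single
    majorant covers all difference quotients.\<close>
  define \<delta> where "\<delta> = Re w / 2"
  have \<delta>: "0 < \<delta>" using assms by (simp add: \<delta>_def)
  let ?g = "\<lambda>n w u. indicator {1..} u *\<^sub>R (of_real (u ^ n * sqrt (u\<^sup>2 - 1)) * exp (- w * of_real u)) :: complex"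
  have "((\<lambda>h. (lapl n (w + h) - lapl n w) / h) \<longlongrightarrow> - lapl (Suc n) w) (at 0 within ball 0 \<delta>)"
    unfolding tendsto_at_iff_sequentially comp_def
  proof (intro allI impI)
    fix h :: "nat \<Rightarrow> complex" assume h: "\<forall>i. h i \<in> ball 0 \<delta> - {0}" and lim: "h \<longlonglongrightarrow> 0"
    have Re: "\<delta> \<le> Re w - cmod (h i)" for i using h[rule_format, of i] by (simp add: \<delta>_def)
    have Re': "0 < Re (w + h i)" for i
      using Re[of i] abs_Re_le_cmod[of "h i"] \<delta> by simp
    have "(\<lambda>i. LINT u|lborel. (?g n (w + h i) u - ?g n w u) / h i) \<longlonglongrightarrow> (LINT u|lborel. - ?g (Suc n) w u)"
    proof (rule integral_dominated_convergence)
      show "integrable lborel (\<lambda>u. (2 / \<delta>) ^ (Suc n + 1) * fact (Suc n + 1) * exp (- (\<delta> / 2) * \<bar>u\<bar>))"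
        using \<delta> by (intro integrable_mult_right integrable_exp_neg_abs) auto
      show "AE u in lborel. (\<lambda>i. (?g n (w + h i) u - ?g n w u) / h i) \<longlonglongrightarrow> - ?g (Suc n) w u"
      proof (intro AE_I2)
        fix u :: real
        have "((\<lambda>w. exp (- w * of_real u)) has_field_derivative - of_real u * exp (- w * of_real u)) (at w)"
          by (auto intro!: derivative_eq_intros)
        then have "((\<lambda>k. (exp (- (w + k) * of_real u) - exp (- w * of_real u)) / k) \<longlongrightarrow>
             - of_real u * exp (- w * of_real u)) (at 0)" by (simp only: DERIV_def)
        then have "(\<lambda>i. (exp (- (w + h i) * of_real u) - exp (- w * of_real u)) / h i) \<longlonglongrightarrow>
             - of_real u * exp (- w * of_real u)"
          using h lim by (auto simp: tendsto_at_iff_sequentially comp_def)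
        then have "(\<lambda>i. indicator {1..} u *\<^sub>R (of_real (u ^ n * sqrt (u\<^sup>2 - 1)) *
             ((exp (- (w + h i) * of_real u) - exp (- w * of_real u)) / h i))) \<longlonglongrightarrow>
             indicator {1..} u *\<^sub>R (of_real (u ^ n * sqrt (u\<^sup>2 - 1)) * (- of_real u * exp (- w * of_real u)))"
          by (intro tendsto_intros)
        then show "(\<lambda>i. (?g n (w + h i) u - ?g n w u) / h i) \<longlonglongrightarrow> - ?g (Suc n) w u"
          by (cases "1 \<le> u") (simp_all add: algebra_simps diff_divide_distrib)
      qed
      show "AE u in lborel. norm ((?g n (w + h i) u - ?g n w u) / h i)
          \<le> (2 / \<delta>) ^ (Suc n + 1) * fact (Suc n + 1) * exp (- (\<delta> / 2) * \<bar>u\<bar>)" for i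
      proof (intro AE_I2)
        fix u :: real
        show "norm ((?g n (w + h i) u - ?g n w u) / h i)
          \<le> (2 / \<delta>) ^ (Suc n + 1) * fact (Suc n + 1) * exp (- (\<delta> / 2) * \<bar>u\<bar>)"
        proof (cases "1 \<le> u")
          case True
          have hi: "h i \<noteq> 0" using h by auto
          define z where "z = - h i * of_real u"
          have nz: "cmod z = cmod (h i) * u" using True by (simp add: z_def norm_mult)
          have "?g n (w + h i) u - ?g n w u
              = of_real (u ^ n * sqrt (u\<^sup>2 - 1)) * exp (- w * of_real u) * (exp z - 1)"
            using True by (simp add: z_def algebra_simps exp_add exp_diff exp_minus divide_inverse)
          then have "norm ((?g n (w + h i) u - ?g n w u) / h i)
              = u ^ n * sqrt (u\<^sup>2 - 1) * exp (- (Re w * u)) * (cmod (exp z - 1) / cmod (h i))"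
            using True by (simp add: norm_mult norm_divide norm_power abs_mult)
          also have "\<dots> \<le> u ^ n * sqrt (u\<^sup>2 - 1) * exp (- (Re w * u)) * (exp (cmod (h i) * u) * u)"
          proof (intro mult_left_mono)
            show "cmod (exp z - 1) / cmod (h i) \<le> exp (cmod (h i) * u) * u"
              using norm_exp_minus_one_le[of z] hi by (simp add: nz field_simps)
          qed (use True in auto)
          \<comment> \<open>The factor exp (|h| u) is paid for by lowering the real part of the
            argument by |h|, the factor u by raising n; the general bound then applies to this
            shifted integrand.\<close>
          also have "\<dots> = norm (?g (Suc n) (of_real (Re w - cmod (h i))) u)"
            using True by (simp add: norm_mult norm_power abs_mult algebra_simps flip: exp_add)
          also have "\<dots> \<le> (2 / \<delta>) ^ (Suc n + 1) * fact (Suc n + 1) * exp (- (\<delta> / 2) * \<bar>u\<bar>)"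
            by (rule lapl_integrand_bound[OF \<delta>]) (simp add: Re)
          finally show ?thesis .
        qed (use \<delta> in auto)
      qed
    qed measurable
    moreover have "(LINT u|lborel. (?g n (w + h i) u - ?g n w u) / h i) = (lapl n (w + h i) - lapl n w) / h i" for i
      unfolding lapl_def
      by (subst integral_divide_zero, subst Bochner_Integration.integral_diff)
         (rule lapl_integrable Re' assms refl)+
    moreover have "(LINT u|lborel. - ?g (Suc n) w u) = - lapl (Suc n) w"
      unfolding lapl_def by simp
    ultimately show "(\<lambda>i. (lapl n (w + h i) - lapl n w) / h i) \<longlonglongrightarrow> - lapl (Suc n) w"
      by (simp only:)
  qed
  then show ?thesis
    using \<delta> by (simp add: DERIV_def at_within_open[of 0 "ball 0 \<delta>"])
qed

definition rlapl :: "nat \<Rightarrow> real \<Rightarrow> real" where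
  "rlapl n x = Re (lapl n (of_real x))"

lemma rlapl_eq:
  assumes "0 < x"
  shows "rlapl n x = (LINT u|lborel. indicator {1..} u * (u ^ n * sqrt (u\<^sup>2 - 1) * exp (- x * u)))"
    and "integrable lborel (\<lambda>u. indicator {1..} u * (u ^ n * sqrt (u\<^sup>2 - 1) * exp (- x * u)))"
    and "lapl n (of_real x) = of_real (rlapl n x)"
proof -
  have eq: "(indicator {1..} u *\<^sub>R (of_real (u ^ n * sqrt (u\<^sup>2 - 1)) * exp (- of_real x * of_real u)))
      = complex_of_real (indicator {1..} u * (u ^ n * sqrt (u\<^sup>2 - 1) * exp (- x * u)))" for u
    by (simp add: scaleR_conv_of_real exp_of_real flip: of_real_mult of_real_minus)
  have int: "integrable lborel (\<lambda>u. complex_of_real (indicator {1..} u * (u ^ n * sqrt (u\<^sup>2 - 1) * exp (- x * u))))"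
    using lapl_integrable[of "of_real x" n] assms unfolding eq by simp
  have lapl: "lapl n (of_real x) = of_real (LINT u|lborel. indicator {1..} u * (u ^ n * sqrt (u\<^sup>2 - 1) * exp (- x * u)))"
    unfolding lapl_def eq by (rule integral_complex_of_real)
  then show "rlapl n x = (LINT u|lborel. indicator {1..} u * (u ^ n * sqrt (u\<^sup>2 - 1) * exp (- x * u)))"
    by (simp add: rlapl_def)
  then show "lapl n (of_real x) = of_real (rlapl n x)" using lapl by simp
  show "integrable lborel (\<lambda>u. indicator {1..} u * (u ^ n * sqrt (u\<^sup>2 - 1) * exp (- x * u)))"
    using integrable_Re[OF int] by simp
qed

lemma rlapl_deriv:
  assumes "0 < x"
  shows "(rlapl n has_real_derivative - rlapl (Suc n) x) (at x)"
proof -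
  have "((\<lambda>x. lapl n (of_real x)) has_vector_derivative - lapl (Suc n) (of_real x)) (at x)"
    using assms by (intro has_vector_derivative_real_field lapl_deriv) simp
  from bounded_linear.has_vector_derivative[OF bounded_linear_Re this]
  show ?thesis
    by (simp add: rlapl_def[abs_def] has_real_derivative_iff_has_vector_derivative)
qed

text \<open>The combined integrand is the derivative of -exp (- x u) (u^2 - 1)^{3/2}, which vanishes
  at 1 and at infinity. As \<open>rlapl n\<close> is up to sign the n-th derivative of
  \<open>rlapl 0\<close>, this is the modified Bessel equation written for K_1(x) / x.\<close>

lemma rlapl_recurrence:
  assumes x: "0 < x"
  shows "x * rlapl 2 x - 3 * rlapl 1 x - x * rlapl 0 x = 0"
proof -
  define f where "f = (\<lambda>u. (x * (u\<^sup>2 - 1) - 3 * u) * sqrt (u\<^sup>2 - 1) * exp (- x * u))"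
  let ?g = "\<lambda>n u. indicator {1..} u * (u ^ n * sqrt (u\<^sup>2 - 1) * exp (- x * u))"
  have int: "integrable lborel (\<lambda>u. x * ?g 2 u - 3 * ?g 1 u - x * ?g 0 u)"
    using x by (intro Bochner_Integration.integrable_diff integrable_mult_right rlapl_eq(2))
  have eq: "x * ?g 2 u - 3 * ?g 1 u - x * ?g 0 u = indicator {1..} u *\<^sub>R f u" for u
    by (cases "1 \<le> u") (auto simp: f_def algebra_simps)
  have "x * rlapl 2 x - 3 * rlapl 1 x - x * rlapl 0 x = (LINT u|lborel. x * ?g 2 u - 3 * ?g 1 u - x * ?g 0 u)"
  proof -
    have hb: "has_bochner_integral lborel (?g n) (rlapl n x)" for n
      using has_bochner_integral_integrable[OF rlapl_eq(2)[OF x]] by (simp only: rlapl_eq(1)[OF x])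
    show ?thesis
      by (rule sym, rule has_bochner_integral_integral_eq,
          intro has_bochner_integral_diff has_bochner_integral_mult_right hb)
  qed
  also have "\<dots> = (LINT u|lborel. indicator (einterval (ereal 1) \<infinity>) u *\<^sub>R f u)"
  proof (rule integral_cong_AE)
    show "AE u in lborel. x * ?g 2 u - 3 * ?g 1 u - x * ?g 0 u = indicator (einterval (ereal 1) \<infinity>) u *\<^sub>R f u"
      using AE_lborel_singleton[of 1] unfolding eq
      by eventually_elim (auto simp: indicator_def einterval_def)
  next
    show "(\<lambda>u. x * ?g 2 u - 3 * ?g 1 u - x * ?g 0 u) \<in> borel_measurable lborel"
      by (rule borel_measurable_integrable[OF int])
    show "(\<lambda>u. indicator (einterval (ereal 1) \<infinity>) u *\<^sub>R f u) \<in> borel_measurable lborel"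
      unfolding f_def by measurable
  qed
  also have "\<dots> = (LBINT u=ereal 1..\<infinity>. f u)"
    by (simp add: interval_lebesgue_integral_def set_lebesgue_integral_def)
  also have "\<dots> = 0 - 0"
  proof (rule interval_integral_FTC_integrable[where F = "\<lambda>u. - exp (- x * u) * ((u\<^sup>2 - 1) * sqrt (u\<^sup>2 - 1))"])
    show "((\<lambda>u. - exp (- x * u) * ((u\<^sup>2 - 1) * sqrt (u\<^sup>2 - 1))) has_vector_derivative f u) (at u)"
      if "ereal 1 < ereal u" for u
    proof -
      have u: "1 < u" using that by simp
      then have pos: "0 < u\<^sup>2 - 1" by simp
      have d1: "((\<lambda>u. u\<^sup>2 - 1) has_real_derivative 2 * u) (at u)"
        by (auto intro!: derivative_eq_intros)
      have d2: "((\<lambda>u. sqrt (u\<^sup>2 - 1)) has_real_derivative inverse (sqrt (u\<^sup>2 - 1)) / 2 * (2 * u)) (at u)"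
        by (rule DERIV_chain2[where f = sqrt and g = "\<lambda>u. u\<^sup>2 - 1", OF DERIV_real_sqrt[OF pos] d1])
      have d3: "((\<lambda>u. - exp (- x * u)) has_real_derivative x * exp (- x * u)) (at u)"
        by (auto intro!: derivative_eq_intros)
      have "(inverse (sqrt (u\<^sup>2 - 1)) / 2 * (2 * u)) * (u\<^sup>2 - 1) = u * ((u\<^sup>2 - 1) / sqrt (u\<^sup>2 - 1))"
        by (simp add: inverse_eq_divide)
      also have "(u\<^sup>2 - 1) / sqrt (u\<^sup>2 - 1) = sqrt (u\<^sup>2 - 1)"
        by (rule real_div_sqrt[OF less_imp_le[OF pos]])
      finally have key: "(inverse (sqrt (u\<^sup>2 - 1)) / 2 * (2 * u)) * (u\<^sup>2 - 1) = u * sqrt (u\<^sup>2 - 1)" .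
      have fu: "x * exp (- x * u) * ((u\<^sup>2 - 1) * sqrt (u\<^sup>2 - 1))
          + (2 * u * sqrt (u\<^sup>2 - 1) + (inverse (sqrt (u\<^sup>2 - 1)) / 2 * (2 * u)) * (u\<^sup>2 - 1)) * (- exp (- x * u)) = f u"
        unfolding key f_def by (simp add: algebra_simps)
      have "((\<lambda>u. - exp (- x * u) * ((u\<^sup>2 - 1) * sqrt (u\<^sup>2 - 1))) has_real_derivative f u) (at u)"
        by (rule DERIV_cong[OF DERIV_mult[OF d3 DERIV_mult[OF d1 d2]] fu])
      then show ?thesis by (simp add: has_real_derivative_iff_has_vector_derivative)
    qed
    show "isCont f u" for u unfolding f_def by (intro continuous_intros)
    have "integrable lborel (\<lambda>u. indicator (einterval (ereal 1) \<infinity>) u *\<^sub>R (indicator {1..} u *\<^sub>R f u))"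
      by (rule integrable_mult_indicator[OF _ int[unfolded eq]]) simp
    moreover have "indicator (einterval (ereal 1) \<infinity>) u *\<^sub>R (indicator {1..} u *\<^sub>R f u) = indicator (einterval (ereal 1) \<infinity>) u *\<^sub>R f u" for u
      by (auto simp: indicator_def einterval_def)
    ultimately show "set_integrable lborel (einterval (ereal 1) \<infinity>) f"
      unfolding set_integrable_def by (simp only:)
    have "((\<lambda>u. - exp (- x * u) * ((u\<^sup>2 - 1) * sqrt (u\<^sup>2 - 1))) \<longlongrightarrow> - exp (- x * 1) * ((1\<^sup>2 - 1) * sqrt (1\<^sup>2 - 1))) (at_right 1)"
      by (intro tendsto_intros)
    then show "(((\<lambda>u. - exp (- x * u) * ((u\<^sup>2 - 1) * sqrt (u\<^sup>2 - 1))) \<circ> real_of_ereal) \<longlongrightarrow> 0) (at_right (ereal 1))"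
      by (simp add: ereal_tendsto_simps)
    have "((\<lambda>u. - exp (- x * u) * ((u\<^sup>2 - 1) * sqrt (u\<^sup>2 - 1))) \<longlongrightarrow> 0) at_top"
      using x by real_asymp
    then show "(((\<lambda>u. - exp (- x * u) * ((u\<^sup>2 - 1) * sqrt (u\<^sup>2 - 1))) \<circ> real_of_ereal) \<longlongrightarrow> 0) (at_left \<infinity>)"
      by (simp add: ereal_tendsto_simps)
  qed auto
  finally show ?thesis by simp
qed

text \<open>Rules out the zero solution when the factor of proportionality is determined.\<close>

lemma rlapl_pos:
  assumes "0 < x" shows "0 < rlapl 0 x"
proof -
  have "0 \<le> rlapl 0 x"
    unfolding rlapl_eq(1)[OF assms] by (intro Bochner_Integration.integral_nonneg) (auto simp: indicator_def)
  moreover have "rlapl 0 x \<noteq> 0"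
  proof
    assume "rlapl 0 x = 0"
    then have "AE u in lborel. indicator {1..} u * (u ^ 0 * sqrt (u\<^sup>2 - 1) * exp (- x * u)) = 0"
      using integral_nonneg_eq_0_iff_AE[OF rlapl_eq(2)[OF assms, of 0]]
      unfolding rlapl_eq(1)[OF assms] by (auto simp: indicator_def)
    then have "AE u in lborel. u \<notin> {2<..<3::real}"
      by eventually_elim (auto simp: indicator_def power2_eq_1_iff)
    then have "emeasure lborel {2<..<3::real} = 0"
      by (subst (asm) AE_iff_measurable[of "{2<..<3}"]) auto
    then show False by simp
  qed
  ultimately show ?thesis by simp
qed

section \<open>Identification of the two recessive solutions\<close>

text \<open>The substitution x = 2 sqrt y passes to the variable of the power series, so that both
  candidates for K_1 satisfy literally the same equation.\<close>

definition lfun :: "real \<Rightarrow> real" where "lfun y = rlapl 0 (2 * sqrt y)"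
definition lfun' :: "real \<Rightarrow> real" where "lfun' y = - rlapl 1 (2 * sqrt y) / sqrt y"

lemma lfun_deriv:
  assumes "0 < y" shows "(lfun has_real_derivative lfun' y) (at y)"
proof -
  have "((\<lambda>y. rlapl 0 (2 * sqrt y)) has_real_derivative - rlapl (Suc 0) (2 * sqrt y) * (2 * (inverse (sqrt y) / 2))) (at y)"
    using assms by (intro DERIV_chain2[OF rlapl_deriv] derivative_intros DERIV_cmult DERIV_real_sqrt) auto
  then show ?thesis using assms by (simp add: lfun_def[abs_def] lfun'_def inverse_eq_divide)
qed

lemma lfun_ode:
  assumes y: "0 < y" shows "((\<lambda>y. y\<^sup>2 * lfun' y) has_real_derivative y * lfun y) (at y)"
proof -
  define r where "r = sqrt y"
  have r: "0 < r" "y = r\<^sup>2" using y by (auto simp: r_def)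
  have "((\<lambda>y. - (sqrt y ^ 3 * rlapl 1 (2 * sqrt y))) has_real_derivative
      - ((3 * sqrt y ^ 2 * (inverse (sqrt y) / 2)) * rlapl 1 (2 * sqrt y)
         + sqrt y ^ 3 * (- rlapl (Suc 1) (2 * sqrt y) * (2 * (inverse (sqrt y) / 2))))) (at y)"
    using y by (auto intro!: derivative_eq_intros DERIV_chain2[OF rlapl_deriv])
  also have "- ((3 * sqrt y ^ 2 * (inverse (sqrt y) / 2)) * rlapl 1 (2 * sqrt y)
         + sqrt y ^ 3 * (- rlapl (Suc 1) (2 * sqrt y) * (2 * (inverse (sqrt y) / 2))))
      = r / 2 * (2 * r * rlapl 2 (2 * r) - 3 * rlapl 1 (2 * r))"
    using r(1) unfolding r_def[symmetric] Suc_1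
    by (simp add: field_simps power2_eq_square power3_eq_cube)
  also have "\<dots> = y * lfun y"
    using rlapl_recurrence[of "2 * r"] r
    by (simp add: lfun_def algebra_simps power2_eq_square)
  finally have "((\<lambda>y. - (sqrt y ^ 3 * rlapl 1 (2 * sqrt y))) has_real_derivative y * lfun y) (at y)" .
  moreover have "\<forall>\<^sub>F x in nhds y. - (sqrt x ^ 3 * rlapl 1 (2 * sqrt x)) = x\<^sup>2 * lfun' x"
    using eventually_nhds_in_open[of "{0<..}" y] y
  proof (auto elim!: eventually_mono)
    fix x :: real assume x: "0 < x"
    have "x\<^sup>2 = sqrt x ^ 3 * sqrt x" using x by (simp add: power3_eq_cube power2_eq_square)
    then show "- (sqrt x ^ 3 * rlapl (Suc 0) (2 * sqrt x)) = x\<^sup>2 * lfun' x"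
      using x by (simp add: lfun'_def)
  qed
  ultimately show ?thesis by (subst (asm) DERIV_cong_ev) auto
qed

text \<open>Boundedness on Re w >= 1 is enough, because the regular solution grows at least
  linearly.\<close>

lemma lfun_ratio_tendsto: "((\<lambda>y. lfun y / pser jcoeff y) \<longlongrightarrow> 0) at_top"
proof -
  obtain C where C: "\<And>w. 1 \<le> Re w \<Longrightarrow> norm (lapl 0 w) \<le> C"
    using lapl_bound[of 1 _ 0] by auto
  show ?thesis
  proof (rule Lim_null_comparison)
    show "\<forall>\<^sub>F y in at_top. norm (lfun y / pser jcoeff y) \<le> C / (1 + y / 2)"
      using eventually_ge_at_top[of 1]
    proof eventually_elim
      case (elim y)
      have "\<bar>lfun y\<bar> \<le> cmod (lapl 0 (of_real (2 * sqrt y)))"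
        by (simp only: lfun_def rlapl_def abs_Re_le_cmod)
      also have "\<dots> \<le> C" using elim by (intro C) (auto intro: order.trans[of 1 2])
      finally have "\<bar>lfun y\<bar> \<le> C" .
      moreover have "1 + y / 2 \<le> pser jcoeff y" using elim by (intro pser_jcoeff_ge) simp
      ultimately show ?case using elim
        by (simp add: abs_divide frac_le)
    qed
    show "((\<lambda>y. C / (1 + y / 2)) \<longlongrightarrow> 0) at_top" by real_asymp
  qed
qed

text \<open>The constant is $y^2$ times the Wronskian of $f$ and the power series.\<close>

lemma solution_ratio_deriv:
  assumes f: "\<And>y. 0 < y \<Longrightarrow> (f has_real_derivative f' y) (at y)"
    and ode: "\<And>y. 0 < y \<Longrightarrow> ((\<lambda>y. y\<^sup>2 * f' y) has_real_derivative y * f y) (at y)"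
  obtains c where
    "\<And>y. 0 < y \<Longrightarrow> ((\<lambda>y. f y / pser jcoeff y) has_real_derivative c / (y * pser jcoeff y)\<^sup>2) (at y)"
proof -
  let ?P = "pser jcoeff :: real \<Rightarrow> real" and ?P' = "pser (diffs jcoeff) :: real \<Rightarrow> real"
  define W where "W = (\<lambda>y. y\<^sup>2 * f' y * ?P y - f y * (y\<^sup>2 * ?P' y))"
  have "\<exists>c. \<forall>y\<in>{0<..}. W y = c"
  proof (rule has_field_derivative_zero_constant)
    fix y :: real assume "y \<in> {0<..}"
    then have y: "0 < y" by simp
    have "(W has_real_derivative (y * f y * ?P y + ?P' y * (y\<^sup>2 * f' y))
        - (f' y * (y\<^sup>2 * ?P' y) + y * ?P y * f y)) (at y)"
      unfolding W_def
      by (intro DERIV_diff DERIV_mult f[OF y] ode[OF y] pser_jcoeff_ode has_field_derivative_pser exp_bounded_jcoeff)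
    then show "(W has_field_derivative 0) (at y within {0<..})"
      by (auto intro: DERIV_subset simp: algebra_simps)
  qed simp
  then obtain c where c: "\<And>y. 0 < y \<Longrightarrow> W y = c" by auto
  show ?thesis
  proof
    fix y :: real assume y: "0 < y"
    have P: "1 \<le> ?P y" using pser_jcoeff_ge[of y] y by simp
    have "((\<lambda>y. f y / ?P y) has_real_derivative (f' y * ?P y - f y * ?P' y) / (?P y * ?P y)) (at y)"
      using P by (intro DERIV_divide f[OF y] has_field_derivative_pser exp_bounded_jcoeff) auto
    also have "(f' y * ?P y - f y * ?P' y) / (?P y * ?P y) = W y / (y * ?P y)\<^sup>2"
      using y P by (simp add: W_def power2_eq_square field_simps)
    finally show "((\<lambda>y. f y / ?P y) has_real_derivative c / (y * ?P y)\<^sup>2) (at y)"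
      by (simp add: c[OF y])
  qed
qed

text \<open>Both quotients by the regular solution have derivatives proportional to the same
  function, so one linear combination of them is constant, and the limits at infinity make the
  constant 0.\<close>

lemma kfun_eq_lfun: obtains \<alpha> where "\<And>y. 0 < y \<Longrightarrow> kfun y = \<alpha> * lfun y"
proof -
  let ?P = "pser jcoeff :: real \<Rightarrow> real"
  obtain c1 where c1: "\<And>y. 0 < y \<Longrightarrow> ((\<lambda>y. lfun y / ?P y) has_real_derivative c1 / (y * ?P y)\<^sup>2) (at y)"
    using solution_ratio_deriv[OF lfun_deriv lfun_ode] by blast
  obtain c2 where c2: "\<And>y. 0 < y \<Longrightarrow> ((\<lambda>y. kfun y / ?P y) has_real_derivative c2 / (y * ?P y)\<^sup>2) (at y)"
    using solution_ratio_deriv[OF kfun_deriv kfun_ode] by blast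
  have "\<exists>d. \<forall>y\<in>{0<..}. c1 * (kfun y / ?P y) - c2 * (lfun y / ?P y) = d"
  proof (rule has_field_derivative_zero_constant)
    fix y :: real assume "y \<in> {0<..}"
    then have y: "0 < y" by simp
    have "((\<lambda>y. c1 * (kfun y / ?P y) - c2 * (lfun y / ?P y)) has_real_derivative
        c1 * (c2 / (y * ?P y)\<^sup>2) - c2 * (c1 / (y * ?P y)\<^sup>2)) (at y)"
      by (intro DERIV_diff DERIV_cmult c1[OF y] c2[OF y])
    then show "((\<lambda>y. c1 * (kfun y / ?P y) - c2 * (lfun y / ?P y)) has_field_derivative 0) (at y within {0<..})"
      by (auto intro: DERIV_subset)
  qed simp
  then obtain d where d: "\<And>y. 0 < y \<Longrightarrow> c1 * (kfun y / ?P y) - c2 * (lfun y / ?P y) = d" by auto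
  have "((\<lambda>y. c1 * (kfun y / ?P y) - c2 * (lfun y / ?P y)) \<longlongrightarrow> c1 * 0 - c2 * 0) at_top"
    by (intro tendsto_intros kfun_ratio_tendsto lfun_ratio_tendsto)
  moreover have "((\<lambda>y. c1 * (kfun y / ?P y) - c2 * (lfun y / ?P y)) \<longlongrightarrow> d) at_top"
    by (rule tendsto_eventually) (rule eventually_mono[OF eventually_gt_at_top[of 0]], rule d)
  ultimately have "d = 0" using tendsto_unique[OF trivial_limit_at_top_linorder] by fastforce
  have P: "?P y \<noteq> 0" if "0 < y" for y using pser_jcoeff_ge[of y] that by simp
  have rel: "c1 * kfun y = c2 * lfun y" if "0 < y" for y
    using d[OF that] \<open>d = 0\<close> P[OF that] by (simp add: field_simps)
  \<comment> \<open>Otherwise \<open>lfun\<close> would be a multiple of the regular solution, and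
    its limit behaviour would force it to be 0.\<close>
  have "c1 \<noteq> 0"
  proof
    assume "c1 = 0"
    have "\<exists>d. \<forall>y\<in>{0<..}. lfun y / ?P y = d"
      by (rule has_field_derivative_zero_constant)
         (use c1 \<open>c1 = 0\<close> in \<open>auto intro: DERIV_subset\<close>)
    then obtain d where d: "\<And>y. 0 < y \<Longrightarrow> lfun y / ?P y = d" by auto
    have "((\<lambda>y. lfun y / ?P y) \<longlongrightarrow> d) at_top"
      by (rule tendsto_eventually) (rule eventually_mono[OF eventually_gt_at_top[of 0]], rule d)
    then have "d = 0" using lfun_ratio_tendsto tendsto_unique[OF trivial_limit_at_top_linorder] by blast
    then show False using d[of 1] rlapl_pos[of 2] P[of 1] by (simp add: lfun_def)
  qed
  with rel show ?thesis by (intro that[of "c2 / c1"]) (simp add: field_simps)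
qed

section \<open>Estimates for the Hankel function\<close>

lemma of_real_jcoeff: "complex_of_real (jcoeff m) = 1 / of_nat (fact m * fact (m + 1))"
  by (simp add: jcoeff_def algebra_simps)

text \<open>The alternating signs are absorbed in the argument -(z^2 / 4), so the coefficients of
  I_1 serve for J_1 as well.\<close>

lemma besselJ1_pser: "besselJ1 z = z / 2 * pser jcoeff (- (z\<^sup>2 / 4))"
proof -
  have "(\<lambda>m. z / 2 * (of_real (jcoeff m) * (- (z\<^sup>2 / 4)) ^ m)) sums (z / 2 * pser jcoeff (- (z\<^sup>2 / 4)))"
    by (intro sums_mult pser_sums exp_bounded_jcoeff)
  moreover have "z / 2 * (of_real (jcoeff m) * (- (z\<^sup>2 / 4)) ^ m)
      = (-1) ^ m * (z / 2) ^ (2 * m + 1) / of_nat (fact m * fact (m + 1))" for m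
  proof -
    have "- (z\<^sup>2 / 4) = (-1) * (z / 2)\<^sup>2" by (simp add: power_divide)
    then have "(- (z\<^sup>2 / 4)) ^ m = (-1) ^ m * (z / 2) ^ (2 * m)"
      by (simp only: power_mult_distrib power_mult)
    then show ?thesis unfolding of_real_jcoeff by (simp add: mult_ac del: of_nat_mult fact_Suc)
  qed
  ultimately show ?thesis by (simp only: besselJ1_def sums_iff)
qed

lemma besselY1_pser:
  "besselY1 z = of_real (2 / pi) * besselJ1 z * Ln (z / 2) - of_real (2 / pi) / z
     - of_real (1 / pi) * (z / 2 * pser ycoeff (- (z\<^sup>2 / 4)))"
proof -
  have "(\<lambda>m. z / 2 * (of_real (ycoeff m) * (- (z\<^sup>2 / 4)) ^ m)) sums (z / 2 * pser ycoeff (- (z\<^sup>2 / 4)))"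
    by (intro sums_mult pser_sums exp_bounded_ycoeff)
  moreover have "z / 2 * (of_real (ycoeff m) * (- (z\<^sup>2 / 4)) ^ m)
      = (-1) ^ m * of_real (Digamma (real (m + 1)) + Digamma (real (m + 2)))
          * (z / 2) ^ (2 * m + 1) / of_nat (fact m * fact (m + 1))" for m
  proof -
    have "- (z\<^sup>2 / 4) = (-1) * (z / 2)\<^sup>2" by (simp add: power_divide)
    then have "(- (z\<^sup>2 / 4)) ^ m = (-1) ^ m * (z / 2) ^ (2 * m)"
      by (simp only: power_mult_distrib power_mult)
    moreover define d where "d = Digamma (real (m + 1)) + Digamma (real (m + 2))"
    moreover have "complex_of_real (ycoeff m) = of_real d * (1 / of_nat (fact m * fact (m + 1)))"
      by (simp only: ycoeff_def digsum_def d_def of_real_mult of_real_jcoeff)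
    ultimately show ?thesis
      unfolding d_def[symmetric] by (simp add: mult_ac del: of_nat_mult fact_Suc)
  qed
  ultimately show ?thesis by (simp only: besselY1_def sums_iff)
qed

lemma hankel1_pser:
  "hankel1 z = z / 2 * pser jcoeff (- (z\<^sup>2 / 4)) * (1 + 2 * \<i> / of_real pi * Ln (z / 2))
     - 2 * \<i> / (of_real pi * z) - \<i> / of_real pi * (z / 2) * pser ycoeff (- (z\<^sup>2 / 4))"
  unfolding hankel1_def besselY1_pser besselJ1_pser by (simp add: algebra_simps)

text \<open>On a disc the two power series are bounded, and the logarithm occurs only multiplied by
  z. Since Im Ln stays in (-pi, pi], the bound also holds across the branch cut.\<close>

lemma hankel1_near_zero:
  assumes "0 < M"
  obtains C where "\<And>z. z \<noteq> 0 \<Longrightarrow> cmod z \<le> M \<Longrightarrow> cmod (hankel1 z + 2 * \<i> / (of_real pi * z)) \<le> C"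
proof -
  have "compact (cball 0 (M\<^sup>2 / 4) :: complex set)" by simp
  then have "bounded (pser jcoeff ` cball (0::complex) (M\<^sup>2 / 4))" "bounded (pser ycoeff ` cball (0::complex) (M\<^sup>2 / 4))"
    by (intro compact_imp_bounded compact_continuous_image continuous_on_pser
        exp_bounded_jcoeff exp_bounded_ycoeff; simp)+
  then obtain A B where A: "\<And>y::complex. cmod y \<le> M\<^sup>2 / 4 \<Longrightarrow> cmod (pser jcoeff y) \<le> A"
    and B: "\<And>y::complex. cmod y \<le> M\<^sup>2 / 4 \<Longrightarrow> cmod (pser ycoeff y) \<le> B"
    unfolding bounded_iff by fastforce
  have AB: "0 \<le> A" "0 \<le> B" using order.trans[OF norm_ge_zero A[of 0]] order.trans[OF norm_ge_zero B[of 0]] assms by auto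
  show ?thesis
  proof (rule that)
    fix z :: complex assume z: "z \<noteq> 0" "cmod z \<le> M"
    define y where "y = - (z\<^sup>2 / 4)"
    define t where "t = cmod z / 2"
    have t: "0 < t" "t \<le> M" using z assms by (auto simp: t_def)
    have y: "cmod y \<le> M\<^sup>2 / 4" using z by (simp add: y_def norm_divide norm_power power_mono)
    \<comment> \<open>Chosen so that multiplication by t gives t^2 + 1, which stays bounded down to
      t = 0.\<close>
    have "\<bar>ln t\<bar> \<le> t + 1 / t"
    proof -
      have "ln t \<le> t" using t by (intro ln_bound) auto
      moreover have "- ln t \<le> 1 / t" using ln_bound[of "1 / t"] t by (simp add: ln_div)
      moreover have "0 < 1 / t" using t by simp
      ultimately show ?thesis using t(1) unfolding abs_le_iff by linarith
    qed
    then have tl: "t * \<bar>ln t\<bar> \<le> M\<^sup>2 + 1"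
    proof -
      have "t * \<bar>ln t\<bar> \<le> t * (t + 1 / t)" using \<open>\<bar>ln t\<bar> \<le> t + 1 / t\<close> t by (intro mult_left_mono) auto
      also have "\<dots> = t\<^sup>2 + 1" using t by (simp add: field_simps power2_eq_square)
      also have "\<dots> \<le> M\<^sup>2 + 1" using t by (simp add: power_mono)
      finally show ?thesis .
    qed
    have "cmod (Ln (z / 2)) \<le> \<bar>Re (Ln (z / 2))\<bar> + \<bar>Im (Ln (z / 2))\<bar>" by (rule cmod_le)
    also have "\<dots> \<le> \<bar>ln t\<bar> + pi"
      using z mpi_less_Im_Ln[of "z / 2"] Im_Ln_le_pi[of "z / 2"] by (auto simp: t_def norm_divide)
    finally have L: "cmod (Ln (z / 2)) \<le> \<bar>ln t\<bar> + pi" .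
    have "cmod (1 + 2 * \<i> / of_real pi * Ln (z / 2)) \<le> 1 + 2 / pi * (\<bar>ln t\<bar> + pi)"
      by (rule order.trans[OF norm_triangle_ineq]) (use L in \<open>simp add: norm_mult norm_divide divide_right_mono\<close>)
    also have "\<dots> \<le> 1 + 1 * (\<bar>ln t\<bar> + pi)"
      using pi_ge_two by (intro add_left_mono mult_right_mono) auto
    finally have "t * cmod (1 + 2 * \<i> / of_real pi * Ln (z / 2)) \<le> t * (1 + 1 * (\<bar>ln t\<bar> + pi))"
      using t by (intro mult_left_mono) auto
    also have "\<dots> \<le> M * (1 + pi) + (M\<^sup>2 + 1)"
    proof -
      have "t * (1 + pi) \<le> M * (1 + pi)" using t by (intro mult_right_mono) (auto intro: add_nonneg_nonneg)
      then show ?thesis using tl by (simp add: algebra_simps)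
    qed
    finally have "t * cmod (1 + 2 * \<i> / of_real pi * Ln (z / 2)) \<le> M * (1 + pi) + (M\<^sup>2 + 1)" .
    then have "cmod (pser jcoeff y) * (t * cmod (1 + 2 * \<i> / of_real pi * Ln (z / 2))) \<le> A * (M * (1 + pi) + (M\<^sup>2 + 1))"
      by (intro mult_mono A[OF y] AB) (use t in auto)
    then have 1: "cmod (z / 2 * pser jcoeff y * (1 + 2 * \<i> / of_real pi * Ln (z / 2))) \<le> A * (M * (1 + pi) + (M\<^sup>2 + 1))"
      by (simp only: norm_mult norm_divide t_def norm_numeral mult_ac)
    have "1 / pi * t \<le> 1 * M" using t pi_ge_two by (intro mult_mono) auto
    then have 2: "cmod (\<i> / of_real pi * (z / 2) * pser ycoeff y) \<le> M * B"
      using mult_mono[OF _ B[OF y], of "1 / pi * t" M] assms by (simp add: norm_mult norm_divide t_def)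
    have "hankel1 z + 2 * \<i> / (of_real pi * z) = z / 2 * pser jcoeff y * (1 + 2 * \<i> / of_real pi * Ln (z / 2))
        - \<i> / of_real pi * (z / 2) * pser ycoeff y"
      by (simp add: hankel1_pser y_def)
    then show "cmod (hankel1 z + 2 * \<i> / (of_real pi * z)) \<le> A * (M * (1 + pi) + (M\<^sup>2 + 1)) + M * B"
      using order.trans[OF norm_triangle_ineq4 add_mono[OF 1 2]] by simp
  qed
qed

lemma hankel1_holomorphic: "hankel1 holomorphic_on {z. 0 < Im z}"
proof -
  have P: "pser c holomorphic_on A" if "exp_bounded c" for c and A :: "complex set"
    unfolding holomorphic_on_def field_differentiable_def
    using has_field_derivative_pser[OF that] by (blast intro: has_field_derivative_at_within)
  have comp: "(\<lambda>z. pser c (- (z\<^sup>2 / 4))) holomorphic_on A" if "exp_bounded c" for c and A :: "complex set"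
    using holomorphic_on_compose[of "\<lambda>z. - (z\<^sup>2 / 4)" A "pser c"] P[OF that]
    by (simp add: o_def holomorphic_intros)
  have "z / 2 \<notin> \<real>\<^sub>\<le>\<^sub>0" if "0 < Im z" for z
    using that by (auto simp: complex_nonpos_Reals_iff)
  moreover have "z \<noteq> 0" if "0 < Im z" for z using that by auto
  ultimately show ?thesis
    unfolding hankel1_pser[abs_def]
    by (intro holomorphic_intros comp exp_bounded_jcoeff exp_bounded_ycoeff) auto
qed

lemma lapl_holomorphic: "lapl n holomorphic_on {w. 0 < Re w}"
  unfolding holomorphic_on_def field_differentiable_def
  using lapl_deriv by (blast intro: has_field_derivative_at_within)

text \<open>The logarithm of i x / 2 has imaginary part pi / 2, and 2 i / pi times i pi / 2 is -1:
  this cancels the contribution of J_1. So precisely the combination J_1 + i Y_1 reduces to the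
  recessive solution.\<close>

lemma hankel1_imaginary:
  assumes "0 < x"
  shows "hankel1 (\<i> * of_real x) = - of_real (x / pi * kfun (x\<^sup>2 / 4))"
proof -
  have y: "- ((\<i> * of_real x)\<^sup>2 / 4) = complex_of_real (x\<^sup>2 / 4)"
    by (simp add: power_mult_distrib)
  have L: "Ln (\<i> * of_real x / 2) = of_real (ln (x / 2)) + \<i> * of_real (pi / 2)"
    using Ln_times_ii[of "of_real (x / 2)"] Ln_of_real[of "x / 2"] assms by (simp add: mult.commute)
  have l: "ln (x\<^sup>2 / 4) = 2 * ln (x / 2)"
    using assms ln_realpow[of "x / 2" 2] by (simp add: power_divide)
  define P where "P = pser jcoeff (x\<^sup>2 / 4)"
  define Q where "Q = pser ycoeff (x\<^sup>2 / 4)"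
  define l where "l = ln (x / 2)"
  have e1: "1 + 2 * \<i> / of_real pi * (of_real l + \<i> * of_real (pi / 2)) = \<i> * of_real (2 / pi * l)"
    by (simp add: field_simps)
  have e2: "2 * \<i> / (of_real pi * (\<i> * of_real x)) = of_real (2 / (pi * x))"
    by simp
  have "hankel1 (\<i> * of_real x) = \<i> * of_real x / 2 * of_real P * (\<i> * of_real (2 / pi * l))
      - of_real (2 / (pi * x)) - \<i> / of_real pi * (\<i> * of_real x / 2) * of_real Q"
    unfolding hankel1_pser y L pser_of_real[OF exp_bounded_jcoeff] pser_of_real[OF exp_bounded_ycoeff]
      P_def[symmetric] Q_def[symmetric] l_def[symmetric] e1 e2 by simp
  also have "\<dots> = of_real (- (x / 2 * P * (2 / pi * l)) - 2 / (pi * x) + x / (2 * pi) * Q)"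
    by (simp add: complex_eq_iff)
  also have "- (x / 2 * P * (2 / pi * l)) - 2 / (pi * x) + x / (2 * pi) * Q = - (x / pi * kfun (x\<^sup>2 / 4))"
    unfolding kfun_def l P_def[symmetric] Q_def[symmetric] l_def[symmetric]
    using assms by (simp add: divide_simps power2_eq_square) (simp add: algebra_simps)
  finally show ?thesis by simp
qed

lemma hankel1_eq_lapl:
  obtains \<beta> where "\<And>z. 0 < Im z \<Longrightarrow> hankel1 z = \<beta> * z * lapl 0 (- \<i> * z)"
proof -
  obtain \<alpha> where \<alpha>: "\<And>y. 0 < y \<Longrightarrow> kfun y = \<alpha> * lfun y" by (rule kfun_eq_lfun) blast
  \<comment> \<open>The values at i x are -(x / pi) times \<open>kfun\<close>, and \<beta> (i x) =
    -(x / pi) \<alpha>; this fixes the constant.\<close>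
  define \<beta> where "\<beta> = \<i> * of_real (\<alpha> / pi)"
  define U where "U = (\<lambda>x. \<i> * complex_of_real x) ` {0<..}"
  have "hankel1 z - \<beta> * z * lapl 0 (- \<i> * z) = 0" if z: "0 < Im z" for z
  proof (rule analytic_continuation[where f = "\<lambda>z. hankel1 z - \<beta> * z * lapl 0 (- \<i> * z)" and w = z and S = "{z. 0 < Im z}" and U = U and \<xi> = \<i>])
    have "(\<lambda>z. lapl 0 (- \<i> * z)) holomorphic_on {z. 0 < Im z}"
    proof (rule holomorphic_on_compose_gen[of "\<lambda>z. - \<i> * z" _ "lapl 0", unfolded o_def])
      show "(\<lambda>z. - \<i> * z) holomorphic_on {z. 0 < Im z}" by (intro holomorphic_intros)
      show "lapl 0 holomorphic_on {w. 0 < Re w}" by (rule lapl_holomorphic)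
    qed auto
    then show "(\<lambda>z. hankel1 z - \<beta> * z * lapl 0 (- \<i> * z)) holomorphic_on {z. 0 < Im z}"
      by (intro holomorphic_intros hankel1_holomorphic)
    show "open {z. 0 < Im z}" by (rule open_halfspace_Im_gt)
    show "connected {z. 0 < Im z}" by (intro convex_connected convex_halfspace_Im_gt)
    show "U \<subseteq> {z. 0 < Im z}" by (auto simp: U_def)
    \<comment> \<open>A connected set with two points has no isolated ones, so i is a limit point of
      the half-axis.\<close>
    have "connected U" unfolding U_def
      by (intro connected_continuous_image continuous_intros convex_connected) auto
    moreover have "\<i> \<in> U" "2 * \<i> \<in> U"
      by (auto simp: U_def intro!: image_eqI[of _ _ 1] image_eqI[of _ _ 2])
    moreover have "2 * \<i> \<noteq> \<i>" by (simp add: complex_eq_iff)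
    ultimately show "\<i> islimpt U" by (intro connected_imp_perfect) auto
    fix w assume "w \<in> U"
    then obtain x where x: "0 < x" "w = \<i> * of_real x" by (auto simp: U_def)
    have "lfun (x\<^sup>2 / 4) = rlapl 0 x" using x by (simp add: lfun_def real_sqrt_divide)
    then have "kfun (x\<^sup>2 / 4) = \<alpha> * rlapl 0 x" using \<alpha>[of "x\<^sup>2 / 4"] x by simp
    then have "hankel1 w = - of_real (x / pi * (\<alpha> * rlapl 0 x))"
      using hankel1_imaginary[OF x(1)] x(2) by simp
    moreover have "lapl 0 (- \<i> * w) = of_real (rlapl 0 x)" using x by (simp add: rlapl_eq(3))
    moreover have "\<beta> * w = - of_real (x / pi * \<alpha>)" by (simp add: \<beta>_def x(2) complex_eq_iff)
    ultimately show "hankel1 w - \<beta> * w * lapl 0 (- \<i> * w) = 0" by simp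
  qed (use z in auto)
  then show ?thesis by (intro that[of \<beta>]) simp
qed

text \<open>For u >= 1 half of the exponent already yields exp (- Re w / 2), and the other half
  keeps the integral bounded; this accounts for the 1/2 in the rate.\<close>

lemma hankel1_decay:
  obtains C where "0 \<le> C" "\<And>z. 1 \<le> Im z \<Longrightarrow> cmod (hankel1 z) \<le> C * cmod z * exp (- Im z / 2)"
proof -
  obtain \<beta> where \<beta>: "\<And>z. 0 < Im z \<Longrightarrow> hankel1 z = \<beta> * z * lapl 0 (- \<i> * z)"
    by (rule hankel1_eq_lapl) blast
  \<comment> \<open>The bound starts at Re w = 1/2 because it is used at half of a real part that is
    at least 1.\<close>
  obtain D where D: "\<And>w. 1 / 2 \<le> Re w \<Longrightarrow> norm (lapl 0 w) \<le> D"
    using lapl_bound[of "1 / 2" _ 0] by auto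
  have D0: "0 \<le> D" using order.trans[OF norm_ge_zero D[of 1]] by simp
  have lapl: "norm (lapl 0 w) \<le> exp (- Re w / 2) * D" if w: "1 \<le> Re w" for w
  proof -
    let ?x = "Re w / 2"
    have "norm (lapl 0 w) \<le> (LINT u|lborel. exp (- ?x) * (indicator {1..} u * (u ^ 0 * sqrt (u\<^sup>2 - 1) * exp (- ?x * u))))"
      unfolding lapl_def
    proof (intro Bochner_Integration.integral_norm_bound_integral lapl_integrable integrable_mult_right rlapl_eq(2))
      fix u :: real
      have "exp (- (Re w * u)) \<le> exp (- ?x) * exp (- ?x * u)" if "1 \<le> u"
      proof -
        have "Re w / 2 * 1 \<le> Re w / 2 * u" using that w by (intro mult_left_mono) auto
        then show ?thesis by (simp flip: exp_add)
      qed
      then show "norm (indicator {1..} u *\<^sub>R (of_real (u ^ 0 * sqrt (u\<^sup>2 - 1)) * exp (- w * of_real u)))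
          \<le> exp (- ?x) * (indicator {1..} u * (u ^ 0 * sqrt (u\<^sup>2 - 1) * exp (- ?x * u)))"
        using mult_left_mono[of "exp (- (Re w * u))" "exp (- ?x) * exp (- ?x * u)" "sqrt (u\<^sup>2 - 1)"]
        by (auto simp: indicator_def norm_mult abs_mult mult_ac)
    qed (use w in auto)
    also have "\<dots> = exp (- ?x) * rlapl 0 ?x" using w by (simp add: rlapl_eq(1))
    also have "\<dots> \<le> exp (- ?x) * D"
      using D[of "of_real ?x"] w complex_Re_le_cmod[of "lapl 0 (of_real ?x)"]
      by (intro mult_left_mono) (auto simp: rlapl_def)
    finally show ?thesis by simp
  qed
  show ?thesis
  proof (rule that[of "cmod \<beta> * D"])
    fix z assume z: "1 \<le> Im z"
    have "cmod (hankel1 z) = cmod \<beta> * cmod z * norm (lapl 0 (- \<i> * z))"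
      using \<beta>[of z] z by (simp add: norm_mult)
    also have "\<dots> \<le> cmod \<beta> * cmod z * (exp (- Im z / 2) * D)"
      using lapl[of "- \<i> * z"] z by (intro mult_left_mono) auto
    finally show "cmod (hankel1 z) \<le> cmod \<beta> * D * cmod z * exp (- Im z / 2)" by (simp add: mult_ac)
  qed (use D0 in simp)
qed

text \<open>The added term cancels the pole at 0, where 1 - exp (-r) <= r makes the damping
  harmless, and it is itself exponentially small at infinity. One inequality thus covers both
  regimes, as the compact remainder requires.\<close>

lemma hankel1_estimate:
  assumes "0 < \<eta>" "\<eta> \<le> 1" "0 < M"
  obtains C c where "0 < c" "0 \<le> C"
    "\<And>Z. 0 < Im Z \<Longrightarrow> (M \<le> cmod Z \<Longrightarrow> \<eta> * cmod Z \<le> Im Z) \<Longrightarrow>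
       cmod (hankel1 Z + 2 * \<i> * of_real (exp (- cmod Z)) / (of_real pi * Z)) \<le> C * exp (- c * cmod Z)"
proof -
  \<comment> \<open>Beyond 1 / \<eta> the sector condition gives Im Z >= 1, where the decay estimate
    starts.\<close>
  define N where "N = max M (1 / \<eta>)"
  have N: "0 < N" "M \<le> N" "1 / \<eta> \<le> N" using assms by (auto simp: N_def)
  obtain C1 where C1: "\<And>z. z \<noteq> 0 \<Longrightarrow> cmod z \<le> N \<Longrightarrow> cmod (hankel1 z + 2 * \<i> / (of_real pi * z)) \<le> C1"
    using hankel1_near_zero[OF N(1)] by blast
  obtain C2 where C2: "0 \<le> C2" "\<And>z. 1 \<le> Im z \<Longrightarrow> cmod (hankel1 z) \<le> C2 * cmod z * exp (- Im z / 2)"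
    by (rule hankel1_decay) blast
  \<comment> \<open>The sector turns exp (- Im Z / 2) into the rate \<eta> / 2 = 2 c; half of it
    absorbs the linear factor |Z|.\<close>
  define c where "c = \<eta> / 4"
  have c: "0 < c" "c \<le> 1" "4 * c = \<eta>" using assms by (auto simp: c_def)
  have C10: "0 \<le> C1" using order.trans[OF norm_ge_zero C1[of "of_real N"]] N by simp
  \<comment> \<open>The factor exp (c N) makes up for exp (- c r) on the bounded region r <= N; the
    second summand serves r > N.\<close>
  define C where "C = (C1 + 1) * exp (c * N) + (C2 / c + 1 / N)"
  show ?thesis
  proof (rule that[of c C])
    show "0 \<le> C" using C10 C2(1) c N by (simp add: C_def)
    fix Z assume Z: "0 < Im Z" and far: "M \<le> cmod Z \<Longrightarrow> \<eta> * cmod Z \<le> Im Z"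
    define r where "r = cmod Z"
    have Z0: "Z \<noteq> 0" using Z by auto
    then have r: "0 < r" by (simp add: r_def)
    show "cmod (hankel1 Z + 2 * \<i> * of_real (exp (- cmod Z)) / (of_real pi * Z)) \<le> C * exp (- c * cmod Z)"
    proof (cases "r \<le> N")
      case True
      have "1 - exp (- r) \<le> r" using exp_ge_add_one_self[of "- r"] by simp
      have "2 * \<i> * of_real (exp (- r)) / (of_real pi * Z) - 2 * \<i> / (of_real pi * Z)
          = 2 * \<i> * of_real (exp (- r) - 1) / (of_real pi * Z)"
        by (simp add: algebra_simps diff_divide_distrib)
      moreover have "cmod (2 * \<i> * of_real (exp (- r) - 1) / (of_real pi * Z)) = 2 / pi * ((1 - exp (- r)) / r)"
        using r by (simp add: norm_mult norm_divide r_def del: of_real_diff)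
      moreover have "\<dots> \<le> 1 * 1"
        using pi_ge_two r \<open>1 - exp (- r) \<le> r\<close> by (intro mult_mono) auto
      ultimately have "cmod (2 * \<i> * of_real (exp (- r)) / (of_real pi * Z) - 2 * \<i> / (of_real pi * Z)) \<le> 1"
        by simp
      moreover have "cmod (hankel1 Z + 2 * \<i> / (of_real pi * Z)) \<le> C1"
        using C1[OF Z0] True by (simp add: r_def)
      moreover have "hankel1 Z + 2 * \<i> * of_real (exp (- r)) / (of_real pi * Z)
        = (hankel1 Z + 2 * \<i> / (of_real pi * Z)) + (2 * \<i> * of_real (exp (- r)) / (of_real pi * Z) - 2 * \<i> / (of_real pi * Z))"
        by simp
      ultimately have "cmod (hankel1 Z + 2 * \<i> * of_real (exp (- r)) / (of_real pi * Z)) \<le> C1 + 1"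
        by (metis add.commute norm_triangle_mono)
      also have "\<dots> \<le> (C1 + 1) * exp (c * N) * exp (- c * r)"
      proof -
        have "1 \<le> exp (c * N - c * r)" using True c by (simp add: mult_left_mono)
        then have "(C1 + 1) * 1 \<le> (C1 + 1) * exp (c * N - c * r)" using C10 by (intro mult_left_mono) auto
        then show ?thesis by (simp add: exp_diff exp_minus field_simps)
      qed
      also have "\<dots> \<le> C * exp (- c * r)"
        unfolding C_def using C2(1) c N by (intro mult_right_mono) auto
      finally show ?thesis by (simp add: r_def)
    next
      case False
      then have rN: "N < r" by simp
      have Im: "\<eta> * r \<le> Im Z" using far rN N by (simp add: r_def)
      have "1 \<le> \<eta> * N" using N assms by (simp add: field_simps)
      also have "\<dots> \<le> \<eta> * r" using rN assms by (intro mult_left_mono) auto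
      finally have "1 \<le> \<eta> * r" .
      then have "1 \<le> Im Z" using Im by simp
      have "cmod (hankel1 Z) \<le> C2 * r * exp (- Im Z / 2)"
        using C2(2)[OF \<open>1 \<le> Im Z\<close>] by (simp add: r_def)
      also have "\<dots> \<le> C2 * r * exp (- (2 * c) * r)"
        using Im C2(1) r c(3) by (intro mult_left_mono) auto
      also have "\<dots> \<le> C2 / c * exp (- c * r)"
      proof -
        have "c * r \<le> exp (c * r)" using exp_ge_add_one_self[of "c * r"] by linarith
        then have "C2 / c * exp (- (2 * c) * r) * (c * r) \<le> C2 / c * exp (- (2 * c) * r) * exp (c * r)"
          using C2(1) c by (intro mult_left_mono) auto
        then show ?thesis using c by (simp add: mult_ac mult.assoc flip: exp_add)
      qed
      finally have 1: "cmod (hankel1 Z) \<le> C2 / c * exp (- c * r)" .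
      have "cmod (2 * \<i> * of_real (exp (- r)) / (of_real pi * Z)) = 2 / pi * (1 / r * exp (- r))"
        by (simp add: norm_mult norm_divide r_def)
      also have "\<dots> \<le> 1 * (1 / N * exp (- c * r))"
        using pi_ge_two rN N r c by (intro mult_mono frac_le) auto
      finally have "cmod (2 * \<i> * of_real (exp (- r)) / (of_real pi * Z)) \<le> 1 / N * exp (- c * r)" by simp
      then have "cmod (hankel1 Z + 2 * \<i> * of_real (exp (- r)) / (of_real pi * Z)) \<le> (C2 / c + 1 / N) * exp (- c * r)"
        using order.trans[OF norm_triangle_ineq add_mono[OF 1]] by (simp add: distrib_right)
      also have "\<dots> \<le> C * exp (- c * r)"
        unfolding C_def using C10 by (intro mult_right_mono) auto
      finally show ?thesis by (simp add: r_def)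
    qed
  qed (rule c)
qed

section \<open>Estimates for the kernel\<close>

text \<open>Along the complexified line $a - \tau_\theta(s) = \pm(p + v e^{i\theta})$ with $p, v \ge 0$ and
  $p + v = |s-a|$, so all three branches of $\tau_\theta$ lead to the same estimates.\<close>

definition real_part :: "real \<Rightarrow> real \<Rightarrow> real" where
  "real_part a s = (if s < - a then 2 * a else if s \<le> a then a - s else 0)"

definition rotated_part :: "real \<Rightarrow> real \<Rightarrow> real" where
  "rotated_part a s = (if s < - a then - a - s else if s \<le> a then 0 else s - a)"

lemma path_parts:
  assumes "0 < a"
  shows "0 \<le> real_part a s" "real_part a s \<le> 2 * a" "0 \<le> rotated_part a s"
    "real_part a s + rotated_part a s = \<bar>s - a\<bar>"
  using assms by (auto simp: real_part_def rotated_part_def)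

text \<open>Only the square enters \<open>Rad\<close>, so the change of sign of a - \<tau>(s) at s =
  a disappears.\<close>

lemma path_square:
  "(of_real a - tau a \<theta> s)\<^sup>2 = (of_real (real_part a s) + of_real (rotated_part a s) * cis \<theta>)\<^sup>2"
proof (cases "a < s \<and> \<not> s < - a")
  case True
  then have "of_real a - tau a \<theta> s = - (of_real (rotated_part a s) * cis \<theta>)" "real_part a s = 0"
    by (auto simp: tau_def real_part_def rotated_part_def)
  then show ?thesis by simp
next
  case False
  then have "of_real a - tau a \<theta> s = of_real (real_part a s) + of_real (rotated_part a s) * cis \<theta>"
    by (auto simp: tau_def real_part_def rotated_part_def algebra_simps)
  then show ?thesis by simp
qed

lemma sin_double_pos: "0 < \<theta> \<Longrightarrow> \<theta> < pi / 2 \<Longrightarrow> 0 < sin (2 * \<theta>)"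
  by (rule sin_gt_zero) auto

text \<open>X is a combination with nonnegative coefficients of e^{2i\<theta>}, e^{i\<theta>} and 1.
  All three lie within the angle \<theta> < pi/2 of e^{i\<theta>}, which gives the lower bounds;
  none lies below the real axis and the first lies strictly above, so the principal root is in the
  open first quadrant. The last claim compares Im X = 2 Re R Im R <= 2 |R| Im R with Im X >=
  sin(2\<theta>) |R|^2 / 8.\<close>

lemma complexified_radius:
  fixes \<theta> u p v :: real
  assumes \<theta>: "0 < \<theta>" "\<theta> < pi / 2" and u: "0 < u" and p: "0 \<le> p" and v: "0 \<le> v"
  defines "X \<equiv> (of_real u * cis \<theta>)\<^sup>2 + (of_real p + of_real v * cis \<theta>)\<^sup>2"
  shows "0 < Im X" "0 < Re (csqrt X)" "0 < Im (csqrt X)"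
    "cos \<theta> / 2 * (u\<^sup>2 + (p + v)\<^sup>2) \<le> (cmod (csqrt X))\<^sup>2"
    "sqrt (cos \<theta>) / 2 * (u + (p + v)) \<le> cmod (csqrt X)"
    "\<lbrakk>p \<le> 2 * a; 4 * a \<le> cmod (csqrt X); 0 < a\<rbrakk> \<Longrightarrow> sin (2 * \<theta>) / 16 * cmod (csqrt X) \<le> Im (csqrt X)"
proof -
  define R where "R = csqrt X"
  have R2: "R\<^sup>2 = X" by (simp add: R_def)
  have s: "0 < sin \<theta>" "0 < cos \<theta>" using \<theta> by (auto intro: sin_gt_zero cos_gt_zero)
  have s2: "0 < sin (2 * \<theta>)" using sin_double_pos[OF \<theta>] .
  have ReX: "Re X = (u\<^sup>2 + v\<^sup>2) * ((cos \<theta>)\<^sup>2 - (sin \<theta>)\<^sup>2) + 2 * p * v * cos \<theta> + p\<^sup>2"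
    by (simp add: X_def power2_eq_square algebra_simps)
  have ImX: "Im X = (u\<^sup>2 + v\<^sup>2) * sin (2 * \<theta>) + 2 * p * v * sin \<theta>"
    unfolding sin_double by (simp add: X_def power2_eq_square algebra_simps)
  show ImX0: "0 < Im X"
    unfolding ImX using u p v s s2 by (intro add_pos_nonneg mult_pos_pos) (auto intro: add_pos_nonneg)
  have "Im X = 2 * Re R * Im R" by (simp add: power2_eq_square flip: R2)
  moreover have "0 \<le> Re R" using csqrt_principal[of X] by (auto simp: R_def)
  ultimately show RR: "0 < Re (csqrt X)" "0 < Im (csqrt X)"
    using ImX0 by (auto simp: zero_less_mult_iff simp flip: R_def)
  have absX: "cmod X = (cmod R)\<^sup>2" by (simp add: norm_power flip: R2)
  have cs: "(cos \<theta>)\<^sup>2 + (sin \<theta>)\<^sup>2 = 1" by simp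
  \<comment> \<open>Projection of X on the direction e^{i\<theta>}: every summand contributes a
    nonnegative amount, so nothing cancels.\<close>
  have "Re (X * cnj (cis \<theta>)) = (u\<^sup>2 + v\<^sup>2) * cos \<theta> * ((cos \<theta>)\<^sup>2 + (sin \<theta>)\<^sup>2) + 2 * p * v * ((cos \<theta>)\<^sup>2 + (sin \<theta>)\<^sup>2) + p\<^sup>2 * cos \<theta>"
  proof -
    have "((u\<^sup>2 + v\<^sup>2) * (C\<^sup>2 - S\<^sup>2) + 2 * p * v * C + p\<^sup>2) * C + ((u\<^sup>2 + v\<^sup>2) * (2 * S * C) + 2 * p * v * S) * S
      = (u\<^sup>2 + v\<^sup>2) * C * (C\<^sup>2 + S\<^sup>2) + 2 * p * v * (C\<^sup>2 + S\<^sup>2) + p\<^sup>2 * C" for C S :: real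
      by algebra
    moreover have "Re (X * cnj (cis \<theta>)) = Re X * cos \<theta> + Im X * sin \<theta>" by simp
    ultimately show ?thesis by (simp only: ReX ImX sin_double)
  qed
  then have "(u\<^sup>2 + v\<^sup>2 + p\<^sup>2) * cos \<theta> + 2 * p * v = Re (X * cnj (cis \<theta>))"
    unfolding cs by (simp add: algebra_simps)
  also have "\<dots> \<le> cmod (X * cnj (cis \<theta>))" by (rule complex_Re_le_cmod)
  also have "\<dots> = (cmod R)\<^sup>2" by (simp add: norm_mult absX)
  finally have "(u\<^sup>2 + v\<^sup>2 + p\<^sup>2) * cos \<theta> + 2 * p * v \<le> (cmod R)\<^sup>2" .
  moreover have "0 \<le> 2 * p * v" using p v by simp
  moreover have "cos \<theta> / 2 * (u\<^sup>2 + (p + v)\<^sup>2) \<le> (u\<^sup>2 + v\<^sup>2 + p\<^sup>2) * cos \<theta>"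
  proof -
    have "0 \<le> (p - v)\<^sup>2 + u\<^sup>2" by simp
    then have "u\<^sup>2 + (p + v)\<^sup>2 \<le> 2 * (u\<^sup>2 + v\<^sup>2 + p\<^sup>2)" by (simp add: power2_eq_square algebra_simps)
    then have "cos \<theta> / 2 * (u\<^sup>2 + (p + v)\<^sup>2) \<le> cos \<theta> / 2 * (2 * (u\<^sup>2 + v\<^sup>2 + p\<^sup>2))"
      using s by (intro mult_left_mono) auto
    then show ?thesis by (simp add: algebra_simps)
  qed
  ultimately show low: "cos \<theta> / 2 * (u\<^sup>2 + (p + v)\<^sup>2) \<le> (cmod (csqrt X))\<^sup>2"
    unfolding R_def[symmetric] by linarith
  show "sqrt (cos \<theta>) / 2 * (u + (p + v)) \<le> cmod (csqrt X)"
  proof (rule power2_le_imp_le)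
    have "0 \<le> (u - (p + v))\<^sup>2" by simp
    then have "(u + (p + v))\<^sup>2 \<le> 2 * (u\<^sup>2 + (p + v)\<^sup>2)" by (simp add: power2_eq_square algebra_simps)
    then have "cos \<theta> / 4 * (u + (p + v))\<^sup>2 \<le> cos \<theta> / 4 * (2 * (u\<^sup>2 + (p + v)\<^sup>2))"
      using s by (intro mult_left_mono) auto
    also have "\<dots> = cos \<theta> / 2 * (u\<^sup>2 + (p + v)\<^sup>2)" by simp
    also note low
    finally show "(sqrt (cos \<theta>) / 2 * (u + (p + v)))\<^sup>2 \<le> (cmod (csqrt X))\<^sup>2"
      using s by (simp add: power_mult_distrib power_divide)
  qed simp
  assume a: "p \<le> 2 * a" "4 * a \<le> cmod (csqrt X)" "0 < a"
  define r where "r = cmod R"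
  have r: "4 * a \<le> r" "0 < r" using a by (auto simp: r_def R_def)
  have "r\<^sup>2 \<le> (u + (p + v))\<^sup>2"
  proof -
    have "cmod X \<le> (cmod (of_real u * cis \<theta>))\<^sup>2 + (cmod (of_real p + of_real v * cis \<theta>))\<^sup>2"
      unfolding X_def norm_power[symmetric] by (rule norm_triangle_ineq)
    also have "\<dots> \<le> u\<^sup>2 + (p + v)\<^sup>2"
      using norm_triangle_ineq[of "of_real p" "of_real v * cis \<theta>"] u p v
      by (intro add_mono power_mono) (auto simp: norm_mult)
    also have "\<dots> \<le> (u + (p + v))\<^sup>2" using u p v by (simp add: power2_eq_square algebra_simps)
    finally show ?thesis by (simp add: absX r_def)
  qed
  then have "r \<le> u + (p + v)" using u p v by (intro power2_le_imp_le[of r]) auto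
  \<comment> \<open>From |R| = 4 a on, p <= 2 a <= r / 2: the real segment accounts for at most half
    of the length, and the rotated parts must carry the rest.\<close>
  then have "r / 2 \<le> u + v" using r a by linarith
  then have "(r / 2)\<^sup>2 \<le> (u + v)\<^sup>2" using r by (intro power_mono) auto
  also have "\<dots> \<le> 2 * (u\<^sup>2 + v\<^sup>2)"
  proof -
    have "0 \<le> (u - v)\<^sup>2" by simp
    then show ?thesis by (simp add: power2_eq_square algebra_simps)
  qed
  finally have "r\<^sup>2 / 8 \<le> u\<^sup>2 + v\<^sup>2" by (simp add: power_divide)
  then have "r\<^sup>2 / 8 * sin (2 * \<theta>) \<le> (u\<^sup>2 + v\<^sup>2) * sin (2 * \<theta>)"
    using s2 by (intro mult_right_mono) auto
  also have "\<dots> \<le> Im X" unfolding ImX using p v s by simp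
  also have "\<dots> = 2 * Re R * Im R" by fact
  also have "\<dots> \<le> 2 * r * Im R"
    using RR complex_Re_le_cmod[of R] by (intro mult_right_mono) (auto simp: r_def R_def)
  finally have "r * (sin (2 * \<theta>) / 16 * r) \<le> r * Im R" by (simp add: power2_eq_square mult_ac)
  then show "sin (2 * \<theta>) / 16 * cmod (csqrt X) \<le> Im (csqrt X)"
    using r by (simp add: r_def R_def)
qed

abbreviation path_Rad :: "real \<Rightarrow> real \<Rightarrow> real \<Rightarrow> real \<Rightarrow> complex" where
  "path_Rad a \<theta> t s \<equiv> Rad (tau a \<theta> t - of_real a) (of_real a - tau a \<theta> s)"

abbreviation path_hker :: "real \<Rightarrow> real \<Rightarrow> real \<Rightarrow> real \<Rightarrow> real \<Rightarrow> complex" where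
  "path_hker a k \<theta> t s \<equiv> hker k (tau a \<theta> t - of_real a) (of_real a - tau a \<theta> s)"

lemma tau_minus:
  "0 < a \<Longrightarrow> a < t \<Longrightarrow> tau a \<theta> t - of_real a = of_real (t - a) * cis \<theta>"
  by (simp add: tau_def)

lemma Rad_tau:
  assumes "0 < a" "a < t"
  shows "path_Rad a \<theta> t s
    = csqrt ((of_real (t - a) * cis \<theta>)\<^sup>2 + (of_real (real_part a s) + of_real (rotated_part a s) * cis \<theta>)\<^sup>2)"
  unfolding Rad_def path_square tau_minus[OF assms] ..

definition sing_kernel :: "real \<Rightarrow> real \<Rightarrow> real \<Rightarrow> real \<Rightarrow> real" where
  "sing_kernel a k t s = (t - a) / (pi * ((t - a)\<^sup>2 + (s - a)\<^sup>2)) * exp (- k * sqrt ((t - a)\<^sup>2 + (s - a)\<^sup>2))"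

definition dker :: "real \<Rightarrow> real \<Rightarrow> real \<Rightarrow> real \<Rightarrow> real \<Rightarrow> complex" where
  "dker a k \<theta> t s = path_hker a k \<theta> t s * tau' a \<theta> s"

text \<open>Set to 0 on [-a, a], where functions in \<open>L2_0\<close> vanish: the kernel is
  unbounded there near the corner, and its phases do not match those of the singular part. For s <
  -a nothing is subtracted because |s - a| >= 2 a keeps R away from 0.\<close>

definition rker :: "real \<Rightarrow> real \<Rightarrow> real \<Rightarrow> real \<Rightarrow> real \<Rightarrow> complex" where
  "rker a k \<theta> t s = (if \<bar>s\<bar> \<le> a then 0
     else if s > a then dker a k \<theta> t s - of_real (sing_kernel a k t s) else dker a k \<theta> t s)"

lemma norm_tau' [simp]: "cmod (tau' a \<theta> s) = 1"
  by (simp add: tau'_def)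

text \<open>Multiplied by the prefactor i k x_1 / (2 R), the term 2 i exp (-|Z|) / (pi Z) with Z = k
  R becomes minus the function subtracted here, so this is the Hankel estimate times a bounded
  factor.\<close>

lemma hker_estimate:
  assumes a: "0 < a" and k: "0 < k" and \<theta>: "0 < \<theta>" "\<theta> < pi / 2"
  obtains C c where "0 < c" "0 \<le> C"
    "\<And>t s. a < t \<Longrightarrow> cmod (path_hker a k \<theta> t s
        - of_real ((t - a) * exp (- k * cmod (path_Rad a \<theta> t s))) * cis \<theta>
            / (of_real pi * (path_Rad a \<theta> t s)\<^sup>2))
       \<le> C * exp (- c * ((t - a) + \<bar>s - a\<bar>))"
proof -
  have s2: "0 < sin (2 * \<theta>)" using sin_double_pos[OF \<theta>] .
  have co: "0 < cos \<theta>" using \<theta> by (auto intro: cos_gt_zero)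
  have e1: "0 < sin (2 * \<theta>) / 16" and e2: "sin (2 * \<theta>) / 16 \<le> 1" and e3: "0 < 4 * a * k"
    using s2 order.trans[OF sin_le_one[of "2 * \<theta>"], of 16] a k by auto
  obtain C c where c: "0 < c" "0 \<le> C" and H:
    "\<And>Z. 0 < Im Z \<Longrightarrow> (4 * a * k \<le> cmod Z \<Longrightarrow> sin (2 * \<theta>) / 16 * cmod Z \<le> Im Z) \<Longrightarrow>
       cmod (hankel1 Z + 2 * \<i> * of_real (exp (- cmod Z)) / (of_real pi * Z)) \<le> C * exp (- c * cmod Z)"
  proof (rule hankel1_estimate[OF e1 e2 e3], goal_cases)
    case 1
    show ?case by (rule 1(1)[OF 1(2-4)])
  qed
  define \<kappa> where "\<kappa> = sqrt (cos \<theta>) / 2"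
  have \<kappa>: "0 < \<kappa>" using co by (simp add: \<kappa>_def)
  show ?thesis
  \<comment> \<open>The prefactor k u / (2 |R|) is at most k / (2 \<kappa>), and |Z| = k |R| >= k
    \<kappa> (u + |s - a|).\<close>
  proof (rule that[of "c * k * \<kappa>" "k / (2 * \<kappa>) * C"])
    show "0 < c * k * \<kappa>" "0 \<le> k / (2 * \<kappa>) * C" using c k \<kappa> by auto
    fix t s :: real assume t: "a < t"
    define R where "R = path_Rad a \<theta> t s"
    define u where "u = t - a"
    have u: "0 < u" using t by (simp add: u_def)
    note cr = complexified_radius[OF \<theta> u path_parts(1,3)[OF a, of s],
        folded Rad_tau[OF a t, of \<theta> s, folded u_def], folded R_def]
    have low: "\<kappa> * (u + \<bar>s - a\<bar>) \<le> cmod R"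
      using cr(5) path_parts(4)[OF a, of s] by (simp add: \<kappa>_def)
    have q: "0 \<le> \<bar>s - a\<bar>" by simp
    have R0: "0 < cmod R" using less_le_trans[OF mult_pos_pos[OF \<kappa> add_pos_nonneg[OF u q]] low] .
    have uR: "u / cmod R \<le> 1 / \<kappa>"
    proof -
      have "\<kappa> * u \<le> cmod R" using \<kappa> by (intro order.trans[OF _ low] mult_left_mono) auto
      then show ?thesis using R0 \<kappa> by (simp add: field_simps)
    qed
    define Z where "Z = of_real k * R"
    have Z: "cmod Z = k * cmod R" "Im Z = k * Im R" using k by (auto simp: Z_def norm_mult)
    have "0 < Im Z" using Z cr(3) k by simp
    moreover have "sin (2 * \<theta>) / 16 * cmod Z \<le> Im Z" if "4 * a * k \<le> cmod Z"
    proof -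
      have "4 * a \<le> cmod R" using that k Z by (simp add: mult.commute)
      from mult_left_mono[OF cr(6)[OF path_parts(2)[OF a] this a], of k] show ?thesis
        using k Z by (simp add: mult_ac)
    qed
    ultimately have HZ: "cmod (hankel1 Z + 2 * \<i> * of_real (exp (- cmod Z)) / (of_real pi * Z)) \<le> C * exp (- c * cmod Z)"
      by (rule H)
    have R0': "R \<noteq> 0" using R0 by auto
    have "path_hker a k \<theta> t s
        - of_real (u * exp (- k * cmod R)) * cis \<theta> / (of_real pi * R\<^sup>2)
      = \<i> * of_real k * (of_real u * cis \<theta>) / (2 * R) * (hankel1 Z + 2 * \<i> * of_real (exp (- cmod Z)) / (of_real pi * Z))"
    proof -
      have "j * K * (U * z) / (2 * R) * (2 * j * E / (q * (K * R))) = (j * j) * (U * E * z / (q * R\<^sup>2))"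
        if "K \<noteq> 0" for j K U z E q :: complex
        using that R0' by (simp add: power2_eq_square mult_ac)
      from this[of "of_real k" \<i> "of_real u" "cis \<theta>" _ "of_real pi"]
      have key: "\<i> * of_real k * (of_real u * cis \<theta>) / (2 * R) * (2 * \<i> * of_real e / (of_real pi * (of_real k * R)))
          = - (of_real (u * e) * cis \<theta> / (of_real pi * R\<^sup>2))" for e
        using k by simp
      show ?thesis
        unfolding hker_def R_def[symmetric]
        unfolding tau_minus[OF a t] u_def[symmetric] Z(1) distrib_left
        unfolding Z_def key by simp
    qed
    then have "cmod (path_hker a k \<theta> t s
        - of_real (u * exp (- k * cmod R)) * cis \<theta> / (of_real pi * R\<^sup>2))
      = k / 2 * (u / cmod R) * cmod (hankel1 Z + 2 * \<i> * of_real (exp (- cmod Z)) / (of_real pi * Z))"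
      using u k by (simp add: norm_mult norm_divide)
    also have "\<dots> \<le> k / 2 * (1 / \<kappa>) * (C * exp (- c * cmod Z))"
      using k u R0 \<kappa> by (intro mult_mono uR HZ mult_left_mono) auto
    also have "\<dots> \<le> k / 2 * (1 / \<kappa>) * (C * exp (- (c * k * \<kappa>) * (u + \<bar>s - a\<bar>)))"
    proof -
      have "(c * k) * (\<kappa> * (u + \<bar>s - a\<bar>)) \<le> (c * k) * cmod R"
        using low c k by (intro mult_left_mono) auto
      then have "- c * cmod Z \<le> - (c * k * \<kappa>) * (u + \<bar>s - a\<bar>)"
        by (simp add: Z mult_ac)
      then show ?thesis using k \<kappa> c by (intro mult_left_mono) auto
    qed
    finally show "cmod (path_hker a k \<theta> t s
        - of_real ((t - a) * exp (- k * cmod (path_Rad a \<theta> t s))) * cis \<theta>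
            / (of_real pi * (path_Rad a \<theta> t s)\<^sup>2))
       \<le> k / (2 * \<kappa>) * C * exp (- (c * k * \<kappa>) * ((t - a) + \<bar>s - a\<bar>))"
      unfolding R_def[symmetric] u_def[symmetric] by (simp add: mult_ac)
  qed
qed

lemma Rad_tau_bounds:
  fixes a \<theta> t s :: real
  assumes a: "0 < a" and \<theta>: "0 < \<theta>" "\<theta> < pi / 2" and t: "a < t"
  defines "R \<equiv> path_Rad a \<theta> t s"
  shows "cos \<theta> / 2 * ((t - a)\<^sup>2 + (s - a)\<^sup>2) \<le> (cmod R)\<^sup>2"
    "sqrt (cos \<theta>) / 2 * ((t - a) + \<bar>s - a\<bar>) \<le> cmod R"
    "0 < Im R" "0 < Im ((tau a \<theta> t - of_real a)\<^sup>2 + (of_real a - tau a \<theta> s)\<^sup>2)"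
proof -
  have u: "0 < t - a" using t by simp
  note cr = complexified_radius[OF \<theta> u path_parts(1,3)[OF a, of s], folded Rad_tau[OF a t, of \<theta> s], folded R_def]
  show "cos \<theta> / 2 * ((t - a)\<^sup>2 + (s - a)\<^sup>2) \<le> (cmod R)\<^sup>2"
    "sqrt (cos \<theta>) / 2 * ((t - a) + \<bar>s - a\<bar>) \<le> cmod R" "0 < Im R"
    using cr(3-5) path_parts(4)[OF a, of s] by auto
  show "0 < Im ((tau a \<theta> t - of_real a)\<^sup>2 + (of_real a - tau a \<theta> s)\<^sup>2)"
    unfolding path_square tau_minus[OF a t] by (rule cr(1))
qed

text \<open>The first bound holds on the whole line, including [-a, a], and feeds the continuity on
  L^2; the second, free of the singular term, feeds compactness.\<close>

lemma dker_bound: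
  assumes a: "0 < a" and k: "0 < k" and \<theta>: "0 < \<theta>" "\<theta> < pi / 2"
  obtains C c where "0 < c" "0 \<le> C"
    "\<And>t s. a < t \<Longrightarrow> cmod (dker a k \<theta> t s) \<le> C * ((t - a) / ((t - a)\<^sup>2 + (s - a)\<^sup>2)) + C * exp (- c * ((t - a) + \<bar>s - a\<bar>))"
    "\<And>t s. a < t \<Longrightarrow> cmod (rker a k \<theta> t s) \<le> C * exp (- c * ((t - a) + \<bar>s - a\<bar>))"
proof -
  have co: "0 < cos \<theta>" using \<theta> by (auto intro: cos_gt_zero)
  obtain C c where c: "0 < c" "0 \<le> C" and H:
    "\<And>t s. a < t \<Longrightarrow> cmod (path_hker a k \<theta> t s
        - of_real ((t - a) * exp (- k * cmod (path_Rad a \<theta> t s))) * cis \<theta>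
            / (of_real pi * (path_Rad a \<theta> t s)\<^sup>2))
       \<le> C * exp (- c * ((t - a) + \<bar>s - a\<bar>))"
  proof (rule hker_estimate[OF a k \<theta>], goal_cases)
    case 1
    show ?case by (rule 1(1)[OF 1(2-4)])
  qed
  define \<kappa> where "\<kappa> = sqrt (cos \<theta>) / 2"
  have \<kappa>: "0 < \<kappa>" using co by (simp add: \<kappa>_def)
  \<comment> \<open>k \<kappa> is the rate at which the damping factor exp (- k |R|) decays in u +
    |s - a|.\<close>
  define c' where "c' = min c (k * \<kappa>)"
  \<comment> \<open>One summand for each source: the error of \<open>hker_estimate\<close>, the
    singular term via |R|^2 >= cos \<theta> (u^2 + (s - a)^2) / 2, and the same term for s < -a,
    where |R| >= 2 a \<kappa>.\<close>
  define C' where "C' = C + 2 / (pi * cos \<theta>) + 1 / (pi * \<kappa> * (2 * a * \<kappa>))"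
  have c': "0 < c'" using c k \<kappa> by (simp add: c'_def)
  have C'2: "0 \<le> 2 / (pi * cos \<theta>)" "0 \<le> 1 / (pi * \<kappa> * (2 * a * \<kappa>))"
    using co \<kappa> a pi_gt_zero by (auto intro!: divide_nonneg_nonneg mult_nonneg_nonneg)
  have C': "0 \<le> C'" "C \<le> C'" "2 / (pi * cos \<theta>) \<le> C'" "C + 1 / (pi * \<kappa> * (2 * a * \<kappa>)) \<le> C'"
    unfolding C'_def using C'2 c by linarith+
  have expc: "exp (- c * ((t - a) + \<bar>s - a\<bar>)) \<le> exp (- c' * ((t - a) + \<bar>s - a\<bar>))" if "a < t" for t s
    using that by (auto simp: c'_def intro!: mult_right_mono)
  have split: "cmod (dker a k \<theta> t s) \<le> (t - a) / (pi * (cmod R)\<^sup>2) * exp (- k * cmod R) + C * exp (- c' * ((t - a) + \<bar>s - a\<bar>))"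
    if t: "a < t" and R: "R = path_Rad a \<theta> t s" for t s R
  proof -
    have "cmod (dker a k \<theta> t s) = cmod (path_hker a k \<theta> t s)"
      by (simp add: dker_def norm_mult)
    also have "\<dots> \<le> cmod (of_real ((t - a) * exp (- k * cmod R)) * cis \<theta> / (of_real pi * R\<^sup>2)) + C * exp (- c * ((t - a) + \<bar>s - a\<bar>))"
      using H[OF t, of s] norm_triangle_sub[of "path_hker a k \<theta> t s"
          "of_real ((t - a) * exp (- k * cmod R)) * cis \<theta> / (of_real pi * R\<^sup>2)"]
      unfolding R by linarith
    also have "cmod (of_real ((t - a) * exp (- k * cmod R)) * cis \<theta> / (of_real pi * R\<^sup>2))
        = (t - a) / (pi * (cmod R)\<^sup>2) * exp (- k * cmod R)"
      using t by (simp add: norm_mult norm_divide norm_power del: of_real_mult of_real_diff)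
    also have "C * exp (- c * ((t - a) + \<bar>s - a\<bar>)) \<le> C * exp (- c' * ((t - a) + \<bar>s - a\<bar>))"
      using expc[OF t] c by (intro mult_left_mono) auto
    finally show ?thesis by simp
  qed
  show ?thesis
  proof (rule that[OF c' C'(1)])
    fix t s :: real assume t: "a < t"
    define R where "R = path_Rad a \<theta> t s"
    define E where "E = exp (- c' * ((t - a) + \<bar>s - a\<bar>))"
    have u: "0 < t - a" using t by simp
    note RB = Rad_tau_bounds[OF a \<theta> t, of s, folded R_def]
    have E: "C * E \<le> C' * E" using C' by (intro mult_right_mono) (auto simp: E_def)
    have pos: "0 < (t - a)\<^sup>2 + (s - a)\<^sup>2" using u by (simp add: add_pos_nonneg)
    have R0: "0 < cmod R" using RB(3) by auto
    have "(t - a) / (pi * (cmod R)\<^sup>2) * exp (- k * cmod R) \<le> (t - a) / (pi * (cmod R)\<^sup>2)"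
      using u k pi_gt_zero by (intro mult_right_le_one_le) auto
    also have "\<dots> \<le> (t - a) / (pi * (cos \<theta> / 2 * ((t - a)\<^sup>2 + (s - a)\<^sup>2)))"
      using u RB(1) pos co pi_gt_zero R0 by (intro divide_left_mono mult_left_mono mult_pos_pos) simp_all
    also have "\<dots> = 2 / (pi * cos \<theta>) * ((t - a) / ((t - a)\<^sup>2 + (s - a)\<^sup>2))"
      by (simp add: mult_ac)
    also have "\<dots> \<le> C' * ((t - a) / ((t - a)\<^sup>2 + (s - a)\<^sup>2))"
      using u pos C' by (intro mult_right_mono) auto
    finally show "cmod (dker a k \<theta> t s) \<le> C' * ((t - a) / ((t - a)\<^sup>2 + (s - a)\<^sup>2)) + C' * exp (- c' * ((t - a) + \<bar>s - a\<bar>))"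
      using split[OF t R_def] E unfolding E_def by linarith
    show "cmod (rker a k \<theta> t s) \<le> C' * exp (- c' * ((t - a) + \<bar>s - a\<bar>))"
    proof (cases "\<bar>s\<bar> \<le> a")
      case True
      then show ?thesis using C' by (simp add: rker_def)
    next
      case out: False
      show ?thesis
      proof (cases "a < s")
        case True
        define \<rho> where "\<rho> = sqrt ((t - a)\<^sup>2 + (s - a)\<^sup>2)"
        have \<rho>: "0 < \<rho>" "\<rho>\<^sup>2 = (t - a)\<^sup>2 + (s - a)\<^sup>2" using pos by (auto simp: \<rho>_def)
        \<comment> \<open>For s > a the real segment is absent, so R is exactly \<rho>
          e^{i\<theta>}; the principal branch is the right one since cos \<theta> > 0. Then |R| =
          \<rho>, the damping agrees with that of \<open>sing_kernel\<close>, and the phases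
          cancel.\<close>
        have "R = csqrt ((of_real \<rho> * cis \<theta>)\<^sup>2)"
        proof -
          have "(of_real (t - a) * cis \<theta>)\<^sup>2 + (of_real (real_part a s) + of_real (rotated_part a s) * cis \<theta>)\<^sup>2
              = of_real ((t - a)\<^sup>2 + (s - a)\<^sup>2) * (cis \<theta>)\<^sup>2"
            using True a by (simp add: real_part_def rotated_part_def power_mult_distrib distrib_right)
          also have "\<dots> = (of_real \<rho> * cis \<theta>)\<^sup>2"
            by (simp only: power_mult_distrib of_real_power[symmetric] \<rho>(2))
          finally show ?thesis by (simp only: R_def Rad_tau[OF a t])
        qed
        also have "\<dots> = of_real \<rho> * cis \<theta>" using \<rho> co by (intro csqrt_square) auto
        finally have Req: "R = of_real \<rho> * cis \<theta>" .
        then have cR: "cmod R = \<rho>" using \<rho> by (simp add: norm_mult)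
        have tau': "tau' a \<theta> s = cis \<theta>" using out by (simp add: tau'_def)
        have "of_real (sing_kernel a k t s) = of_real ((t - a) * exp (- k * cmod R)) * cis \<theta> / (of_real pi * R\<^sup>2) * cis \<theta>"
        proof -
          have "sing_kernel a k t s = (t - a) / (pi * \<rho>\<^sup>2) * exp (- k * \<rho>)"
            unfolding sing_kernel_def \<rho>(2) unfolding \<rho>_def ..
          moreover have "of_real (U / (pi * \<rho>\<^sup>2) * E) = of_real (U * E) * cis \<theta> / (of_real pi * (of_real \<rho> * cis \<theta>)\<^sup>2) * cis \<theta>" for U E
            using \<rho>(1) by (simp add: power2_eq_square)
          ultimately show ?thesis unfolding cR unfolding Req by (simp only:)
        qed
        then have "rker a k \<theta> t s = (path_hker a k \<theta> t s
           - of_real ((t - a) * exp (- k * cmod R)) * cis \<theta> / (of_real pi * R\<^sup>2)) * cis \<theta>"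
          using out True by (simp add: rker_def dker_def tau' left_diff_distrib)
        then have "cmod (rker a k \<theta> t s) \<le> C * exp (- c * ((t - a) + \<bar>s - a\<bar>))"
          using H[OF t, of s] by (simp add: norm_mult R_def)
        also have "\<dots> \<le> C * E" unfolding E_def using expc[OF t] c by (intro mult_left_mono) auto
        also note E
        finally show ?thesis by (simp only: E_def)
      next
        case False
        then have s: "s < - a" using out by auto
        have uq: "2 * a \<le> t - a + \<bar>s - a\<bar>" "t - a \<le> t - a + \<bar>s - a\<bar>" using s a t by auto
        have RL: "2 * a * \<kappa> \<le> cmod R" "\<kappa> * (t - a) \<le> cmod R"
        proof -
          have low: "\<kappa> * (t - a + \<bar>s - a\<bar>) \<le> cmod R" using RB(2) by (simp only: \<kappa>_def)
          show "\<kappa> * (t - a) \<le> cmod R"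
            using \<kappa> by (intro order.trans[OF mult_left_mono[OF uq(2)] low]) simp
          have "\<kappa> * (2 * a) \<le> cmod R"
            using \<kappa> by (intro order.trans[OF mult_left_mono[OF uq(1)] low]) simp
          then show "2 * a * \<kappa> \<le> cmod R" by (simp only: mult.commute)
        qed
        have "(t - a) / (pi * (cmod R)\<^sup>2) = ((t - a) / cmod R) * (1 / (pi * cmod R))"
          by (simp add: power2_eq_square)
        also have "\<dots> \<le> (1 / \<kappa>) * (1 / (pi * (2 * a * \<kappa>)))"
        proof (intro mult_mono)
          show "(t - a) / cmod R \<le> 1 / \<kappa>" using RL(2) R0 \<kappa> by (simp add: field_simps)
          show "1 / (pi * cmod R) \<le> 1 / (pi * (2 * a * \<kappa>))"
            using RL(1) R0 \<kappa> a pi_gt_zero by (intro divide_left_mono mult_left_mono mult_pos_pos) auto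
        qed (use \<kappa> in auto)
        finally have 1: "(t - a) / (pi * (cmod R)\<^sup>2) \<le> 1 / (pi * \<kappa> * (2 * a * \<kappa>))" by (simp add: mult_ac)
        have 2: "exp (- k * cmod R) \<le> E"
        proof -
          have "c' * ((t - a) + \<bar>s - a\<bar>) \<le> (k * \<kappa>) * ((t - a) + \<bar>s - a\<bar>)"
            using t by (intro mult_right_mono) (auto simp: c'_def)
          also have "\<dots> \<le> k * cmod R" using RB(2) k by (simp add: \<kappa>_def mult.assoc)
          finally show ?thesis by (simp add: E_def)
        qed
        have "(t - a) / (pi * (cmod R)\<^sup>2) * exp (- k * cmod R) \<le> 1 / (pi * \<kappa> * (2 * a * \<kappa>)) * E"
          by (intro mult_mono 1 2) (use C'2 in auto)
        then have "cmod (dker a k \<theta> t s) \<le> (C + 1 / (pi * \<kappa> * (2 * a * \<kappa>))) * E"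
          using split[OF t R_def] by (simp add: E_def distrib_right)
        also have "\<dots> \<le> C' * E" using C' by (intro mult_right_mono) (auto simp: E_def)
        finally show ?thesis using out False by (simp add: rker_def E_def)
      qed
    qed
  qed
qed

text \<open>Clamping s to [-a, a] replaces the three cases by a single formula that is visibly
  continuous.\<close>

lemma tau_clamp:
  assumes "0 < a"
  shows "tau a \<theta> s = of_real (max (- a) (min s a)) + of_real (s - max (- a) (min s a)) * cis \<theta>"
  using assms by (auto simp: tau_def max_def min_def)

text \<open>R^2 lies in the open upper half-plane, off the cut of the square root, and so does k R,
  where the Hankel function is holomorphic.\<close>

lemma continuous_on_hker_tau:
  assumes a: "0 < a" and k: "0 < k" and \<theta>: "0 < \<theta>" "\<theta> < pi / 2"
  shows "continuous_on ({a<..} \<times> UNIV) (\<lambda>(t, s). path_hker a k \<theta> t s)"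
proof -
  have tau: "continuous_on A (\<lambda>x. tau a \<theta> (f x))" if "continuous_on A f" for A and f :: "real \<times> real \<Rightarrow> real"
    unfolding tau_clamp[OF a] by (intro continuous_intros that)
  let ?S = "{a<..} \<times> UNIV :: (real \<times> real) set"
  let ?x1 = "\<lambda>x::real \<times> real. tau a \<theta> (fst x) - of_real a" and ?x2 = "\<lambda>x::real \<times> real. of_real a - tau a \<theta> (snd x)"
  have c1: "continuous_on ?S ?x1" and c2: "continuous_on ?S ?x2"
    by (intro continuous_intros tau)+
  have im: "0 < Im ((?x1 x)\<^sup>2 + (?x2 x)\<^sup>2)" "0 < Im (Rad (?x1 x) (?x2 x))" if "x \<in> ?S" for x
    using that Rad_tau_bounds(3,4)[OF a \<theta>, of "fst x" "snd x"] by auto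
  have cR: "continuous_on ?S (\<lambda>x. Rad (?x1 x) (?x2 x))"
    unfolding Rad_def
  proof (rule continuous_on_compose2[OF continuous_on_csqrt])
    show "continuous_on ?S (\<lambda>x. (?x1 x)\<^sup>2 + (?x2 x)\<^sup>2)" by (intro continuous_intros c1 c2)
    show "(\<lambda>x. (?x1 x)\<^sup>2 + (?x2 x)\<^sup>2) ` ?S \<subseteq> - \<real>\<^sub>\<le>\<^sub>0"
    proof (rule image_subsetI)
      fix x assume "x \<in> ?S"
      then show "(?x1 x)\<^sup>2 + (?x2 x)\<^sup>2 \<in> - \<real>\<^sub>\<le>\<^sub>0"
        using im(1)[of x] by (simp only: Compl_iff complex_nonpos_Reals_iff) auto
    qed
  qed
  have "continuous_on ?S (\<lambda>x. hankel1 (of_real k * Rad (?x1 x) (?x2 x)))"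
    by (rule continuous_on_compose2[OF holomorphic_on_imp_continuous_on[OF hankel1_holomorphic]])
       (use im(2) k in \<open>auto intro!: continuous_intros cR\<close>)
  moreover have "Rad (?x1 x) (?x2 x) \<noteq> 0" if "x \<in> ?S" for x using im(2)[OF that] by auto
  ultimately have "continuous_on ?S (\<lambda>x. hker k (?x1 x) (?x2 x))"
    unfolding hker_def by (intro continuous_intros c1 cR) auto
  then show ?thesis by (simp add: case_prod_unfold)
qed

section \<open>Schur's test and the homogeneous kernel\<close>

text \<open>Write K f as the product of sqrt(K p) and sqrt(K / p) f, apply Cauchy-Schwarz in y and
  exchange the integrals. Positivity of p is asked almost everywhere because the weight 1 / sqrt |s
  - a| evaluates to 0 at s = a.\<close>

lemma schur_test:
  fixes K :: "real \<Rightarrow> real \<Rightarrow> real" and p q f :: "real \<Rightarrow> real"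
  assumes K [measurable]: "case_prod K \<in> borel_measurable (lborel \<Otimes>\<^sub>M lborel)"
    and [measurable]: "p \<in> borel_measurable lborel" "q \<in> borel_measurable lborel" "f \<in> borel_measurable lborel"
    and nonneg: "\<And>x y. 0 \<le> K x y" "\<And>y. 0 \<le> p y" "\<And>x. 0 \<le> q x" "\<And>y. 0 \<le> f y" "0 \<le> \<alpha>" "0 \<le> \<beta>"
    and pos: "AE y in lborel. 0 < p y"
    and row: "\<And>x. (\<integral>\<^sup>+y. ennreal (K x y * p y) \<partial>lborel) \<le> ennreal (\<alpha> * q x)"
    and col: "AE y in lborel. (\<integral>\<^sup>+x. ennreal (K x y * q x) \<partial>lborel) \<le> ennreal (\<beta> * p y)"
  shows "(\<integral>\<^sup>+x. (\<integral>\<^sup>+y. ennreal (K x y * f y) \<partial>lborel)\<^sup>2 \<partial>lborel)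
    \<le> ennreal (\<alpha> * \<beta>) * (\<integral>\<^sup>+y. ennreal ((f y)\<^sup>2) \<partial>lborel)"
proof -
  have Kx [measurable]: "K x \<in> borel_measurable lborel" for x
    using measurable_compose[OF measurable_Pair1'[of x lborel lborel] K] by simp
  have "(\<integral>\<^sup>+x. (\<integral>\<^sup>+y. ennreal (K x y * f y) \<partial>lborel)\<^sup>2 \<partial>lborel)
      \<le> (\<integral>\<^sup>+x. (\<integral>\<^sup>+y. ennreal (\<alpha> * q x * (K x y * ((f y)\<^sup>2 / p y))) \<partial>lborel) \<partial>lborel)"
  proof (rule nn_integral_mono)
    fix x :: real
    have "(\<integral>\<^sup>+y. ennreal (K x y * f y) \<partial>lborel)
        = (\<integral>\<^sup>+y. ennreal (sqrt (K x y * p y)) * ennreal (sqrt (K x y / p y) * f y) \<partial>lborel)"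
    proof (rule nn_integral_cong_AE, use pos in eventually_elim)
      fix y assume "0 < p y"
      then have "sqrt (K x y * p y) * sqrt (K x y / p y) = K x y"
        using nonneg(1)[of x y] by (simp flip: real_sqrt_mult)
      then show "ennreal (K x y * f y) = ennreal (sqrt (K x y * p y)) * ennreal (sqrt (K x y / p y) * f y)"
        using nonneg by (simp add: ennreal_mult[symmetric] mult.assoc[symmetric])
    qed
    then have "(\<integral>\<^sup>+y. ennreal (K x y * f y) \<partial>lborel)\<^sup>2
        \<le> (\<integral>\<^sup>+y. ennreal (sqrt (K x y * p y)) ^ 2 \<partial>lborel) * (\<integral>\<^sup>+y. ennreal (sqrt (K x y / p y) * f y) ^ 2 \<partial>lborel)"
      using Cauchy_Schwarz_nn_integral[of "\<lambda>y. ennreal (sqrt (K x y * p y))" lborel "\<lambda>y. ennreal (sqrt (K x y / p y) * f y)"]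
      by simp
    also have "(\<integral>\<^sup>+y. ennreal (sqrt (K x y * p y)) ^ 2 \<partial>lborel) = (\<integral>\<^sup>+y. ennreal (K x y * p y) \<partial>lborel)"
      using nonneg by (intro nn_integral_cong) (simp add: ennreal_power)
    also have "(\<integral>\<^sup>+y. ennreal (sqrt (K x y / p y) * f y) ^ 2 \<partial>lborel) = (\<integral>\<^sup>+y. ennreal (K x y * ((f y)\<^sup>2 / p y)) \<partial>lborel)"
      using nonneg by (intro nn_integral_cong) (simp add: ennreal_power power_mult_distrib)
    also have "(\<integral>\<^sup>+y. ennreal (K x y * p y) \<partial>lborel) * (\<integral>\<^sup>+y. ennreal (K x y * ((f y)\<^sup>2 / p y)) \<partial>lborel)
        \<le> ennreal (\<alpha> * q x) * (\<integral>\<^sup>+y. ennreal (K x y * ((f y)\<^sup>2 / p y)) \<partial>lborel)"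
      by (intro mult_right_mono row) simp
    also have "\<dots> = (\<integral>\<^sup>+y. ennreal (\<alpha> * q x * (K x y * ((f y)\<^sup>2 / p y))) \<partial>lborel)"
      using nonneg by (subst nn_integral_cmult[symmetric]) (auto simp: ennreal_mult[symmetric])
    finally show "(\<integral>\<^sup>+y. ennreal (K x y * f y) \<partial>lborel)\<^sup>2
      \<le> (\<integral>\<^sup>+y. ennreal (\<alpha> * q x * (K x y * ((f y)\<^sup>2 / p y))) \<partial>lborel)" .
  qed
  also have "\<dots> = (\<integral>\<^sup>+y. (\<integral>\<^sup>+x. ennreal (\<alpha> * q x * (K x y * ((f y)\<^sup>2 / p y))) \<partial>lborel) \<partial>lborel)"
    by (rule lborel_pair.Fubini'[symmetric]) measurable
  also have "\<dots> \<le> (\<integral>\<^sup>+y. ennreal (\<alpha> * \<beta>) * ennreal ((f y)\<^sup>2) \<partial>lborel)"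
  proof (rule nn_integral_mono_AE, use pos col in eventually_elim)
    fix y assume p: "0 < p y" and c: "(\<integral>\<^sup>+x. ennreal (K x y * q x) \<partial>lborel) \<le> ennreal (\<beta> * p y)"
    have [measurable]: "(\<lambda>x. K x y) \<in> borel_measurable lborel"
      using measurable_compose[OF measurable_Pair2'[of y lborel lborel] K] by simp
    have "(\<integral>\<^sup>+x. ennreal (\<alpha> * q x * (K x y * ((f y)\<^sup>2 / p y))) \<partial>lborel)
        = (\<integral>\<^sup>+x. ennreal (\<alpha> * ((f y)\<^sup>2 / p y)) * ennreal (K x y * q x) \<partial>lborel)"
      using nonneg by (intro nn_integral_cong) (simp add: ennreal_mult[symmetric] mult_ac)
    also have "\<dots> = ennreal (\<alpha> * ((f y)\<^sup>2 / p y)) * (\<integral>\<^sup>+x. ennreal (K x y * q x) \<partial>lborel)"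
      by (rule nn_integral_cmult) measurable
    also have "\<dots> \<le> ennreal (\<alpha> * ((f y)\<^sup>2 / p y)) * ennreal (\<beta> * p y)"
      by (intro mult_left_mono c) simp
    also have "\<dots> = ennreal (\<alpha> * \<beta>) * ennreal ((f y)\<^sup>2)"
      using nonneg p by (simp add: ennreal_mult[symmetric])
    finally show "(\<integral>\<^sup>+x. ennreal (\<alpha> * q x * (K x y * ((f y)\<^sup>2 / p y))) \<partial>lborel) \<le> ennreal (\<alpha> * \<beta>) * ennreal ((f y)\<^sup>2)" .
  qed
  also have "\<dots> = ennreal (\<alpha> * \<beta>) * (\<integral>\<^sup>+y. ennreal ((f y)\<^sup>2) \<partial>lborel)"
    by (rule nn_integral_cmult) measurable
  finally show ?thesis .
qed

text \<open>The two integrals below are $\int_0^\infty x^{\mp1/2}(1+x^2)^{-1}\,dx$; with $w = \sqrt x$ the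
  partial fractions come from $w^4 + 1 = (w^2 + \sqrt2 w + 1)(w^2 - \sqrt2 w + 1)$.\<close>

definition quartic_atan :: "real \<Rightarrow> real" where
  "quartic_atan w = sqrt 2 / 2 * (arctan (sqrt 2 * w + 1) + arctan (sqrt 2 * w - 1))"

definition quartic_log :: "real \<Rightarrow> real" where
  "quartic_log w = sqrt 2 / 4 * (ln (w\<^sup>2 + sqrt 2 * w + 1) - ln (w\<^sup>2 - sqrt 2 * w + 1))"

lemma quartic_factors:
  "0 < w\<^sup>2 + sqrt 2 * w + 1" "0 < w\<^sup>2 - sqrt 2 * w + 1"
  "(w\<^sup>2 + sqrt 2 * w + 1) * (w\<^sup>2 - sqrt 2 * w + 1) = w ^ 4 + (1::real)"
proof -
  have c: "sqrt 2 * sqrt 2 = (2::real)" by simp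
  have "w\<^sup>2 + sqrt 2 * w + 1 = (w + sqrt 2 / 2)\<^sup>2 + 1 / 2" "w\<^sup>2 - sqrt 2 * w + 1 = (w - sqrt 2 / 2)\<^sup>2 + 1 / 2"
    by (auto simp: power2_eq_square algebra_simps c)
  then show "0 < w\<^sup>2 + sqrt 2 * w + 1" "0 < w\<^sup>2 - sqrt 2 * w + 1"
    by (auto intro: add_nonneg_pos)
  have "(w\<^sup>2 + z * w + 1) * (w\<^sup>2 - z * w + 1) = w ^ 4 + 1" if "z * z = 2" for z :: real
  proof -
    have "(w\<^sup>2 + z * w + 1) * (w\<^sup>2 - z * w + 1) = w ^ 4 + (2 - z * z) * w\<^sup>2 + 1"
      by (simp add: power2_eq_square power4_eq_xxxx algebra_simps)
    then show ?thesis by (simp add: that)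
  qed
  from this[OF c] show "(w\<^sup>2 + sqrt 2 * w + 1) * (w\<^sup>2 - sqrt 2 * w + 1) = w ^ 4 + 1" .
qed

lemma quartic_deriv:
  "(quartic_atan has_real_derivative (w\<^sup>2 + 1) / (w ^ 4 + 1)) (at w)"
  "(quartic_log has_real_derivative (1 - w\<^sup>2) / (w ^ 4 + 1)) (at w)"
proof -
  define z :: real where "z = sqrt 2"
  have z: "z * z = 2" "z\<^sup>2 = 2" by (auto simp: z_def)
  define P where "P = w\<^sup>2 + z * w + 1"
  define M where "M = w\<^sup>2 - z * w + 1"
  have PM: "0 < P" "0 < M" "P * M = w ^ 4 + 1"
    using quartic_factors[of w] by (auto simp: P_def M_def z_def)
  have a1: "1 + (z * w + 1)\<^sup>2 = 2 * P" "1 + (z * w - 1)\<^sup>2 = 2 * M"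
    using z by (auto simp: P_def M_def power2_eq_square algebra_simps)
  have "(quartic_atan has_real_derivative z / 2 * (1 / (1 + (z * w + 1)\<^sup>2) * z + 1 / (1 + (z * w - 1)\<^sup>2) * z)) (at w)"
    unfolding quartic_atan_def[abs_def] z_def[symmetric]
    by (auto intro!: derivative_eq_intros simp: divide_simps add_nonneg_eq_0_iff)
  also have "z / 2 * (1 / (1 + (z * w + 1)\<^sup>2) * z + 1 / (1 + (z * w - 1)\<^sup>2) * z) = (z * z) / 4 * ((P + M) / (P * M))"
    unfolding a1 using PM by (simp add: field_simps)
  also have "\<dots> = (w\<^sup>2 + 1) / (w ^ 4 + 1)"
  proof -
    have "P + M = 2 * (w\<^sup>2 + 1)" by (simp add: P_def M_def)
    then show ?thesis unfolding PM(3) z by (simp only:)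
  qed
  finally show "(quartic_atan has_real_derivative (w\<^sup>2 + 1) / (w ^ 4 + 1)) (at w)" .
  have "(quartic_log has_real_derivative z / 4 * (1 / P * (2 * w + z) - 1 / M * (2 * w - z))) (at w)"
    unfolding quartic_log_def[abs_def] z_def[symmetric]
    using PM(1,2) unfolding P_def M_def
    by (auto intro!: derivative_eq_intros)
  also have "z / 4 * (1 / P * (2 * w + z) - 1 / M * (2 * w - z)) = (z * ((2 * w + z) * M - (2 * w - z) * P)) / 4 / (P * M)"
    using PM by (simp add: field_simps)
  also have "z * ((2 * w + z) * M - (2 * w - z) * P) = 4 * (1 - w\<^sup>2)"
  proof -
    have "z * ((2 * w + z) * M - (2 * w - z) * P) = (z * z) * (2 - 2 * w\<^sup>2)"
      by (simp add: P_def M_def power2_eq_square algebra_simps)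
    then show ?thesis by (simp add: z(1))
  qed
  also have "4 * (1 - w\<^sup>2) / 4 / (P * M) = (1 - w\<^sup>2) / (w ^ 4 + 1)"
  proof -
    have "4 * X / 4 = X" for X :: real by simp
    then show ?thesis by (simp only: PM(3))
  qed
  finally show "(quartic_log has_real_derivative (1 - w\<^sup>2) / (w ^ 4 + 1)) (at w)" .
qed

lemma quartic_limits:
  "(quartic_atan \<longlongrightarrow> pi / sqrt 2) at_top" "(quartic_log \<longlongrightarrow> 0) at_top"
  "quartic_atan 0 = 0" "quartic_log 0 = 0"
proof -
  have "(quartic_atan \<longlongrightarrow> sqrt 2 / 2 * (pi / 2 + pi / 2)) at_top"
    unfolding quartic_atan_def[abs_def]
    by (intro tendsto_intros filterlim_compose[OF tendsto_arctan_at_top]) real_asymp+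
  moreover have "sqrt 2 / 2 * (pi / 2 + pi / 2) = pi / sqrt 2" by (simp add: field_simps)
  ultimately show "(quartic_atan \<longlongrightarrow> pi / sqrt 2) at_top" by simp
  show "(quartic_log \<longlongrightarrow> 0) at_top" unfolding quartic_log_def[abs_def] by real_asymp
qed (auto simp: quartic_atan_def quartic_log_def arctan_minus)

lemma nn_integral_half_line_FTC:
  fixes F f :: "real \<Rightarrow> real"
  assumes F: "\<And>x. 0 < x \<Longrightarrow> (F has_real_derivative f x) (at x)"
    and f: "\<And>x. 0 < x \<Longrightarrow> isCont f x" "\<And>x. 0 < x \<Longrightarrow> 0 \<le> f x"
    and lim: "(F \<longlongrightarrow> 0) (at_right 0)" "(F \<longlongrightarrow> L) at_top"
  shows "(\<integral>\<^sup>+x. ennreal (indicator {0<..} x * f x) \<partial>lborel) = ennreal L"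
proof -
  have A: "((F \<circ> real_of_ereal) \<longlongrightarrow> 0) (at_right (ereal 0))" and B: "((F \<circ> real_of_ereal) \<longlongrightarrow> L) (at_left \<infinity>)"
    using lim by (auto simp: ereal_tendsto_simps)
  have FTC: "set_integrable lborel (einterval (ereal 0) \<infinity>) f" "(LBINT x=ereal 0..\<infinity>. f x) = L - 0"
    by (rule interval_integral_FTC_nonneg[OF _ _ _ _ A B]; use F f in simp)+
  have e: "einterval (ereal 0) \<infinity> = {0<..}" by (auto simp: einterval_def)
  have "integrable lborel (\<lambda>x. indicator {0<..} x * f x)"
    using FTC(1) by (simp add: set_integrable_def e)
  moreover have "(LINT x|lborel. indicator {0<..} x * f x) = L"
    using FTC(2) by (simp add: interval_lebesgue_integral_def set_lebesgue_integral_def e)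
  ultimately show ?thesis
    using f(2) by (subst nn_integral_eq_integral) (auto simp: indicator_def)
qed

text \<open>\<sigma> = 1 and \<sigma> = -1 give the two integrands; the value is the same because
  the logarithmic primitive vanishes at 0 and at infinity.\<close>

lemma nn_integral_quartic:
  assumes \<sigma>: "\<bar>\<sigma>\<bar> = (1::real)"
  shows "(\<integral>\<^sup>+x. ennreal (indicator {0<..} x * (((1 + \<sigma>) + (1 - \<sigma>) * x) / (2 * sqrt x * (1 + x\<^sup>2)))) \<partial>lborel) = ennreal (pi / sqrt 2)"
proof (rule nn_integral_half_line_FTC[where F = "\<lambda>x. quartic_atan (sqrt x) + \<sigma> * quartic_log (sqrt x)"])
  fix x :: real assume x: "0 < x"
  have x4: "sqrt x ^ 4 = x\<^sup>2" "(sqrt x)\<^sup>2 = x" using x by (simp_all add: power4_eq_xxxx power2_eq_square)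
  have "((\<lambda>x. quartic_atan (sqrt x) + \<sigma> * quartic_log (sqrt x)) has_real_derivative
      ((sqrt x)\<^sup>2 + 1) / (sqrt x ^ 4 + 1) * (inverse (sqrt x) / 2)
      + \<sigma> * ((1 - (sqrt x)\<^sup>2) / (sqrt x ^ 4 + 1) * (inverse (sqrt x) / 2))) (at x)"
    by (intro DERIV_add DERIV_cmult DERIV_chain2[OF quartic_deriv(1)] DERIV_chain2[OF quartic_deriv(2)] DERIV_real_sqrt x)
  then have "((\<lambda>x. quartic_atan (sqrt x) + \<sigma> * quartic_log (sqrt x)) has_real_derivative
      (x + 1) / (x\<^sup>2 + 1) * (inverse (sqrt x) / 2) + \<sigma> * ((1 - x) / (x\<^sup>2 + 1) * (inverse (sqrt x) / 2))) (at x)"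
    unfolding x4 .
  also have "(x + 1) / (x\<^sup>2 + 1) * (inverse (sqrt x) / 2) + \<sigma> * ((1 - x) / (x\<^sup>2 + 1) * (inverse (sqrt x) / 2))
      = ((1 + \<sigma>) + (1 - \<sigma>) * x) / (2 * sqrt x * (1 + x\<^sup>2))"
  proof -
    have "(x + 1) / d * (inverse r / 2) + \<sigma> * ((1 - x) / d * (inverse r / 2)) = ((x + 1) + \<sigma> * (1 - x)) / (2 * r * d)" for d r
      by (simp add: inverse_eq_divide add_divide_distrib mult_ac)
    moreover have "(x + 1) + \<sigma> * (1 - x) = (1 + \<sigma>) + (1 - \<sigma>) * x" by (simp add: algebra_simps)
    ultimately show ?thesis by (simp only: add.commute[of "x\<^sup>2"])
  qed
  finally show "((\<lambda>x. quartic_atan (sqrt x) + \<sigma> * quartic_log (sqrt x)) has_real_derivative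
      ((1 + \<sigma>) + (1 - \<sigma>) * x) / (2 * sqrt x * (1 + x\<^sup>2))) (at x)" .
  have "1 + x\<^sup>2 \<noteq> 0" by (smt (verit) zero_le_power2)
  then show "isCont (\<lambda>x. ((1 + \<sigma>) + (1 - \<sigma>) * x) / (2 * sqrt x * (1 + x\<^sup>2))) x" using x by (intro continuous_intros) auto
  have "0 \<le> 1 + \<sigma>" "0 \<le> 1 - \<sigma>" using \<sigma> by auto
  then have "0 \<le> (1 + \<sigma>) + (1 - \<sigma>) * x" using x by (intro add_nonneg_nonneg[of "1 + \<sigma>"] mult_nonneg_nonneg) auto
  then show "0 \<le> ((1 + \<sigma>) + (1 - \<sigma>) * x) / (2 * sqrt x * (1 + x\<^sup>2))"
    using x by (intro divide_nonneg_nonneg) auto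
next
  have c: "isCont quartic_atan 0" "isCont quartic_log 0"
    by (rule DERIV_isCont[OF quartic_deriv(1)], rule DERIV_isCont[OF quartic_deriv(2)])
  have r: "(sqrt \<longlongrightarrow> 0) (at_right 0)" using tendsto_real_sqrt[OF tendsto_ident_at, of 0 "{0<..}"] by simp
  have "((\<lambda>x. quartic_atan (sqrt x) + \<sigma> * quartic_log (sqrt x)) \<longlongrightarrow> quartic_atan 0 + \<sigma> * quartic_log 0) (at_right 0)"
    by (rule tendsto_add[OF isCont_tendsto_compose[OF c(1) r] tendsto_mult_left[OF isCont_tendsto_compose[OF c(2) r]]])
  then show "((\<lambda>x. quartic_atan (sqrt x) + \<sigma> * quartic_log (sqrt x)) \<longlongrightarrow> 0) (at_right 0)"
    by (simp add: quartic_limits)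
  have "((\<lambda>x. quartic_atan (sqrt x) + \<sigma> * quartic_log (sqrt x)) \<longlongrightarrow> pi / sqrt 2 + \<sigma> * 0) at_top"
    by (intro tendsto_add tendsto_mult_left filterlim_compose[OF quartic_limits(1) sqrt_at_top]
        filterlim_compose[OF quartic_limits(2) sqrt_at_top])
  then show "((\<lambda>x. quartic_atan (sqrt x) + \<sigma> * quartic_log (sqrt x)) \<longlongrightarrow> pi / sqrt 2) at_top" by simp
qed

lemma nn_integral_inv_sqrt:
  "(\<integral>\<^sup>+x. ennreal (indicator {0<..} x * (1 / (sqrt x * (1 + x\<^sup>2)))) \<partial>lborel) = ennreal (pi / sqrt 2)"
  using nn_integral_quartic[of 1] by simp

lemma nn_integral_sqrt:
  "(\<integral>\<^sup>+x. ennreal (indicator {0<..} x * (sqrt x / (1 + x\<^sup>2))) \<partial>lborel) = ennreal (pi / sqrt 2)"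
proof -
  have "2 * x / (2 * sqrt x * (1 + x\<^sup>2)) = sqrt x / (1 + x\<^sup>2)" if "0 < x" for x :: real
    using real_div_sqrt[of x] that by (simp flip: divide_divide_eq_left)
  then have "indicator {0<..} x * (((1 + - 1) + (1 - - 1) * x) / (2 * sqrt x * (1 + x\<^sup>2)))
      = indicator {0<..} x * (sqrt x / (1 + x\<^sup>2))" for x :: real
    by (auto simp: indicator_def)
  then show ?thesis using nn_integral_quartic[of "- 1"] by simp
qed

text \<open>The undamped majorant of \<open>sker\<close>: it is homogeneous of degree -1 in the
  distances from a, so scaling reduces its weighted row and column integrals to fixed
  numbers.\<close>

definition hardy_kernel :: "real \<Rightarrow> real \<Rightarrow> real \<Rightarrow> real" where
  "hardy_kernel a t s = indicator {a<..} t * (indicator {a<..} s * ((t - a) / (pi * ((t - a)\<^sup>2 + (s - a)\<^sup>2))))"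

lemma hardy_kernel_nonneg: "0 \<le> hardy_kernel a t s"
  using pi_gt_zero by (auto simp: hardy_kernel_def indicator_def intro!: divide_nonneg_nonneg mult_nonneg_nonneg)

lemma hardy_kernel_measurable [measurable]:
  "case_prod (hardy_kernel a) \<in> borel_measurable (lborel \<Otimes>\<^sub>M lborel)"
  unfolding hardy_kernel_def[abs_def] by measurable

text \<open>With s = a + u x and u = t - a, the integral becomes u^{-1/2} / pi times that of
  x^{-1/2} / (1 + x^2), whose value is pi / sqrt 2.\<close>

lemma hardy_row:
  "(\<integral>\<^sup>+s. ennreal (hardy_kernel a t s * (1 / sqrt \<bar>s - a\<bar>)) \<partial>lborel) \<le> ennreal (1 / sqrt 2 * (1 / sqrt \<bar>t - a\<bar>))"
proof (cases "a < t")
  case True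
  define u where "u = t - a"
  have u: "0 < u" "t = a + u" using True by (auto simp: u_def)
  have "(\<integral>\<^sup>+s. ennreal (hardy_kernel a t s * (1 / sqrt \<bar>s - a\<bar>)) \<partial>lborel)
      = ennreal \<bar>u\<bar> * (\<integral>\<^sup>+x. ennreal (hardy_kernel a t (a + u * x) * (1 / sqrt \<bar>a + u * x - a\<bar>)) \<partial>lborel)"
    by (rule nn_integral_real_affine) (use u in \<open>auto simp: hardy_kernel_def\<close>)
  also have "(\<integral>\<^sup>+x. ennreal (hardy_kernel a t (a + u * x) * (1 / sqrt \<bar>a + u * x - a\<bar>)) \<partial>lborel)
      = (\<integral>\<^sup>+x. ennreal (1 / (pi * u * sqrt u)) * ennreal (indicator {0<..} x * (1 / (sqrt x * (1 + x\<^sup>2)))) \<partial>lborel)"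
  proof (rule nn_integral_cong)
    fix x :: real
    show "ennreal (hardy_kernel a t (a + u * x) * (1 / sqrt \<bar>a + u * x - a\<bar>))
        = ennreal (1 / (pi * u * sqrt u)) * ennreal (indicator {0<..} x * (1 / (sqrt x * (1 + x\<^sup>2))))"
    proof (cases "0 < x")
      case True
      have "u\<^sup>2 + (u * x)\<^sup>2 = u * (u * (1 + x\<^sup>2))" by (simp add: power2_eq_square algebra_simps)
      then have "hardy_kernel a t (a + u * x) * (1 / sqrt \<bar>a + u * x - a\<bar>) = 1 / (pi * u * sqrt u) * (1 / (sqrt x * (1 + x\<^sup>2)))"
        using u True by (simp add: hardy_kernel_def real_sqrt_mult mult_ac)
      then show ?thesis using True u by (simp add: ennreal_mult[symmetric])
    next
      case False
      then have "\<not> a < a + u * x" using u by (simp add: mult_le_0_iff not_less)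
      then show ?thesis using False by (simp add: hardy_kernel_def)
    qed
  qed
  also have "\<dots> = ennreal (1 / (pi * u * sqrt u)) * ennreal (pi / sqrt 2)"
    unfolding nn_integral_inv_sqrt[symmetric] by (rule nn_integral_cmult) measurable
  also have "ennreal \<bar>u\<bar> * \<dots> = ennreal (1 / sqrt 2 * (1 / sqrt \<bar>t - a\<bar>))"
    using u by (simp add: ennreal_mult[symmetric])
  finally show ?thesis by simp
qed (simp add: hardy_kernel_def)

text \<open>Here the numerator t - a scales as well, so the second integral, of x^{1/2} / (1 + x^2),
  appears. The weight exponent -1/2 is the one for which both integrals have the same value.\<close>

lemma hardy_col:
  assumes "s \<noteq> a"
  shows "(\<integral>\<^sup>+t. ennreal (hardy_kernel a t s * (1 / sqrt \<bar>t - a\<bar>)) \<partial>lborel) \<le> ennreal (1 / sqrt 2 * (1 / sqrt \<bar>s - a\<bar>))"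
proof (cases "a < s")
  case True
  define v where "v = s - a"
  have v: "0 < v" "s = a + v" using True by (auto simp: v_def)
  have "(\<integral>\<^sup>+t. ennreal (hardy_kernel a t s * (1 / sqrt \<bar>t - a\<bar>)) \<partial>lborel)
      = ennreal \<bar>v\<bar> * (\<integral>\<^sup>+x. ennreal (hardy_kernel a (a + v * x) s * (1 / sqrt \<bar>a + v * x - a\<bar>)) \<partial>lborel)"
    by (rule nn_integral_real_affine) (use v in \<open>auto simp: hardy_kernel_def\<close>)
  also have "(\<integral>\<^sup>+x. ennreal (hardy_kernel a (a + v * x) s * (1 / sqrt \<bar>a + v * x - a\<bar>)) \<partial>lborel)
      = (\<integral>\<^sup>+x. ennreal (1 / (pi * v * sqrt v)) * ennreal (indicator {0<..} x * (sqrt x / (1 + x\<^sup>2))) \<partial>lborel)"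
  proof (rule nn_integral_cong)
    fix x :: real
    show "ennreal (hardy_kernel a (a + v * x) s * (1 / sqrt \<bar>a + v * x - a\<bar>))
        = ennreal (1 / (pi * v * sqrt v)) * ennreal (indicator {0<..} x * (sqrt x / (1 + x\<^sup>2)))"
    proof (cases "0 < x")
      case True
      have e: "(v * x)\<^sup>2 + v\<^sup>2 = v * (v * (1 + x\<^sup>2))" by (simp add: power2_eq_square algebra_simps)
      have x: "x / sqrt x = sqrt x" using True by (intro real_div_sqrt) simp
      have "hardy_kernel a (a + v * x) s * (1 / sqrt \<bar>a + v * x - a\<bar>) = (v * x) / (pi * (v * (v * (1 + x\<^sup>2)))) / (sqrt v * sqrt x)"
        using v True by (simp add: hardy_kernel_def e real_sqrt_mult)
      also have "\<dots> = 1 / (pi * v * sqrt v) * ((x / sqrt x) / (1 + x\<^sup>2))"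
        using v True by (simp add: mult_ac)
      also have "\<dots> = 1 / (pi * v * sqrt v) * (sqrt x / (1 + x\<^sup>2))"
        by (simp only: x)
      finally show ?thesis using True v by (simp add: ennreal_mult[symmetric])
    next
      case False
      then have "\<not> a < a + v * x" using v by (simp add: mult_le_0_iff not_less)
      then show ?thesis using False by (simp add: hardy_kernel_def)
    qed
  qed
  also have "\<dots> = ennreal (1 / (pi * v * sqrt v)) * ennreal (pi / sqrt 2)"
    unfolding nn_integral_sqrt[symmetric] by (rule nn_integral_cmult) measurable
  also have "ennreal \<bar>v\<bar> * \<dots> = ennreal (1 / sqrt 2 * (1 / sqrt \<bar>s - a\<bar>))"
    using v by (simp add: ennreal_mult[symmetric])
  finally show ?thesis by simp
qed (simp add: hardy_kernel_def)

text \<open>Both Schur constants are 1 / sqrt 2, with product 1/2. Inserting the indicator into f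
  keeps only s > a on the right, which the sharp norm count on quadruples exploits.\<close>

lemma hardy_bound:
  assumes [measurable]: "f \<in> borel_measurable lborel" and "\<And>s. 0 \<le> f s"
  shows "(\<integral>\<^sup>+t. (\<integral>\<^sup>+s. ennreal (hardy_kernel a t s * f s) \<partial>lborel)\<^sup>2 \<partial>lborel)
    \<le> ennreal (1 / 2) * (\<integral>\<^sup>+s. ennreal (indicator {a<..} s * (f s)\<^sup>2) \<partial>lborel)"
proof -
  have "(\<integral>\<^sup>+t. (\<integral>\<^sup>+s. ennreal (hardy_kernel a t s * (indicator {a<..} s * f s)) \<partial>lborel)\<^sup>2 \<partial>lborel)
    \<le> ennreal (1 / sqrt 2 * (1 / sqrt 2)) * (\<integral>\<^sup>+s. ennreal ((indicator {a<..} s * f s)\<^sup>2) \<partial>lborel)"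
  proof (rule schur_test[where p = "\<lambda>s. 1 / sqrt \<bar>s - a\<bar>" and q = "\<lambda>t. 1 / sqrt \<bar>t - a\<bar>"])
    show "AE y in lborel. 0 < 1 / sqrt \<bar>y - a\<bar>"
      using AE_lborel_singleton[of a] by eventually_elim simp
    show "AE y in lborel. (\<integral>\<^sup>+x. ennreal (hardy_kernel a x y * (1 / sqrt \<bar>x - a\<bar>)) \<partial>lborel) \<le> ennreal (1 / sqrt 2 * (1 / sqrt \<bar>y - a\<bar>))"
      using AE_lborel_singleton[of a] by eventually_elim (rule hardy_col)
    show "(\<integral>\<^sup>+s. ennreal (hardy_kernel a t s * (1 / sqrt \<bar>s - a\<bar>)) \<partial>lborel) \<le> ennreal (1 / sqrt 2 * (1 / sqrt \<bar>t - a\<bar>))" for t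
      by (rule hardy_row)
  qed (use assms in \<open>auto intro: hardy_kernel_nonneg\<close>)
  moreover have "hardy_kernel a t s * (indicator {a<..} s * f s) = hardy_kernel a t s * f s" for t s
    by (simp add: hardy_kernel_def indicator_def)
  moreover have "(indicator {a<..} s * f s)\<^sup>2 = indicator {a<..} s * (f s)\<^sup>2" for s
    by (simp add: indicator_def)
  ultimately show ?thesis by simp
qed

section \<open>Integral operators on $L^2$\<close>

definition N2 :: "(real \<Rightarrow> complex) \<Rightarrow> real" where
  "N2 f = (LINT x|lborel. (cmod (f x))\<^sup>2)"

lemma L2_measurable [measurable_dest]: "f \<in> L2 \<Longrightarrow> f \<in> borel_measurable lborel"
  by (simp add: L2_def)

lemma L2_integrable: "f \<in> L2 \<Longrightarrow> integrable lborel (\<lambda>x. (cmod (f x))\<^sup>2)"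
  by (simp add: L2_def)

lemma N2_nonneg [simp]: "0 \<le> N2 f"
  by (simp add: N2_def)

lemma nn_integral_N2: "f \<in> L2 \<Longrightarrow> (\<integral>\<^sup>+x. ennreal ((cmod (f x))\<^sup>2) \<partial>lborel) = ennreal (N2 f)"
  unfolding N2_def by (rule nn_integral_eq_integral) (auto simp: L2_integrable)

lemma L2_bound:
  assumes [measurable]: "f \<in> borel_measurable lborel"
    and "(\<integral>\<^sup>+x. ennreal ((cmod (f x))\<^sup>2) \<partial>lborel) \<le> ennreal B" "0 \<le> B"
  shows "f \<in> L2" "N2 f \<le> B"
proof -
  have "integrable lborel (\<lambda>x. (cmod (f x))\<^sup>2)"
    by (rule integrableI_bounded) (use assms(2) in \<open>auto simp: le_less_trans[OF _ ennreal_less_top]\<close>)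
  then show f: "f \<in> L2" by (simp add: L2_def)
  show "N2 f \<le> B" using assms nn_integral_N2[OF f] by simp
qed

lemma L2_dominated:
  assumes [measurable]: "f \<in> borel_measurable lborel" and g: "integrable lborel g"
    and le: "\<And>x. (cmod (f x))\<^sup>2 \<le> g x"
  shows "f \<in> L2" "N2 f \<le> (LINT x|lborel. g x)"
proof -
  have i: "integrable lborel (\<lambda>x. (cmod (f x))\<^sup>2)"
    using order.trans[OF zero_le_power2 le]
    by (intro Bochner_Integration.integrable_bound[OF g]) (auto simp: le)
  then show "f \<in> L2" by (simp add: L2_def)
  show "N2 f \<le> (LINT x|lborel. g x)"
    unfolding N2_def by (intro integral_mono i g le)
qed

lemma norm_add_square_le: "(cmod (x + y))\<^sup>2 \<le> 2 * (cmod x)\<^sup>2 + 2 * (cmod y)\<^sup>2"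
proof -
  have "(cmod (x + y))\<^sup>2 \<le> (cmod x + cmod y)\<^sup>2" by (intro power_mono norm_triangle_ineq) simp
  also have "\<dots> \<le> 2 * (cmod x)\<^sup>2 + 2 * (cmod y)\<^sup>2"
    using zero_le_power2[of "cmod x - cmod y"] by (simp add: power2_eq_square algebra_simps)
  finally show ?thesis .
qed

lemma L2_add:
  assumes "f \<in> L2" "g \<in> L2"
  shows "(\<lambda>x. f x + g x) \<in> L2" "N2 (\<lambda>x. f x + g x) \<le> 2 * N2 f + 2 * N2 g"
proof -
  note [measurable] = assms[THEN L2_measurable]
  have i: "integrable lborel (\<lambda>x. 2 * (cmod (f x))\<^sup>2 + 2 * (cmod (g x))\<^sup>2)"
    using assms by (intro Bochner_Integration.integrable_add integrable_mult_right L2_integrable)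
  show "(\<lambda>x. f x + g x) \<in> L2"
    by (rule L2_dominated(1)[OF _ i norm_add_square_le]) measurable
  have "N2 (\<lambda>x. f x + g x) \<le> (LINT x|lborel. 2 * (cmod (f x))\<^sup>2 + 2 * (cmod (g x))\<^sup>2)"
    by (rule L2_dominated(2)[OF _ i norm_add_square_le]) measurable
  also have "\<dots> = 2 * N2 f + 2 * N2 g"
    unfolding N2_def using assms by (simp add: L2_integrable)
  finally show "N2 (\<lambda>x. f x + g x) \<le> 2 * N2 f + 2 * N2 g" .
qed

lemma L2_cmult: "f \<in> L2 \<Longrightarrow> (\<lambda>x. c * f x) \<in> L2"
  by (auto simp: L2_def norm_mult power_mult_distrib)

lemma L2_minus: "f \<in> L2 \<Longrightarrow> g \<in> L2 \<Longrightarrow> (\<lambda>x. f x - g x) \<in> L2"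
  using L2_add(1)[OF _ L2_cmult[of g "-1"], of f] by simp

lemma L2_Sop:
  assumes "f \<in> L2" shows "Sop f \<in> L2" "N2 (Sop f) = N2 f"
proof -
  note [measurable] = L2_measurable[OF assms]
  have "integrable lborel (\<lambda>x. (cmod (f (0 + (-1) * x)))\<^sup>2)"
    by (rule lborel_integrable_real_affine[OF L2_integrable[OF assms]]) simp
  then show "Sop f \<in> L2" by (simp add: L2_def Sop_def[abs_def])
  show "N2 (Sop f) = N2 f"
    unfolding N2_def Sop_def
    using lborel_integral_real_affine[of "-1" "\<lambda>x. (cmod (f x))\<^sup>2" 0] by simp
qed

lemma L2_mult:
  assumes "f \<in> L2" "g \<in> L2"
  shows "integrable lborel (\<lambda>x. f x * g x)"
    "cmod (LINT x|lborel. f x * g x) \<le> sqrt (N2 f) * sqrt (N2 g)"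
proof -
  note [measurable] = assms[THEN L2_measurable]
  show i: "integrable lborel (\<lambda>x. f x * g x)"
  proof (rule Bochner_Integration.integrable_bound)
    show "integrable lborel (\<lambda>x. (cmod (f x))\<^sup>2 + (cmod (g x))\<^sup>2)"
      using assms by (intro Bochner_Integration.integrable_add L2_integrable)
    have "cmod (f x * g x) \<le> (cmod (f x))\<^sup>2 + (cmod (g x))\<^sup>2" for x
    proof -
      have "2 * (cmod (f x) * cmod (g x)) \<le> (cmod (f x))\<^sup>2 + (cmod (g x))\<^sup>2"
        using zero_le_power2[of "cmod (f x) - cmod (g x)"] by (simp add: power2_eq_square algebra_simps)
      moreover have "0 \<le> cmod (f x) * cmod (g x)" by simp
      ultimately show ?thesis unfolding norm_mult by linarith
    qed
    then show "AE x in lborel. norm (f x * g x) \<le> norm ((cmod (f x))\<^sup>2 + (cmod (g x))\<^sup>2)"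
      by (intro AE_I2) (simp add: abs_of_nonneg)
  qed measurable
  have "(ennreal (cmod (LINT x|lborel. f x * g x)))\<^sup>2 \<le> (\<integral>\<^sup>+x. ennreal (cmod (f x)) * ennreal (cmod (g x)) \<partial>lborel)\<^sup>2"
    using integral_norm_bound_ennreal[OF i] by (intro power_mono) (simp_all add: norm_mult ennreal_mult)
  also have "\<dots> \<le> (\<integral>\<^sup>+x. ennreal (cmod (f x)) ^ 2 \<partial>lborel) * (\<integral>\<^sup>+x. ennreal (cmod (g x)) ^ 2 \<partial>lborel)"
    by (rule Cauchy_Schwarz_nn_integral) measurable
  also have "\<dots> = ennreal (N2 f * N2 g)"
    using assms by (simp add: ennreal_power nn_integral_N2 ennreal_mult)
  finally have "(cmod (LINT x|lborel. f x * g x))\<^sup>2 \<le> N2 f * N2 g"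
    by (simp add: ennreal_power)
  then show "cmod (LINT x|lborel. f x * g x) \<le> sqrt (N2 f) * sqrt (N2 g)"
    by (simp add: real_le_rsqrt flip: real_sqrt_mult)
qed

section \<open>Operators with exponentially decaying kernels\<close>

definition expdecay :: "real \<Rightarrow> real \<Rightarrow> real \<Rightarrow> complex" where
  "expdecay a c s = of_real (exp (- c * \<bar>s - a\<bar>))"

lemma expdecay_L2:
  assumes "0 < c" shows "expdecay a c \<in> L2"
proof -
  have "integrable lborel (\<lambda>x. exp (- (2 * c) * \<bar>- a + 1 * x\<bar>))"
    using assms by (intro lborel_integrable_real_affine[OF integrable_exp_neg_abs]) auto
  moreover have "(cmod (expdecay a c x))\<^sup>2 = exp (- (2 * c) * \<bar>- a + 1 * x\<bar>)" for x
    by (simp add: expdecay_def power2_eq_square flip: exp_add)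
  ultimately show ?thesis by (simp add: L2_def expdecay_def[abs_def])
qed

lemma norm_expdecay: "cmod (expdecay a c s) = exp (- c * \<bar>s - a\<bar>)"
  by (simp add: expdecay_def)

lemma L2_le_expdecay:
  assumes [measurable]: "f \<in> borel_measurable lborel" and "0 < c" and le: "\<And>s. cmod (f s) \<le> B * exp (- c * \<bar>s - a\<bar>)"
  shows "f \<in> L2" "N2 f \<le> B\<^sup>2 * N2 (expdecay a c)"
proof -
  have i: "integrable lborel (\<lambda>s. B\<^sup>2 * (cmod (expdecay a c s))\<^sup>2)"
    using assms by (intro integrable_mult_right L2_integrable expdecay_L2)
  have le': "(cmod (f s))\<^sup>2 \<le> B\<^sup>2 * (cmod (expdecay a c s))\<^sup>2" for s
    using power_mono[OF le norm_ge_zero, of s 2] by (simp add: norm_expdecay power_mult_distrib)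
  show "f \<in> L2" by (rule L2_dominated(1)[OF _ i le']) measurable
  show "N2 f \<le> B\<^sup>2 * N2 (expdecay a c)"
    using L2_dominated(2)[OF _ i le'] by (simp add: N2_def)
qed

definition Kop :: "real \<Rightarrow> (real \<Rightarrow> real \<Rightarrow> complex) \<Rightarrow> (real \<Rightarrow> complex) \<Rightarrow> real \<Rightarrow> complex" where
  "Kop a \<kappa> \<psi> t = (if a < t then (LINT s|lborel. \<kappa> t s * \<psi> s) else 0)"

text \<open>The indicator confines measurability to t > a, the region where R^2 avoids the branch
  cut and continuity is available; \<open>Kop\<close> ignores the rest.\<close>

definition kernel_meas :: "real \<Rightarrow> (real \<Rightarrow> real \<Rightarrow> complex) \<Rightarrow> bool" where
  "kernel_meas a \<kappa> \<longleftrightarrow> (\<lambda>(t, s). indicator {a<..} t *\<^sub>R \<kappa> t s) \<in> borel_measurable (lborel \<Otimes>\<^sub>M lborel)"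

lemma kernel_meas_section:
  assumes "kernel_meas a \<kappa>" "a < t" shows "\<kappa> t \<in> borel_measurable lborel"
proof -
  have "(\<lambda>s. indicator {a<..} t *\<^sub>R \<kappa> t s) \<in> borel_measurable lborel"
    using measurable_compose[OF measurable_Pair1'[of t lborel lborel] assms(1)[unfolded kernel_meas_def]] by simp
  then show ?thesis using assms(2) by simp
qed

lemma kernel_exp_L2:
  assumes "kernel_meas a \<kappa>" "0 < c" "0 \<le> C" "a < t"
    and le: "\<And>t s. a < t \<Longrightarrow> cmod (\<kappa> t s) \<le> C * exp (- c * ((t - a) + \<bar>s - a\<bar>))"
  shows "\<kappa> t \<in> L2"
proof (rule L2_le_expdecay(1)[OF kernel_meas_section[OF assms(1,4)] assms(2)])
  fix s
  have "exp (- c * ((t - a) + \<bar>s - a\<bar>)) \<le> exp (- c * \<bar>s - a\<bar>)" using assms by simp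
  from mult_left_mono[OF this assms(3)] show "cmod (\<kappa> t s) \<le> C * exp (- c * \<bar>s - a\<bar>)"
    using le[OF assms(4), of s] by linarith
qed

lemma Kop_measurable:
  assumes "kernel_meas a \<kappa>" and [measurable]: "\<psi> \<in> borel_measurable lborel"
  shows "Kop a \<kappa> \<psi> \<in> borel_measurable lborel"
proof -
  have [measurable]: "(\<lambda>x. indicator {a<..} (fst x) *\<^sub>R \<kappa> (fst x) (snd x)) \<in> borel_measurable (lborel \<Otimes>\<^sub>M lborel)"
    using assms(1) by (simp add: kernel_meas_def case_prod_unfold)
  have "(\<lambda>t. LINT s|lborel. (indicator {a<..} t *\<^sub>R \<kappa> t s) * \<psi> s) \<in> borel_measurable lborel"
    by (rule lborel.borel_measurable_lebesgue_integral) (unfold case_prod_unfold, measurable)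
  moreover have "(LINT s|lborel. (indicator {a<..} t *\<^sub>R \<kappa> t s) * \<psi> s) = Kop a \<kappa> \<psi> t" for t
    by (simp add: Kop_def)
  ultimately show ?thesis by simp
qed

lemma Kop_linear:
  assumes "\<And>t. a < t \<Longrightarrow> \<kappa> t \<in> L2" "\<phi> \<in> L2" "\<psi> \<in> L2"
  shows "Kop a \<kappa> (\<lambda>x. c * \<phi> x + \<psi> x) t = c * Kop a \<kappa> \<phi> t + Kop a \<kappa> \<psi> t"
proof (cases "a < t")
  case True
  have "(LINT s|lborel. c * (\<kappa> t s * \<phi> s) + \<kappa> t s * \<psi> s) = c * (LINT s|lborel. \<kappa> t s * \<phi> s) + (LINT s|lborel. \<kappa> t s * \<psi> s)"
    using L2_mult(1)[OF assms(1)[OF True] assms(2)] L2_mult(1)[OF assms(1)[OF True] assms(3)]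
    by (simp add: Bochner_Integration.integral_add)
  then show ?thesis using True by (simp add: Kop_def algebra_simps)
qed (simp add: Kop_def)

text \<open>The exponent is a sum, so the bound factors into a function of t times one of s;
  Cauchy-Schwarz in s leaves a fixed exponential profile in t, the same for all \<psi> of given
  norm.\<close>

lemma Kop_exp_bound:
  assumes meas: "kernel_meas a \<kappa>" and "0 < c" "0 \<le> C"
    and le: "\<And>t s. a < t \<Longrightarrow> cmod (\<kappa> t s) \<le> C * exp (- c * ((t - a) + \<bar>s - a\<bar>))"
    and \<psi>: "\<psi> \<in> L2"
  shows "cmod (Kop a \<kappa> \<psi> t) \<le> C * sqrt (N2 (expdecay a c)) * sqrt (N2 \<psi>) * exp (- c * \<bar>t - a\<bar>)"
    and "Kop a \<kappa> \<psi> \<in> L2" "N2 (Kop a \<kappa> \<psi>) \<le> (C * N2 (expdecay a c))\<^sup>2 * N2 \<psi>"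
proof -
  show b: "cmod (Kop a \<kappa> \<psi> t) \<le> C * sqrt (N2 (expdecay a c)) * sqrt (N2 \<psi>) * exp (- c * \<bar>t - a\<bar>)" for t
  proof (cases "a < t")
    case True
    define e where "e = exp (- c * \<bar>t - a\<bar>)"
    have le': "cmod (\<kappa> t s) \<le> C * e * exp (- c * \<bar>s - a\<bar>)" for s
    proof -
      have "exp (- c * ((t - a) + \<bar>s - a\<bar>)) = e * exp (- c * \<bar>s - a\<bar>)"
        unfolding e_def exp_add[symmetric] using True by (simp add: algebra_simps)
      then show ?thesis using le[OF True, of s] by (simp add: mult.assoc)
    qed
    note K = L2_le_expdecay[OF kernel_meas_section[OF meas True] \<open>0 < c\<close> le']
    have "cmod (Kop a \<kappa> \<psi> t) \<le> sqrt (N2 (\<kappa> t)) * sqrt (N2 \<psi>)"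
      using L2_mult(2)[OF K(1) \<psi>] True by (simp add: Kop_def)
    also have "\<dots> \<le> sqrt ((C * e)\<^sup>2 * N2 (expdecay a c)) * sqrt (N2 \<psi>)"
      by (intro mult_right_mono real_sqrt_le_mono K(2)) simp
    also have "\<dots> = C * sqrt (N2 (expdecay a c)) * sqrt (N2 \<psi>) * e"
      using \<open>0 \<le> C\<close> by (simp add: real_sqrt_mult e_def abs_mult)
    finally show ?thesis by (simp add: e_def)
  qed (use assms in \<open>simp add: Kop_def\<close>)
  have m: "Kop a \<kappa> \<psi> \<in> borel_measurable lborel"
    by (rule Kop_measurable[OF meas L2_measurable[OF \<psi>]])
  show "Kop a \<kappa> \<psi> \<in> L2" by (rule L2_le_expdecay(1)[OF m \<open>0 < c\<close> b])
  have "N2 (Kop a \<kappa> \<psi>) \<le> (C * sqrt (N2 (expdecay a c)) * sqrt (N2 \<psi>))\<^sup>2 * N2 (expdecay a c)"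
    by (rule L2_le_expdecay(2)[OF m \<open>0 < c\<close> b])
  also have "\<dots> = (C * N2 (expdecay a c))\<^sup>2 * N2 \<psi>"
    by (simp add: power_mult_distrib) (simp add: power2_eq_square)
  finally show "N2 (Kop a \<kappa> \<psi>) \<le> (C * N2 (expdecay a c))\<^sup>2 * N2 \<psi>" .
qed

text \<open>The rows converge pointwise and are dominated by a multiple of exp (- c |s - a|). Norm
  continuity of the rows makes the images under \<open>Kop\<close> continuous in t, uniformly over
  bounded sets of \<psi>.\<close>

lemma Kop_L2_continuous:
  assumes meas: "kernel_meas a \<kappa>" and c: "0 < c" "0 \<le> C"
    and le: "\<And>t s. a < t \<Longrightarrow> cmod (\<kappa> t s) \<le> C * exp (- c * ((t - a) + \<bar>s - a\<bar>))"
    and cont: "\<And>t s. a < t \<Longrightarrow> ((\<lambda>t. \<kappa> t s) \<longlongrightarrow> \<kappa> t s) (at t)"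
    and t: "a < t"
  shows "((\<lambda>t'. N2 (\<lambda>s. \<kappa> t' s - \<kappa> t s)) \<longlongrightarrow> 0) (at t)"
proof -
  have "((\<lambda>t'. N2 (\<lambda>s. \<kappa> t' s - \<kappa> t s)) \<longlongrightarrow> 0) (at t within {a<..})"
    unfolding tendsto_at_iff_sequentially comp_def
  proof (intro allI impI)
    fix X assume X: "\<forall>i. X i \<in> {a<..} - {t}" and lim: "X \<longlonglongrightarrow> t"
    have Xa: "a < X i" for i using X by auto
    have m [measurable]: "\<kappa> t' \<in> borel_measurable lborel" if "a < t'" for t' by (rule kernel_meas_section[OF meas that])
    have bd: "cmod (\<kappa> t' s) \<le> C * exp (- c * \<bar>s - a\<bar>)" if "a < t'" for t' s
    proof -
      have "exp (- c * ((t' - a) + \<bar>s - a\<bar>)) \<le> exp (- c * \<bar>s - a\<bar>)" using that c by simp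
      from mult_left_mono[OF this c(2)] show ?thesis using le[OF that, of s] by linarith
    qed
    have "(\<lambda>i. LINT s|lborel. (cmod (\<kappa> (X i) s - \<kappa> t s))\<^sup>2) \<longlonglongrightarrow> (LINT s|(lborel :: real measure). 0)"
    proof (rule integral_dominated_convergence[where w = "\<lambda>s. (2 * C)\<^sup>2 * (cmod (expdecay a c s))\<^sup>2"])
      show "integrable lborel (\<lambda>s. (2 * C)\<^sup>2 * (cmod (expdecay a c s))\<^sup>2)"
        by (intro integrable_mult_right L2_integrable expdecay_L2 c)
      show "(\<lambda>s. (cmod (\<kappa> (X i) s - \<kappa> t s))\<^sup>2) \<in> borel_measurable lborel" for i
        using m[OF Xa[of i]] m[OF t] by measurable
      show "AE s in lborel. (\<lambda>i. (cmod (\<kappa> (X i) s - \<kappa> t s))\<^sup>2) \<longlonglongrightarrow> 0"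
      proof (intro AE_I2)
        fix s
        have "(\<lambda>i. \<kappa> (X i) s) \<longlonglongrightarrow> \<kappa> t s"
          using cont[OF t, of s] X lim by (auto simp: tendsto_at_iff_sequentially comp_def)
        then have "(\<lambda>i. (cmod (\<kappa> (X i) s - \<kappa> t s))\<^sup>2) \<longlonglongrightarrow> (cmod (\<kappa> t s - \<kappa> t s))\<^sup>2"
          by (intro tendsto_intros)
        then show "(\<lambda>i. (cmod (\<kappa> (X i) s - \<kappa> t s))\<^sup>2) \<longlonglongrightarrow> 0" by simp
      qed
      show "AE s in lborel. norm ((cmod (\<kappa> (X i) s - \<kappa> t s))\<^sup>2) \<le> (2 * C)\<^sup>2 * (cmod (expdecay a c s))\<^sup>2" for i
      proof (intro AE_I2)
        fix s
        have "cmod (\<kappa> (X i) s - \<kappa> t s) \<le> 2 * C * cmod (expdecay a c s)"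
          using norm_triangle_ineq4[of "\<kappa> (X i) s" "\<kappa> t s"] bd[OF Xa[of i], of s] bd[OF t, of s]
          unfolding norm_expdecay by linarith
        from power_mono[OF this norm_ge_zero, of 2]
        show "norm ((cmod (\<kappa> (X i) s - \<kappa> t s))\<^sup>2) \<le> (2 * C)\<^sup>2 * (cmod (expdecay a c s))\<^sup>2"
          by (simp add: power_mult_distrib)
      qed
    qed simp
    then show "(\<lambda>i. N2 (\<lambda>s. \<kappa> (X i) s - \<kappa> t s)) \<longlonglongrightarrow> 0" by (simp add: N2_def)
  qed
  then show ?thesis using t by (simp add: at_within_open[of t "{a<..}"])
qed

text \<open>Diagonal selection at the countably many pairs of an index and a rational t; norm
  continuity of the rows carries convergence to all t > a, and the common exponential profile
  upgrades it to L^2 convergence. The index set lets several sequences share one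
  subsequence.\<close>

lemma Kop_compact:
  fixes \<psi> :: "nat \<Rightarrow> 'i \<Rightarrow> real \<Rightarrow> complex"
  assumes meas: "kernel_meas a \<kappa>" and c: "0 < c" "0 \<le> C"
    and le: "\<And>t s. a < t \<Longrightarrow> cmod (\<kappa> t s) \<le> C * exp (- c * ((t - a) + \<bar>s - a\<bar>))"
    and cont: "\<And>t s. a < t \<Longrightarrow> ((\<lambda>t. \<kappa> t s) \<longlongrightarrow> \<kappa> t s) (at t)"
    and I: "countable I" and \<psi>: "\<And>n i. i \<in> I \<Longrightarrow> \<psi> n i \<in> L2" "\<And>n i. i \<in> I \<Longrightarrow> N2 (\<psi> n i) \<le> B"
  obtains r g where "strict_mono (r :: nat \<Rightarrow> nat)" "\<And>i. i \<in> I \<Longrightarrow> g i \<in> L2"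
    "\<And>i t. i \<in> I \<Longrightarrow> t \<le> a \<Longrightarrow> g i t = 0"
    "\<And>i. i \<in> I \<Longrightarrow> (\<lambda>n. N2 (\<lambda>t. Kop a \<kappa> (\<psi> (r n) i) t - g i t)) \<longlonglongrightarrow> 0"
proof -
  define M where "M = C * sqrt (N2 (expdecay a c)) * sqrt B"
  have bound: "cmod (Kop a \<kappa> (\<psi> n i) t) \<le> M * exp (- c * \<bar>t - a\<bar>)" if "i \<in> I" for n i t
  proof -
    have "sqrt (N2 (\<psi> n i)) \<le> sqrt B" using \<psi>(2)[OF that] by simp
    then have "C * sqrt (N2 (expdecay a c)) * sqrt (N2 (\<psi> n i)) * exp (- c * \<bar>t - a\<bar>) \<le> M * exp (- c * \<bar>t - a\<bar>)"
      unfolding M_def using c by (intro mult_right_mono mult_left_mono) auto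
    then show ?thesis using Kop_exp_bound(1)[OF meas c le \<psi>(1)[OF that, of n], of t] by linarith
  qed
  have bound': "norm (Kop a \<kappa> (\<psi> n (fst p)) (snd p)) \<le> max M 0" if "p \<in> I \<times> \<rat>" for n p
  proof -
    have "M * exp (- c * \<bar>snd p - a\<bar>) \<le> max M 0 * exp (- c * \<bar>snd p - a\<bar>)" by (intro mult_right_mono) auto
    also have "\<dots> \<le> max M 0" using c by (intro mult_right_le_one_le) auto
    finally show ?thesis using bound[of "fst p" n "snd p"] that by auto
  qed
  have "countable (I \<times> \<rat>)" using I countable_rat by blast
  from function_convergent_subsequence[where f = "\<lambda>n p. Kop a \<kappa> (\<psi> n (fst p)) (snd p)", OF this bound']
  obtain r where r: "strict_mono (r :: nat \<Rightarrow> nat)"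
    and conv: "\<And>p. p \<in> I \<times> \<rat> \<Longrightarrow> \<exists>l. (\<lambda>n. Kop a \<kappa> (\<psi> (r n) (fst p)) (snd p)) \<longlonglongrightarrow> l"
    by blast
  have convergent: "convergent (\<lambda>n. Kop a \<kappa> (\<psi> (r n) i) t)" if i: "i \<in> I" for i t
  proof (cases "a < t")
    case False
    then show ?thesis by (simp add: Kop_def convergent_const)
  next
    case t: True
    have "Cauchy (\<lambda>n. Kop a \<kappa> (\<psi> (r n) i) t)"
    proof (rule metric_CauchyI)
      fix e :: real assume e: "0 < e"
      have B: "0 \<le> B" using \<psi>(2)[OF i, of 0] N2_nonneg order.trans by blast
      \<comment> \<open>Makes sqrt d (sqrt B + 1) equal to e / 3, one third of the allowance; the 1
        guards against B = 0.\<close>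
      define d where "d = (e / (3 * (sqrt B + 1)))\<^sup>2"
      have b: "0 < sqrt B + 1" using B by (simp add: add_nonneg_pos)
      have sd: "sqrt d = e / (3 * (sqrt B + 1))" using e b by (simp add: d_def)
      have *: "x / (3 * y) * y = x / 3" if "0 < y" for x y :: real using that by simp
      have d: "0 < d" "sqrt d * (sqrt B + 1) = e / 3"
        using e b by (simp add: d_def) (simp only: sd *[OF b])
      have "\<forall>\<^sub>F t' in at t. N2 (\<lambda>s. \<kappa> t' s - \<kappa> t s) < d"
        using order_tendstoD(2)[OF Kop_L2_continuous[OF meas c le cont t] d(1)] .
      then obtain \<delta> where \<delta>: "0 < \<delta>" "\<And>t'. t' \<noteq> t \<Longrightarrow> dist t' t < \<delta> \<Longrightarrow> N2 (\<lambda>s. \<kappa> t' s - \<kappa> t s) < d"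
        by (auto simp: eventually_at)
      obtain q where q: "q \<in> \<rat>" "t < q" "q < t + \<delta>"
        using Rats_dense_in_real[of t "t + \<delta>"] \<delta>(1) by auto
      have qa: "a < q" using q t by simp
      have N2q: "N2 (\<lambda>s. \<kappa> q s - \<kappa> t s) < d" using q by (intro \<delta>) (auto simp: dist_real_def)
      note KL = kernel_exp_L2[OF meas c _ le]
      have near: "cmod (Kop a \<kappa> (\<psi> n i) q - Kop a \<kappa> (\<psi> n i) t) < e / 3" for n
      proof -
        have "Kop a \<kappa> (\<psi> n i) q - Kop a \<kappa> (\<psi> n i) t = (LINT s|lborel. (\<kappa> q s - \<kappa> t s) * \<psi> n i s)"
          using qa t L2_mult(1)[OF KL[OF qa] \<psi>(1)[OF i, of n]] L2_mult(1)[OF KL[OF t] \<psi>(1)[OF i, of n]]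
          by (simp add: Kop_def left_diff_distrib)
        also have "cmod \<dots> \<le> sqrt (N2 (\<lambda>s. \<kappa> q s - \<kappa> t s)) * sqrt (N2 (\<psi> n i))"
          by (intro L2_mult(2) L2_minus KL qa t \<psi> i)
        also have "\<dots> \<le> sqrt (N2 (\<lambda>s. \<kappa> q s - \<kappa> t s)) * (sqrt B + 1)"
        proof (intro mult_left_mono)
          have "sqrt (N2 (\<psi> n i)) \<le> sqrt B" using \<psi>(2)[OF i] by simp
          then show "sqrt (N2 (\<psi> n i)) \<le> sqrt B + 1" by linarith
        qed simp
        also have "\<dots> < sqrt d * (sqrt B + 1)"
          using N2q B by (intro mult_strict_right_mono) (auto simp: add_nonneg_pos)
        also note d(2)
        finally show ?thesis .
      qed
      obtain l where "(\<lambda>n. Kop a \<kappa> (\<psi> (r n) i) q) \<longlonglongrightarrow> l" using conv[of "(i, q)"] i q by auto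
      then have "Cauchy (\<lambda>n. Kop a \<kappa> (\<psi> (r n) i) q)" by (rule LIMSEQ_imp_Cauchy)
      then obtain N where N: "\<And>m n. N \<le> m \<Longrightarrow> N \<le> n \<Longrightarrow> dist (Kop a \<kappa> (\<psi> (r m) i) q) (Kop a \<kappa> (\<psi> (r n) i) q) < e / 3"
        using metric_CauchyD[of _ "e / 3"] e by (meson divide_pos_pos zero_less_numeral)
      show "\<exists>N. \<forall>m\<ge>N. \<forall>n\<ge>N. dist (Kop a \<kappa> (\<psi> (r m) i) t) (Kop a \<kappa> (\<psi> (r n) i) t) < e"
      proof (intro exI allI impI)
        fix m n assume mn: "N \<le> m" "N \<le> n"
        have "dist (Kop a \<kappa> (\<psi> (r m) i) t) (Kop a \<kappa> (\<psi> (r n) i) t)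
          \<le> dist (Kop a \<kappa> (\<psi> (r m) i) q) (Kop a \<kappa> (\<psi> (r m) i) t)
            + dist (Kop a \<kappa> (\<psi> (r m) i) q) (Kop a \<kappa> (\<psi> (r n) i) q)
            + dist (Kop a \<kappa> (\<psi> (r n) i) q) (Kop a \<kappa> (\<psi> (r n) i) t)"
          by metric
        then show "dist (Kop a \<kappa> (\<psi> (r m) i) t) (Kop a \<kappa> (\<psi> (r n) i) t) < e"
          using near[of "r m"] near[of "r n"] N[OF mn] unfolding dist_norm by linarith
      qed
    qed
    then show ?thesis by (rule Cauchy_convergent)
  qed
  define g where "g = (\<lambda>i t. lim (\<lambda>n. Kop a \<kappa> (\<psi> (r n) i) t))"
  have lim: "(\<lambda>n. Kop a \<kappa> (\<psi> (r n) i) t) \<longlonglongrightarrow> g i t" if "i \<in> I" for i t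
    using convergent[OF that] by (simp add: g_def convergent_LIMSEQ_iff)
  show ?thesis
  proof (rule that[OF r])
    fix i assume i: "i \<in> I"
    have Km [measurable]: "Kop a \<kappa> (\<psi> n i) \<in> borel_measurable lborel" for n
      by (rule Kop_measurable[OF meas L2_measurable[OF \<psi>(1)[OF i]]])
    have gm [measurable]: "g i \<in> borel_measurable lborel"
      by (rule borel_measurable_LIMSEQ_metric[OF Km lim[OF i]])
    have gb: "cmod (g i t) \<le> M * exp (- c * \<bar>t - a\<bar>)" for t
      by (rule tendsto_upperbound[OF tendsto_norm[OF lim[OF i]]])
         (use bound[OF i] in \<open>simp_all add: always_eventually\<close>)
    show "g i \<in> L2" by (rule L2_le_expdecay(1)[OF gm c(1) gb])
    show "g i t = 0" if "t \<le> a" for t using that by (simp add: g_def Kop_def)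
    have "(\<lambda>n. LINT t|lborel. (cmod (Kop a \<kappa> (\<psi> (r n) i) t - g i t))\<^sup>2) \<longlonglongrightarrow> (LINT t|(lborel :: real measure). 0)"
    proof (rule integral_dominated_convergence[where w = "\<lambda>t. (2 * M)\<^sup>2 * (cmod (expdecay a c t))\<^sup>2"])
      show "integrable lborel (\<lambda>t. (2 * M)\<^sup>2 * (cmod (expdecay a c t))\<^sup>2)"
        by (intro integrable_mult_right L2_integrable expdecay_L2 c)
      show "AE t in lborel. (\<lambda>n. (cmod (Kop a \<kappa> (\<psi> (r n) i) t - g i t))\<^sup>2) \<longlonglongrightarrow> 0"
      proof (intro AE_I2)
        fix t
        have "(\<lambda>n. (cmod (Kop a \<kappa> (\<psi> (r n) i) t - g i t))\<^sup>2) \<longlonglongrightarrow> (cmod (g i t - g i t))\<^sup>2"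
          by (intro tendsto_intros lim i)
        then show "(\<lambda>n. (cmod (Kop a \<kappa> (\<psi> (r n) i) t - g i t))\<^sup>2) \<longlonglongrightarrow> 0" by simp
      qed
      show "AE t in lborel. norm ((cmod (Kop a \<kappa> (\<psi> (r n) i) t - g i t))\<^sup>2) \<le> (2 * M)\<^sup>2 * (cmod (expdecay a c t))\<^sup>2" for n
      proof (intro AE_I2)
        fix t
        have "cmod (Kop a \<kappa> (\<psi> (r n) i) t - g i t) \<le> 2 * M * cmod (expdecay a c t)"
          using norm_triangle_ineq4[of "Kop a \<kappa> (\<psi> (r n) i) t" "g i t"] bound[OF i, of "r n" t] gb[of t]
          unfolding norm_expdecay by linarith
        from power_mono[OF this norm_ge_zero, of 2]
        show "norm ((cmod (Kop a \<kappa> (\<psi> (r n) i) t - g i t))\<^sup>2) \<le> (2 * M)\<^sup>2 * (cmod (expdecay a c t))\<^sup>2"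
          by (simp add: power_mult_distrib)
      qed
    qed measurable
    then show "(\<lambda>n. N2 (\<lambda>t. Kop a \<kappa> (\<psi> (r n) i) t - g i t)) \<longlonglongrightarrow> 0" by (simp add: N2_def)
  qed
qed

section \<open>The operator on quadruples\<close>

text \<open>The shape of \<open>DDop\<close> with the one-corner operator left free: the same norm
  and support lemmas then apply to the full kernel, the homogeneous part and the remainder.\<close>

definition corner_lift :: "((real \<Rightarrow> complex) \<Rightarrow> real \<Rightarrow> complex) \<Rightarrow> (4 \<Rightarrow> real \<Rightarrow> complex) \<Rightarrow> 4 \<Rightarrow> real \<Rightarrow> complex" where
  "corner_lift T \<Phi> j = (\<lambda>t. Sop (T (\<Phi> (j - 1))) t + T (Sop (\<Phi> (j + 1))) t)"

lemma vnorm_N2: "vnorm \<Phi> = sqrt (\<Sum>j\<in>UNIV. N2 (\<Phi> j))"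
  by (simp add: vnorm_def N2_def)

lemma sum_shift_4: "(\<Sum>j\<in>UNIV. f (j - 1)) = (\<Sum>j\<in>UNIV. f (j :: 4))" "(\<Sum>j\<in>UNIV. f (j + 1)) = (\<Sum>j\<in>UNIV. f (j :: 4))"
  for f :: "4 \<Rightarrow> real"
  by (rule sum.reindex_bij_witness[of _ "\<lambda>j. j + 1" "\<lambda>j. j - 1"]; simp)
     (rule sum.reindex_bij_witness[of _ "\<lambda>j. j - 1" "\<lambda>j. j + 1"]; simp)

text \<open>\<open>Sop f\<close> lives on t < -a and g on t > a: the sum misses (-a, a), and squared
  norms add without a factor 2.\<close>

lemma N2_disjoint:
  assumes a: "0 < a" and f: "f \<in> L2" "\<And>t. t \<le> a \<Longrightarrow> f t = 0" and g: "g \<in> L2" "\<And>t. t \<le> a \<Longrightarrow> g t = 0"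
  shows "(\<lambda>t. Sop f t + g t) \<in> L2_0 a" "N2 (\<lambda>t. Sop f t + g t) = N2 f + N2 g"
proof -
  show "(\<lambda>t. Sop f t + g t) \<in> L2_0 a"
    using L2_add(1)[OF L2_Sop(1)[OF f(1)] g(1)] f(2) g(2) by (auto simp: L2_0_def Sop_def)
  have "(cmod (Sop f t + g t))\<^sup>2 = (cmod (Sop f t))\<^sup>2 + (cmod (g t))\<^sup>2" for t
    using f(2)[of "- t"] g(2)[of t] a by (cases "t \<le> a") (auto simp: Sop_def)
  then have "N2 (\<lambda>t. Sop f t + g t) = N2 (Sop f) + N2 g"
    unfolding N2_def using L2_integrable[OF L2_Sop(1)[OF f(1)]] L2_integrable[OF g(1)] by simp
  then show "N2 (\<lambda>t. Sop f t + g t) = N2 f + N2 g" using L2_Sop(2)[OF f(1)] by simp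
qed

lemma corner_lift_L2_0:
  assumes a: "0 < a" and T: "\<And>\<psi>. \<psi> \<in> L2 \<Longrightarrow> T \<psi> \<in> L2" "\<And>\<psi> t. t \<le> a \<Longrightarrow> T \<psi> t = 0" and \<Phi>: "\<Phi> \<in> vspace L2"
  shows "corner_lift T \<Phi> \<in> vspace (L2_0 a)"
    "N2 (corner_lift T \<Phi> j) = N2 (T (\<Phi> (j - 1))) + N2 (T (Sop (\<Phi> (j + 1))))"
proof -
  have \<Phi>j: "\<Phi> j \<in> L2" for j using \<Phi> by (simp add: vspace_def)
  have "corner_lift T \<Phi> j \<in> L2_0 a \<and> N2 (corner_lift T \<Phi> j) = N2 (T (\<Phi> (j - 1))) + N2 (T (Sop (\<Phi> (j + 1))))" for j
    using N2_disjoint[OF a T(1)[OF \<Phi>j] T(2) T(1)[OF L2_Sop(1)[OF \<Phi>j]] T(2)]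
    by (simp add: corner_lift_def)
  then show "corner_lift T \<Phi> \<in> vspace (L2_0 a)"
    "N2 (corner_lift T \<Phi> j) = N2 (T (\<Phi> (j - 1))) + N2 (T (Sop (\<Phi> (j + 1))))"
    by (auto simp: vspace_def)
qed

text \<open>Each component of \<Phi> enters two components of the result, hence the factor 2 under
  the root.\<close>

lemma corner_lift_vnorm:
  assumes a: "0 < a" and T: "\<And>\<psi>. \<psi> \<in> L2 \<Longrightarrow> T \<psi> \<in> L2" "\<And>\<psi> t. t \<le> a \<Longrightarrow> T \<psi> t = 0"
    and M: "\<And>\<psi>. \<psi> \<in> L2 \<Longrightarrow> N2 (T \<psi>) \<le> M * N2 \<psi>" "0 \<le> M" and \<Phi>: "\<Phi> \<in> vspace L2"
  shows "vnorm (corner_lift T \<Phi>) \<le> sqrt (2 * M) * vnorm \<Phi>"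
proof -
  have \<Phi>j: "\<Phi> j \<in> L2" for j using \<Phi> by (simp add: vspace_def)
  have "(\<Sum>j\<in>UNIV. N2 (corner_lift T \<Phi> j)) \<le> (\<Sum>j\<in>UNIV. M * N2 (\<Phi> (j - 1)) + M * N2 (\<Phi> (j + 1)))"
  proof (rule sum_mono)
    fix j :: 4
    show "N2 (corner_lift T \<Phi> j) \<le> M * N2 (\<Phi> (j - 1)) + M * N2 (\<Phi> (j + 1))"
      using corner_lift_L2_0(2)[where T = T, OF a T \<Phi>, of j] M(1)[OF \<Phi>j, of "j - 1"]
        M(1)[OF L2_Sop(1)[OF \<Phi>j], of "j + 1"] by (simp add: L2_Sop(2)[OF \<Phi>j])
  qed
  also have "\<dots> = 2 * M * (\<Sum>j\<in>UNIV. N2 (\<Phi> j))"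
    by (simp add: sum.distrib sum_shift_4[of "\<lambda>j. N2 (\<Phi> j)"] flip: sum_distrib_left)
  finally show ?thesis unfolding vnorm_N2 using M(2) by (simp flip: real_sqrt_mult)
qed

lemma N2_split:
  assumes a: "0 < a" and f: "f \<in> L2"
  shows "N2 (\<lambda>s. indicator {a<..} s *\<^sub>R f s) + N2 (\<lambda>s. indicator {a<..} s *\<^sub>R Sop f s) \<le> N2 f"
proof -
  note [measurable] = L2_measurable[OF f]
  let ?p = "\<lambda>s. indicator {a<..} s *\<^sub>R f s" and ?n = "\<lambda>s. indicator {a<..} (- s) *\<^sub>R f s"
  have "N2 (\<lambda>s. indicator {a<..} s *\<^sub>R Sop f s) = N2 ?n"
    unfolding N2_def Sop_def
    using lborel_integral_real_affine[of "-1" "\<lambda>s. (cmod (indicator {a<..} s *\<^sub>R f (- s)))\<^sup>2" 0] by simp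
  moreover have i: "integrable lborel (\<lambda>s. (cmod (?p s))\<^sup>2)" "integrable lborel (\<lambda>s. (cmod (?n s))\<^sup>2)"
    by (auto intro!: Bochner_Integration.integrable_bound[OF L2_integrable[OF f]] simp: indicator_def)
  moreover have "N2 ?p + N2 ?n = (LINT s|lborel. (cmod (?p s))\<^sup>2 + (cmod (?n s))\<^sup>2)"
    unfolding N2_def using i by simp
  moreover have "\<dots> \<le> N2 f"
    unfolding N2_def using a
    by (intro integral_mono[OF Bochner_Integration.integrable_add[OF i] L2_integrable[OF f]]) (auto simp: indicator_def)
  ultimately show ?thesis by simp
qed

text \<open>A component of \<Phi> is used once as it stands and once reflected, so an operator that
  reads only s > a sees two disjoint halves of it, and the factor 2 disappears.\<close>

lemma corner_lift_vnorm_half: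
  assumes a: "0 < a" and T: "\<And>\<psi>. \<psi> \<in> L2 \<Longrightarrow> T \<psi> \<in> L2" "\<And>\<psi> t. t \<le> a \<Longrightarrow> T \<psi> t = 0"
    and M: "\<And>\<psi>. \<psi> \<in> L2 \<Longrightarrow> N2 (T \<psi>) \<le> M * N2 (\<lambda>s. indicator {a<..} s *\<^sub>R \<psi> s)" "0 \<le> M" and \<Phi>: "\<Phi> \<in> vspace L2"
  shows "vnorm (corner_lift T \<Phi>) \<le> sqrt M * vnorm \<Phi>"
proof -
  have \<Phi>j: "\<Phi> j \<in> L2" for j using \<Phi> by (simp add: vspace_def)
  let ?p = "\<lambda>j. N2 (\<lambda>s. indicator {a<..} s *\<^sub>R \<Phi> j s)" and ?n = "\<lambda>j. N2 (\<lambda>s. indicator {a<..} s *\<^sub>R Sop (\<Phi> j) s)"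
  have "(\<Sum>j\<in>UNIV. N2 (corner_lift T \<Phi> j)) \<le> (\<Sum>j\<in>UNIV. M * ?p (j - 1) + M * ?n (j + 1))"
  proof (rule sum_mono)
    fix j :: 4
    show "N2 (corner_lift T \<Phi> j) \<le> M * ?p (j - 1) + M * ?n (j + 1)"
      using corner_lift_L2_0(2)[where T = T, OF a T \<Phi>, of j] M(1)[OF \<Phi>j, of "j - 1"]
        M(1)[OF L2_Sop(1)[OF \<Phi>j], of "j + 1"] by simp
  qed
  also have "\<dots> = M * (\<Sum>j\<in>UNIV. ?p j + ?n j)"
    by (simp add: sum.distrib distrib_left sum_shift_4(1)[of ?p] sum_shift_4(2)[of ?n] flip: sum_distrib_left)
  also have "\<dots> \<le> M * (\<Sum>j\<in>UNIV. N2 (\<Phi> j))"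
    by (intro mult_left_mono sum_mono N2_split a \<Phi>j M(2))
  finally show ?thesis unfolding vnorm_N2 by (simp flip: real_sqrt_mult)
qed

lemma corner_lift_bounded_linear:
  assumes a: "0 < a" and T: "\<And>\<psi>. \<psi> \<in> L2 \<Longrightarrow> T \<psi> \<in> L2" "\<And>\<psi> t. t \<le> a \<Longrightarrow> T \<psi> t = 0"
    and M: "\<And>\<psi>. \<psi> \<in> L2 \<Longrightarrow> N2 (T \<psi>) \<le> M * N2 \<psi>" "0 \<le> M"
    and lin: "\<And>\<phi> \<psi> c t. \<phi> \<in> L2 \<Longrightarrow> \<psi> \<in> L2 \<Longrightarrow> T (\<lambda>x. c * \<phi> x + \<psi> x) t = c * T \<phi> t + T \<psi> t"
  shows "bounded_linear_on (vspace (L2_0 a)) (corner_lift T)"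
proof -
  have sub: "\<Phi> \<in> vspace L2" if "\<Phi> \<in> vspace (L2_0 a)" for \<Phi>
    using that by (auto simp: vspace_def L2_0_def)
  have "corner_lift T (\<lambda>i x. c * \<Phi> i x + \<Psi> i x) j t = c * corner_lift T \<Phi> j t + corner_lift T \<Psi> j t"
    if "\<Phi> \<in> vspace L2" "\<Psi> \<in> vspace L2" for \<Phi> \<Psi> c j t
  proof -
    have L: "\<Phi> i \<in> L2" "\<Psi> i \<in> L2" for i using that by (auto simp: vspace_def)
    have h1: "Sop (\<lambda>x. c * \<Phi> (j + 1) x + \<Psi> (j + 1) x) = (\<lambda>x. c * Sop (\<Phi> (j + 1)) x + Sop (\<Psi> (j + 1)) x)"
      by (simp add: Sop_def fun_eq_iff)
    have h2: "Sop (T (\<lambda>x. c * \<Phi> (j - 1) x + \<Psi> (j - 1) x)) t = c * Sop (T (\<Phi> (j - 1))) t + Sop (T (\<Psi> (j - 1))) t"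
      unfolding Sop_def by (rule lin[OF L])
    show ?thesis
      unfolding corner_lift_def h1 h2 lin[OF L2_Sop(1)[OF L(1)] L2_Sop(1)[OF L(2)]] by (simp add: algebra_simps)
  qed
  then show ?thesis
    unfolding bounded_linear_on_def
    using corner_lift_L2_0(1)[OF a T] corner_lift_vnorm[OF a T M] sub
    by (intro conjI ballI allI exI[of _ "sqrt (2 * M)"]) auto
qed

section \<open>Decomposition of the corner kernel\<close>

lemma Dop_eq_Kop: "Dop a k \<theta> = Kop a (dker a k \<theta>)"
  by (simp add: Dop_def Kop_def dker_def fun_eq_iff mult_ac)

lemma DDop_eq_corner_lift: "DDop a k \<theta> = corner_lift (Kop a (dker a k \<theta>))"
  by (simp add: DDop_def corner_lift_def fun_eq_iff Dop_eq_Kop)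

definition sker :: "real \<Rightarrow> real \<Rightarrow> real \<Rightarrow> real \<Rightarrow> complex" where
  "sker a k t s = indicator {a<..} s *\<^sub>R of_real (sing_kernel a k t s)"

lemma tau'_measurable [measurable]: "tau' a \<theta> \<in> borel_measurable borel"
  unfolding tau'_def[abs_def] by measurable

text \<open>Continuity gives measurability on t > a; \<open>tau'\<close> jumps at s = a and s = -a
  and is therefore multiplied in separately.\<close>

lemma kernel_meas_dker:
  assumes "0 < a" "0 < k" "0 < \<theta>" "\<theta> < pi / 2"
  shows "kernel_meas a (dker a k \<theta>)"
proof -
  let ?h = "\<lambda>x. hker k (tau a \<theta> (fst x) - of_real a) (of_real a - tau a \<theta> (snd x))"
  have "(\<lambda>x. indicator ({a<..} \<times> UNIV) x *\<^sub>R ?h x) \<in> borel_measurable borel"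
    using continuous_on_hker_tau[OF assms]
    by (intro borel_measurable_continuous_on_indicator borel_open open_Times) (auto simp: case_prod_unfold)
  then have [measurable]: "(\<lambda>x. indicator ({a<..} \<times> UNIV) x *\<^sub>R ?h x) \<in> borel_measurable (borel \<Otimes>\<^sub>M borel)"
    by (simp add: borel_prod)
  have "(\<lambda>x. (indicator ({a<..} \<times> UNIV) x *\<^sub>R ?h x) * tau' a \<theta> (snd x)) \<in> borel_measurable (borel \<Otimes>\<^sub>M borel)"
    by measurable
  moreover have "(indicator ({a<..} \<times> UNIV) x *\<^sub>R ?h x) * tau' a \<theta> (snd x) = (case x of (t, s) \<Rightarrow> indicator {a<..} t *\<^sub>R dker a k \<theta> t s)" for x
    by (cases x) (simp add: dker_def indicator_def)
  ultimately have "(\<lambda>(t, s). indicator {a<..} t *\<^sub>R dker a k \<theta> t s) \<in> borel_measurable (borel \<Otimes>\<^sub>M borel)"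
    by (simp only: case_prod_unfold)
  then show ?thesis
    unfolding kernel_meas_def by (simp cong: measurable_cong_sets add: sets_pair_measure_cong[OF sets_lborel sets_lborel])
qed

lemma kernel_meas_sker: "kernel_meas a (sker a k)"
  unfolding kernel_meas_def sker_def sing_kernel_def case_prod_unfold by measurable

lemma kernel_meas_rker:
  assumes "0 < a" "0 < k" "0 < \<theta>" "\<theta> < pi / 2"
  shows "kernel_meas a (rker a k \<theta>)"
proof -
  have [measurable]: "(\<lambda>x. indicator {a<..} (fst x) *\<^sub>R dker a k \<theta> (fst x) (snd x)) \<in> borel_measurable (lborel \<Otimes>\<^sub>M lborel)"
    "(\<lambda>x. indicator {a<..} (fst x) *\<^sub>R sker a k (fst x) (snd x)) \<in> borel_measurable (lborel \<Otimes>\<^sub>M lborel)"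
    using kernel_meas_dker[OF assms] kernel_meas_sker[of a k] by (simp_all add: kernel_meas_def case_prod_unfold)
  have "(\<lambda>x. if \<bar>snd x\<bar> \<le> a then 0 else indicator {a<..} (fst x) *\<^sub>R dker a k \<theta> (fst x) (snd x)
      - indicator {a<..} (fst x) *\<^sub>R sker a k (fst x) (snd x)) \<in> borel_measurable (lborel \<Otimes>\<^sub>M lborel)"
    by measurable
  moreover have "(if \<bar>snd x\<bar> \<le> a then 0 else indicator {a<..} (fst x) *\<^sub>R dker a k \<theta> (fst x) (snd x)
      - indicator {a<..} (fst x) *\<^sub>R sker a k (fst x) (snd x)) = indicator {a<..} (fst x) *\<^sub>R rker a k \<theta> (fst x) (snd x)" for x
    by (simp add: rker_def sker_def indicator_def)
  ultimately show ?thesis by (simp only: kernel_meas_def case_prod_unfold)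
qed

text \<open>The second bound hands the kernel over to the Hardy estimate; the third, though singular
  as t tends to a, puts every row into L^2.\<close>

lemma sing_kernel_bounds:
  assumes "0 < k" "a < t"
  shows "0 \<le> sing_kernel a k t s" "sing_kernel a k t s \<le> (t - a) / (pi * ((t - a)\<^sup>2 + (s - a)\<^sup>2))"
    "sing_kernel a k t s \<le> 1 / (t - a) * exp (- k * \<bar>s - a\<bar>)"
proof -
  define q where "q = (t - a)\<^sup>2 + (s - a)\<^sup>2"
  have q: "0 < q" using assms by (simp add: q_def add_pos_nonneg)
  have f: "0 \<le> (t - a) / (pi * q)" using assms q by simp
  show "0 \<le> sing_kernel a k t s"
    unfolding sing_kernel_def q_def[symmetric] by (rule mult_nonneg_nonneg[OF f]) simp
  show "sing_kernel a k t s \<le> (t - a) / (pi * ((t - a)\<^sup>2 + (s - a)\<^sup>2))"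
    unfolding sing_kernel_def q_def[symmetric] using f q assms by (intro mult_right_le_one_le) auto
  have "(t - a) / (pi * q) \<le> (t - a) / (1 * (t - a)\<^sup>2)"
    using assms pi_ge_two q by (intro divide_left_mono mult_mono) (auto simp: q_def)
  also have "\<dots> = 1 / (t - a)" using assms by (simp add: power2_eq_square)
  finally have 1: "(t - a) / (pi * q) \<le> 1 / (t - a)" .
  have "\<bar>s - a\<bar> \<le> sqrt q" by (intro real_le_rsqrt) (simp add: q_def)
  then have 2: "exp (- k * sqrt q) \<le> exp (- k * \<bar>s - a\<bar>)" using assms by simp
  show "sing_kernel a k t s \<le> 1 / (t - a) * exp (- k * \<bar>s - a\<bar>)"
    unfolding sing_kernel_def q_def[symmetric] by (rule mult_mono[OF 1 2]) (use assms in auto)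
qed

lemma sker_L2:
  assumes "0 < k" "a < t" shows "sker a k t \<in> L2"
proof (rule L2_le_expdecay(1)[OF kernel_meas_section[OF kernel_meas_sker \<open>a < t\<close>] \<open>0 < k\<close>])
  show "cmod (sker a k t s) \<le> 1 / (t - a) * exp (- k * \<bar>s - a\<bar>)" for s
  proof -
    have "cmod (sker a k t s) \<le> sing_kernel a k t s"
      using sing_kernel_bounds(1)[OF assms, of s] by (simp add: sker_def indicator_def)
    also note sing_kernel_bounds(3)[OF assms]
    finally show ?thesis .
  qed
qed

lemma Kop_sker_bound:
  assumes k: "0 < k" and \<psi>: "\<psi> \<in> L2"
  shows "Kop a (sker a k) \<psi> \<in> L2"
    "N2 (Kop a (sker a k) \<psi>) \<le> 1 / 2 * N2 (\<lambda>s. indicator {a<..} s *\<^sub>R \<psi> s)"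
proof -
  note [measurable] = L2_measurable[OF \<psi>]
  let ?p = "\<lambda>s. indicator {a<..} s *\<^sub>R \<psi> s"
  have p: "?p \<in> L2"
    by (rule L2_dominated(1)[OF _ L2_integrable[OF \<psi>]]) (auto simp: indicator_def)
  have le: "ennreal (cmod (Kop a (sker a k) \<psi> t)) \<le> (\<integral>\<^sup>+s. ennreal (hardy_kernel a t s * cmod (\<psi> s)) \<partial>lborel)" for t
  proof (cases "a < t")
    case True
    have "ennreal (cmod (Kop a (sker a k) \<psi> t)) \<le> (\<integral>\<^sup>+s. ennreal (cmod (sker a k t s * \<psi> s)) \<partial>lborel)"
      using integral_norm_bound_ennreal[OF L2_mult(1)[OF sker_L2[OF k True] \<psi>]] True by (simp add: Kop_def)
    also have "\<dots> \<le> (\<integral>\<^sup>+s. ennreal (hardy_kernel a t s * cmod (\<psi> s)) \<partial>lborel)"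
    proof (intro nn_integral_mono ennreal_leI)
      fix s
      have "cmod (sker a k t s) \<le> hardy_kernel a t s"
        using sing_kernel_bounds(1,2)[OF k True, of s] True by (simp add: sker_def hardy_kernel_def indicator_def)
      then show "cmod (sker a k t s * \<psi> s) \<le> hardy_kernel a t s * cmod (\<psi> s)"
        unfolding norm_mult by (rule mult_right_mono) simp
    qed
    finally show ?thesis .
  qed (simp add: Kop_def)
  have "(\<integral>\<^sup>+t. ennreal ((cmod (Kop a (sker a k) \<psi> t))\<^sup>2) \<partial>lborel)
      \<le> (\<integral>\<^sup>+t. (\<integral>\<^sup>+s. ennreal (hardy_kernel a t s * cmod (\<psi> s)) \<partial>lborel)\<^sup>2 \<partial>lborel)"
    using power_mono[OF le, of _ 2] by (intro nn_integral_mono) (simp add: ennreal_power)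
  also have "\<dots> \<le> ennreal (1 / 2) * (\<integral>\<^sup>+s. ennreal (indicator {a<..} s * (cmod (\<psi> s))\<^sup>2) \<partial>lborel)"
    by (rule hardy_bound) auto
  also have "(\<integral>\<^sup>+s. ennreal (indicator {a<..} s * (cmod (\<psi> s))\<^sup>2) \<partial>lborel) = (\<integral>\<^sup>+s. ennreal ((cmod (?p s))\<^sup>2) \<partial>lborel)"
    by (intro nn_integral_cong) (simp add: indicator_def)
  also have "\<dots> = ennreal (N2 ?p)" by (rule nn_integral_N2[OF p])
  also have "ennreal (1 / 2) * ennreal (N2 ?p) = ennreal (1 / 2 * N2 ?p)" by (rule ennreal_mult[symmetric]) auto
  finally have b: "(\<integral>\<^sup>+t. ennreal ((cmod (Kop a (sker a k) \<psi> t))\<^sup>2) \<partial>lborel) \<le> ennreal (1 / 2 * N2 ?p)" .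
  have m: "Kop a (sker a k) \<psi> \<in> borel_measurable lborel"
    by (rule Kop_measurable[OF kernel_meas_sker]) measurable
  show "Kop a (sker a k) \<psi> \<in> L2" "N2 (Kop a (sker a k) \<psi>) \<le> 1 / 2 * N2 ?p"
    by (rule L2_bound[OF m b], simp)+
qed

lemma N2_indicator_le:
  assumes "\<psi> \<in> L2" and A [measurable]: "A \<in> sets borel"
  shows "N2 (\<lambda>s. indicator A s *\<^sub>R \<psi> s) \<le> N2 \<psi>"
proof -
  note [measurable] = L2_measurable[OF assms(1)]
  show ?thesis
    unfolding N2_def[of \<psi>]
    by (rule L2_dominated(2)[OF _ L2_integrable[OF assms(1)]]) (auto simp: indicator_def)
qed

text \<open>The case distinction in \<open>rker\<close> depends on s alone, so for fixed s no case
  boundary is crossed when t varies.\<close>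

lemma rker_tendsto:
  assumes "0 < a" "0 < k" "0 < \<theta>" "\<theta> < pi / 2" "a < t"
  shows "((\<lambda>t. rker a k \<theta> t s) \<longlongrightarrow> rker a k \<theta> t s) (at t)"
proof -
  have cont: "continuous_on {a<..} (\<lambda>t. path_hker a k \<theta> t s)"
  proof -
    have "continuous_on {a<..} (\<lambda>t. (t, s))" by (intro continuous_intros)
    from continuous_on_compose2[OF continuous_on_hker_tau[OF assms(1-4)] this] show ?thesis by auto
  qed
  have h: "((\<lambda>t. path_hker a k \<theta> t s) \<longlongrightarrow> path_hker a k \<theta> t s) (at t)"
    using cont[unfolded continuous_on_def, THEN bspec, of t] assms(5) by (simp add: at_within_open[of t "{a<..}"])
  then have d: "((\<lambda>t. dker a k \<theta> t s) \<longlongrightarrow> dker a k \<theta> t s) (at t)"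
    unfolding dker_def by (intro tendsto_intros)
  have "(t - a)\<^sup>2 + (s - a)\<^sup>2 \<noteq> 0" using assms(5) by (simp add: add_nonneg_eq_0_iff)
  then have "((\<lambda>t. sing_kernel a k t s) \<longlongrightarrow> sing_kernel a k t s) (at t)"
    unfolding sing_kernel_def by (intro tendsto_intros) auto
  then show ?thesis
    unfolding rker_def using d by (auto intro!: tendsto_intros)
qed

text \<open>For fixed t > a the singular point is at positive distance: the singular term is at most
  a multiple of 1 / (t - a), which handles [-a, a]; outside, the kernel is the sum of two parts
  already known to be in L^2.\<close>

lemma dker_L2:
  assumes a: "0 < a" and k: "0 < k" and \<theta>: "0 < \<theta>" "\<theta> < pi / 2" and t: "a < t"
  shows "dker a k \<theta> t \<in> L2"
proof -
  obtain C c where c: "0 < c" "0 \<le> C" and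
    D: "\<And>t s. a < t \<Longrightarrow> cmod (dker a k \<theta> t s) \<le> C * ((t - a) / ((t - a)\<^sup>2 + (s - a)\<^sup>2)) + C * exp (- c * ((t - a) + \<bar>s - a\<bar>))" and
    R: "\<And>t s. a < t \<Longrightarrow> cmod (rker a k \<theta> t s) \<le> C * exp (- c * ((t - a) + \<bar>s - a\<bar>))"
  proof (rule dker_bound[OF a k \<theta>], goal_cases)
    case 1
    show ?case by (rule 1(1)[OF 1(2-5)])
  qed
  have m: "dker a k \<theta> t \<in> borel_measurable lborel" by (rule kernel_meas_section[OF kernel_meas_dker[OF a k \<theta>] t])
  note [measurable] = m
  let ?i = "\<lambda>s. indicator {- a..a} s *\<^sub>R dker a k \<theta> t s"
  have "rker a k \<theta> t \<in> L2" by (rule kernel_exp_L2[OF kernel_meas_rker[OF a k \<theta>] c t R])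
  moreover have "?i \<in> L2"
  proof (rule L2_dominated(1))
    let ?B = "C * (1 / (t - a)) + C"
    show "integrable lborel (\<lambda>s. indicator {- a..a} s * ?B\<^sup>2)"
      using a by (intro integrable_mult_left integrable_real_indicator) (auto simp: emeasure_lborel_Icc_eq)
    fix s
    have "(t - a) / ((t - a)\<^sup>2 + (s - a)\<^sup>2) \<le> (t - a) / (t - a)\<^sup>2"
      using t by (intro divide_left_mono mult_pos_pos add_pos_nonneg) auto
    also have "\<dots> = 1 / (t - a)" using t by (simp add: power2_eq_square)
    finally have 1: "C * ((t - a) / ((t - a)\<^sup>2 + (s - a)\<^sup>2)) \<le> C * (1 / (t - a))"
      by (rule mult_left_mono) (rule c)
    have "exp (- c * ((t - a) + \<bar>s - a\<bar>)) \<le> 1" using t c by simp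
    from mult_left_mono[OF this c(2)] have "cmod (dker a k \<theta> t s) \<le> ?B" using 1 D[OF t, of s] by linarith
    from power_mono[OF this norm_ge_zero, of 2]
    show "(cmod (?i s))\<^sup>2 \<le> indicator {- a..a} s * ?B\<^sup>2" by (simp add: indicator_def)
  qed measurable
  ultimately have "(\<lambda>s. (rker a k \<theta> t s + sker a k t s) + ?i s) \<in> L2"
    by (intro L2_add(1) sker_L2[OF k t])
  moreover have "(rker a k \<theta> t s + sker a k t s) + ?i s = dker a k \<theta> t s" for s
    using a by (auto simp: rker_def sker_def indicator_def abs_le_iff)
  ultimately show ?thesis by simp
qed

lemma ennreal_add_square_le: "(x + y)\<^sup>2 \<le> 2 * x\<^sup>2 + 2 * (y :: ennreal)\<^sup>2"
proof -
  have "2 * x * y = x * y + x * y" by (simp add: mult_2 distrib_right)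
  then have "(x + y)\<^sup>2 = x\<^sup>2 + 2 * x * y + y\<^sup>2"
    by (simp add: power2_eq_square distrib_left distrib_right ac_simps)
  also have "\<dots> \<le> x\<^sup>2 + (x\<^sup>2 + y\<^sup>2) + y\<^sup>2"
    by (intro add_mono sum_of_squares_ge_ennreal order_refl)
  also have "\<dots> = 2 * x\<^sup>2 + 2 * y\<^sup>2" by (simp add: mult_2 ac_simps)
  finally show ?thesis .
qed

text \<open>On the whole line, the kernel is folded at its singular point $s = a$.\<close>

lemma hardy_bound_line:
  assumes \<psi>: "\<psi> \<in> L2"
  shows "(\<integral>\<^sup>+t. (\<integral>\<^sup>+s. ennreal (indicator {a<..} t * ((t - a) / (pi * ((t - a)\<^sup>2 + (s - a)\<^sup>2)) * cmod (\<psi> s))) \<partial>lborel)\<^sup>2 \<partial>lborel)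
    \<le> ennreal (2 * N2 \<psi>)"
proof -
  note [measurable] = L2_measurable[OF \<psi>]
  define f where "f = (\<lambda>s. cmod (\<psi> s) + cmod (\<psi> (2 * a - s)))"
  let ?K = "\<lambda>t s. indicator {a<..} t * ((t - a) / (pi * ((t - a)\<^sup>2 + (s - a)\<^sup>2)) * cmod (\<psi> s))"
  have K0: "0 \<le> ?K t s" for t s
    using pi_gt_zero by (auto simp: indicator_def intro!: mult_nonneg_nonneg divide_nonneg_nonneg)
  have eq: "(\<integral>\<^sup>+s. ennreal (?K t s) \<partial>lborel) = (\<integral>\<^sup>+s. ennreal (hardy_kernel a t s * f s) \<partial>lborel)" for t
  proof -
    have "(\<integral>\<^sup>+s. ennreal (?K t s) \<partial>lborel)
        = (\<integral>\<^sup>+s. ennreal (indicator {a<..} s * ?K t s) + ennreal (indicator {..<a} s * ?K t s) \<partial>lborel)"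
    proof (rule nn_integral_cong_AE, use AE_lborel_singleton[of a] in eventually_elim)
      case (elim s)
      then show ?case by (cases "a < s") auto
    qed
    also have "\<dots> = (\<integral>\<^sup>+s. ennreal (indicator {a<..} s * ?K t s) \<partial>lborel) + (\<integral>\<^sup>+s. ennreal (indicator {..<a} s * ?K t s) \<partial>lborel)"
      by (rule nn_integral_add) measurable
    also have "(\<integral>\<^sup>+s. ennreal (indicator {..<a} s * ?K t s) \<partial>lborel)
        = (\<integral>\<^sup>+s. ennreal (indicator {a<..} s * (indicator {a<..} t * ((t - a) / (pi * ((t - a)\<^sup>2 + (s - a)\<^sup>2)) * cmod (\<psi> (2 * a - s))))) \<partial>lborel)"
    proof -
      have "(\<integral>\<^sup>+s. ennreal (indicator {..<a} s * ?K t s) \<partial>lborel)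
          = ennreal \<bar>-1\<bar> * (\<integral>\<^sup>+s. ennreal (indicator {..<a} (2 * a + (-1) * s) * ?K t (2 * a + (-1) * s)) \<partial>lborel)"
        by (rule nn_integral_real_affine) auto
      moreover have "(2 * a + (-1) * s - a)\<^sup>2 = (s - a)\<^sup>2" for s
        by (simp add: power2_eq_square algebra_simps)
      ultimately show ?thesis by (auto intro!: nn_integral_cong simp: indicator_def)
    qed
    also have "(\<integral>\<^sup>+s. ennreal (indicator {a<..} s * ?K t s) \<partial>lborel)
         + (\<integral>\<^sup>+s. ennreal (indicator {a<..} s * (indicator {a<..} t * ((t - a) / (pi * ((t - a)\<^sup>2 + (s - a)\<^sup>2)) * cmod (\<psi> (2 * a - s))))) \<partial>lborel)
       = (\<integral>\<^sup>+s. ennreal (hardy_kernel a t s * cmod (\<psi> s)) + ennreal (hardy_kernel a t s * cmod (\<psi> (2 * a - s))) \<partial>lborel)"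
      by (subst nn_integral_add[symmetric]) (auto simp: hardy_kernel_def mult_ac)
    also have "\<dots> = (\<integral>\<^sup>+s. ennreal (hardy_kernel a t s * f s) \<partial>lborel)"
      by (intro nn_integral_cong) (simp add: f_def distrib_left hardy_kernel_nonneg flip: ennreal_plus)
    finally show ?thesis .
  qed
  have "(\<integral>\<^sup>+t. (\<integral>\<^sup>+s. ennreal (?K t s) \<partial>lborel)\<^sup>2 \<partial>lborel)
      \<le> ennreal (1 / 2) * (\<integral>\<^sup>+s. ennreal (indicator {a<..} s * (f s)\<^sup>2) \<partial>lborel)"
    unfolding eq by (rule hardy_bound) (auto simp: f_def)
  also have "\<dots> \<le> ennreal (1 / 2) * (\<integral>\<^sup>+s. ennreal (2 * (cmod (\<psi> s))\<^sup>2) + ennreal (2 * (cmod (\<psi> (2 * a - s)))\<^sup>2) \<partial>lborel)"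
  proof (intro mult_left_mono nn_integral_mono)
    fix s
    have "(f s)\<^sup>2 \<le> 2 * (cmod (\<psi> s))\<^sup>2 + 2 * (cmod (\<psi> (2 * a - s)))\<^sup>2"
      using zero_le_power2[of "cmod (\<psi> s) - cmod (\<psi> (2 * a - s))"]
      by (simp add: f_def power2_eq_square algebra_simps)
    then show "ennreal (indicator {a<..} s * (f s)\<^sup>2) \<le> ennreal (2 * (cmod (\<psi> s))\<^sup>2) + ennreal (2 * (cmod (\<psi> (2 * a - s)))\<^sup>2)"
      by (auto simp: indicator_def simp flip: ennreal_plus intro!: ennreal_leI)
  qed simp
  also have "(\<integral>\<^sup>+s. ennreal (2 * (cmod (\<psi> s))\<^sup>2) + ennreal (2 * (cmod (\<psi> (2 * a - s)))\<^sup>2) \<partial>lborel)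
      = (\<integral>\<^sup>+s. 2 * ennreal ((cmod (\<psi> s))\<^sup>2) \<partial>lborel) + (\<integral>\<^sup>+s. 2 * ennreal ((cmod (\<psi> (2 * a - s)))\<^sup>2) \<partial>lborel)"
    by (subst nn_integral_add) (auto simp: ennreal_mult)
  also have "(\<integral>\<^sup>+s. 2 * ennreal ((cmod (\<psi> (2 * a - s)))\<^sup>2) \<partial>lborel) = (\<integral>\<^sup>+s. 2 * ennreal ((cmod (\<psi> s))\<^sup>2) \<partial>lborel)"
    using nn_integral_real_affine[of "\<lambda>s. 2 * ennreal ((cmod (\<psi> s))\<^sup>2)" "-1" "2 * a"] by simp
  also have "(\<integral>\<^sup>+s. 2 * ennreal ((cmod (\<psi> s))\<^sup>2) \<partial>lborel) = 2 * ennreal (N2 \<psi>)"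
    by (subst nn_integral_cmult) (auto simp: nn_integral_N2[OF \<psi>])
  also have "ennreal (1 / 2) * (2 * ennreal (N2 \<psi>) + 2 * ennreal (N2 \<psi>)) = ennreal (2 * N2 \<psi>)"
  proof -
    have "ennreal (1 / 2) * (ennreal x + ennreal x) = ennreal x" if "0 \<le> x" for x
    proof -
      have "ennreal (1 / 2) * (ennreal x + ennreal x) = ennreal (1 / 2) * ennreal (x + x)"
        using that by (simp only: ennreal_plus)
      also have "\<dots> = ennreal (1 / 2 * (x + x))" using that by (intro ennreal_mult[symmetric]) auto
      finally show ?thesis by simp
    qed
    moreover have "2 * ennreal (N2 \<psi>) = ennreal (2 * N2 \<psi>)" by (simp add: ennreal_mult)
    ultimately show ?thesis by (simp only: N2_nonneg mult_nonneg_nonneg zero_le_numeral)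
  qed
  finally show ?thesis .
qed

text \<open>On [-a, a] the phases do not cancel, so the kernel is replaced by its absolute majorant:
  a multiple of the homogeneous kernel on the whole line plus an exponential. Only finiteness of M
  matters.\<close>

lemma Kop_dker_bound:
  assumes a: "0 < a" and k: "0 < k" and \<theta>: "0 < \<theta>" "\<theta> < pi / 2"
  obtains M where "0 \<le> M" "\<And>\<psi>. \<psi> \<in> L2 \<Longrightarrow> Kop a (dker a k \<theta>) \<psi> \<in> L2"
    "\<And>\<psi>. \<psi> \<in> L2 \<Longrightarrow> N2 (Kop a (dker a k \<theta>) \<psi>) \<le> M * N2 \<psi>"
proof -
  obtain C c where c: "0 < c" "0 \<le> C" and
    D: "\<And>t s. a < t \<Longrightarrow> cmod (dker a k \<theta> t s) \<le> C * ((t - a) / ((t - a)\<^sup>2 + (s - a)\<^sup>2)) + C * exp (- c * ((t - a) + \<bar>s - a\<bar>))" and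
    R: "\<And>t s. a < t \<Longrightarrow> cmod (rker a k \<theta> t s) \<le> C * exp (- c * ((t - a) + \<bar>s - a\<bar>))"
  proof (rule dker_bound[OF a k \<theta>], goal_cases)
    case 1
    show ?case by (rule 1(1)[OF 1(2-5)])
  qed
  \<comment> \<open>The exponential majorant as a kernel of its own: applied to |\<psi>|, it turns
    the second part of the bound into a case of \<open>Kop_exp_bound\<close>.\<close>
  define E where "E = (\<lambda>t s. complex_of_real (exp (- c * ((t - a) + \<bar>s - a\<bar>))))"
  have Em: "kernel_meas a E" unfolding kernel_meas_def E_def case_prod_unfold by measurable
  \<comment> \<open>The outer factors 2 come from (x + y)^2 <= 2 x^2 + 2 y^2, the inner 2 from
    folding the line, and pi undoes the 1 / pi in the homogeneous kernel.\<close>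
  define M where "M = 2 * ((C * pi)\<^sup>2 * 2) + 2 * (C\<^sup>2 * (N2 (expdecay a c))\<^sup>2)"
  have *: "Kop a (dker a k \<theta>) \<psi> \<in> L2 \<and> N2 (Kop a (dker a k \<theta>) \<psi>) \<le> M * N2 \<psi>" if \<psi>: "\<psi> \<in> L2" for \<psi>
  proof -
    note [measurable] = L2_measurable[OF \<psi>]
    define \<psi>' where "\<psi>' = (\<lambda>s. complex_of_real (cmod (\<psi> s)))"
    have \<psi>': "\<psi>' \<in> L2" "N2 \<psi>' = N2 \<psi>" using \<psi> by (auto simp: \<psi>'_def L2_def N2_def)
    let ?H = "\<lambda>t. \<integral>\<^sup>+s. ennreal (indicator {a<..} t * ((t - a) / (pi * ((t - a)\<^sup>2 + (s - a)\<^sup>2)) * cmod (\<psi> s))) \<partial>lborel"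
    let ?G = "\<lambda>t. ennreal (cmod (Kop a E \<psi>' t))"
    have E: "cmod (E t s) \<le> 1 * exp (- c * ((t - a) + \<bar>s - a\<bar>))" for t s by (simp add: E_def)
    note KE = Kop_exp_bound[OF Em c(1) zero_le_one E \<psi>'(1)]
    have le: "ennreal (cmod (Kop a (dker a k \<theta>) \<psi> t)) \<le> ennreal (C * pi) * ?H t + ennreal C * ?G t" for t
    proof (cases "a < t")
      case True
      have EL: "E t \<in> L2"
        by (rule L2_le_expdecay(1)[OF kernel_meas_section[OF Em True] c(1), where B = 1 and a = a]) (use True c in \<open>simp add: E_def\<close>)
      have G: "(\<integral>\<^sup>+s. ennreal (cmod (E t s) * cmod (\<psi> s)) \<partial>lborel) = ?G t"
      proof -
        have r: "E t s * \<psi>' s = of_real (cmod (E t s) * cmod (\<psi> s))" for s by (simp add: E_def \<psi>'_def)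
        have i: "integrable lborel (\<lambda>s. cmod (E t s) * cmod (\<psi> s))"
          using integrable_norm[OF L2_mult(1)[OF EL \<psi>'(1)]] by (simp add: norm_mult \<psi>'_def)
        have "Kop a E \<psi>' t = of_real (LINT s|lborel. cmod (E t s) * cmod (\<psi> s))"
          using True by (simp add: Kop_def r del: of_real_mult)
        then have "cmod (Kop a E \<psi>' t) = (LINT s|lborel. cmod (E t s) * cmod (\<psi> s))"
          by (simp add: integral_nonneg_AE)
        then show ?thesis by (simp add: nn_integral_eq_integral[OF i])
      qed
      have [measurable]: "E t \<in> borel_measurable lborel" by (rule kernel_meas_section[OF Em True])
      have "ennreal (cmod (Kop a (dker a k \<theta>) \<psi> t)) \<le> (\<integral>\<^sup>+s. ennreal (cmod (dker a k \<theta> t s * \<psi> s)) \<partial>lborel)"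
        using integral_norm_bound_ennreal[OF L2_mult(1)[OF dker_L2[OF a k \<theta> True] \<psi>]] True by (simp add: Kop_def)
      also have "\<dots> \<le> (\<integral>\<^sup>+s. ennreal (C * pi) * ennreal (indicator {a<..} t * ((t - a) / (pi * ((t - a)\<^sup>2 + (s - a)\<^sup>2)) * cmod (\<psi> s)))
          + ennreal C * ennreal (cmod (E t s) * cmod (\<psi> s)) \<partial>lborel)"
      proof (rule nn_integral_mono)
        fix s
        let ?q = "(t - a) / ((t - a)\<^sup>2 + (s - a)\<^sup>2)"
        have q: "0 \<le> ?q" using True by simp
        have "cmod (dker a k \<theta> t s * \<psi> s) \<le> (C * ?q + C * cmod (E t s)) * cmod (\<psi> s)"
          using D[OF True, of s] by (simp add: norm_mult E_def mult_right_mono)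
        also have "\<dots> = C * pi * (?q / pi * cmod (\<psi> s)) + C * (cmod (E t s) * cmod (\<psi> s))"
        proof -
          have "(C * q + C * e) * y = C * pi * (q / pi * y) + C * (e * y)" for q e y by (simp add: distrib_right)
          then show ?thesis .
        qed
        finally have "ennreal (cmod (dker a k \<theta> t s * \<psi> s)) \<le> ennreal (C * pi * (?q / pi * cmod (\<psi> s)) + C * (cmod (E t s) * cmod (\<psi> s)))"
          by (rule ennreal_leI)
        also have "\<dots> = ennreal (C * pi) * ennreal (?q / pi * cmod (\<psi> s)) + ennreal C * ennreal (cmod (E t s) * cmod (\<psi> s))"
        proof -
          have "ennreal (C * pi * (q / pi * y) + C * z) = ennreal (C * pi) * ennreal (q / pi * y) + ennreal C * ennreal z"
            if "0 \<le> q" "0 \<le> y" "0 \<le> z" for q y z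
            using that c by (simp only: ennreal_plus ennreal_mult mult_nonneg_nonneg divide_nonneg_nonneg pi_ge_zero)
          from this[OF q norm_ge_zero mult_nonneg_nonneg[OF norm_ge_zero norm_ge_zero]] show ?thesis .
        qed
        also have "?q / pi = (t - a) / (pi * ((t - a)\<^sup>2 + (s - a)\<^sup>2))" by (simp add: mult.commute)
        finally show "ennreal (cmod (dker a k \<theta> t s * \<psi> s)) \<le> ennreal (C * pi) * ennreal (indicator {a<..} t * ((t - a) / (pi * ((t - a)\<^sup>2 + (s - a)\<^sup>2)) * cmod (\<psi> s)))
          + ennreal C * ennreal (cmod (E t s) * cmod (\<psi> s))" using True by simp
      qed
      also have "\<dots> = ennreal (C * pi) * ?H t + ennreal C * (\<integral>\<^sup>+s. ennreal (cmod (E t s) * cmod (\<psi> s)) \<partial>lborel)"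
        by (subst nn_integral_add, measurable, subst nn_integral_cmult, measurable, subst nn_integral_cmult, measurable)
      finally show ?thesis unfolding G .
    qed (simp add: Kop_def)
    have [measurable]: "Kop a E \<psi>' \<in> borel_measurable lborel" by (rule Kop_measurable[OF Em L2_measurable[OF \<psi>'(1)]])
    have [measurable]: "?H \<in> borel_measurable lborel" by measurable
    have "(\<integral>\<^sup>+t. ennreal ((cmod (Kop a (dker a k \<theta>) \<psi> t))\<^sup>2) \<partial>lborel)
        \<le> (\<integral>\<^sup>+t. 2 * (ennreal ((C * pi)\<^sup>2) * (?H t)\<^sup>2) + 2 * (ennreal (C\<^sup>2) * (?G t)\<^sup>2) \<partial>lborel)"
    proof (rule nn_integral_mono)
      fix t
      have "ennreal ((cmod (Kop a (dker a k \<theta>) \<psi> t))\<^sup>2) = (ennreal (cmod (Kop a (dker a k \<theta>) \<psi> t)))\<^sup>2"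
        by (simp add: ennreal_power)
      also have "\<dots> \<le> (ennreal (C * pi) * ?H t + ennreal C * ?G t)\<^sup>2"
        by (intro power_mono le) simp
      also have "\<dots> \<le> 2 * (ennreal (C * pi) * ?H t)\<^sup>2 + 2 * (ennreal C * ?G t)\<^sup>2"
        by (rule ennreal_add_square_le)
      also have "\<dots> = 2 * (ennreal ((C * pi)\<^sup>2) * (?H t)\<^sup>2) + 2 * (ennreal (C\<^sup>2) * (?G t)\<^sup>2)"
        using c by (simp only: power_mult_distrib ennreal_power mult_nonneg_nonneg pi_ge_zero)
      finally show "ennreal ((cmod (Kop a (dker a k \<theta>) \<psi> t))\<^sup>2) \<le> 2 * (ennreal ((C * pi)\<^sup>2) * (?H t)\<^sup>2) + 2 * (ennreal (C\<^sup>2) * (?G t)\<^sup>2)" .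
    qed
    also have "\<dots> = 2 * (ennreal ((C * pi)\<^sup>2) * (\<integral>\<^sup>+t. (?H t)\<^sup>2 \<partial>lborel)) + 2 * (ennreal (C\<^sup>2) * (\<integral>\<^sup>+t. (?G t)\<^sup>2 \<partial>lborel))"
      by (simp add: nn_integral_add nn_integral_cmult)
    also have "\<dots> \<le> 2 * (ennreal ((C * pi)\<^sup>2) * ennreal (2 * N2 \<psi>)) + 2 * (ennreal (C\<^sup>2) * ennreal ((N2 (expdecay a c))\<^sup>2 * N2 \<psi>))"
    proof (intro add_mono mult_left_mono hardy_bound_line \<psi>)
      have "(\<integral>\<^sup>+t. (?G t)\<^sup>2 \<partial>lborel) = ennreal (N2 (Kop a E \<psi>'))"
        using nn_integral_N2[OF KE(2)] by (simp add: ennreal_power)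
      also have "\<dots> \<le> ennreal ((N2 (expdecay a c))\<^sup>2 * N2 \<psi>)"
        using KE(3) by (intro ennreal_leI) (simp add: \<psi>'(2))
      finally show "(\<integral>\<^sup>+t. (?G t)\<^sup>2 \<partial>lborel) \<le> ennreal ((N2 (expdecay a c))\<^sup>2 * N2 \<psi>)" .
    qed auto
    also have "\<dots> = ennreal (M * N2 \<psi>)"
    proof -
      have two: "2 = ennreal 2" by simp
      have "2 * (ennreal ((C * pi)\<^sup>2) * ennreal (2 * N2 \<psi>)) = ennreal (2 * ((C * pi)\<^sup>2 * (2 * N2 \<psi>)))"
        by (subst two) (simp only: ennreal_mult[symmetric] zero_le_power2 mult_nonneg_nonneg N2_nonneg zero_le_numeral)
      moreover have "2 * (ennreal (C\<^sup>2) * ennreal ((N2 (expdecay a c))\<^sup>2 * N2 \<psi>)) = ennreal (2 * (C\<^sup>2 * ((N2 (expdecay a c))\<^sup>2 * N2 \<psi>)))"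
        by (subst two) (simp only: ennreal_mult[symmetric] zero_le_power2 mult_nonneg_nonneg N2_nonneg zero_le_numeral)
      ultimately have "2 * (ennreal ((C * pi)\<^sup>2) * ennreal (2 * N2 \<psi>)) + 2 * (ennreal (C\<^sup>2) * ennreal ((N2 (expdecay a c))\<^sup>2 * N2 \<psi>))
          = ennreal (2 * ((C * pi)\<^sup>2 * (2 * N2 \<psi>)) + 2 * (C\<^sup>2 * ((N2 (expdecay a c))\<^sup>2 * N2 \<psi>)))"
        by (simp only: ennreal_plus[symmetric] zero_le_power2 mult_nonneg_nonneg N2_nonneg zero_le_numeral)
      then show ?thesis by (simp add: M_def algebra_simps)
    qed
    finally have b: "(\<integral>\<^sup>+t. ennreal ((cmod (Kop a (dker a k \<theta>) \<psi> t))\<^sup>2) \<partial>lborel) \<le> ennreal (M * N2 \<psi>)" .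
    have m: "Kop a (dker a k \<theta>) \<psi> \<in> borel_measurable lborel"
      by (rule Kop_measurable[OF kernel_meas_dker[OF a k \<theta>]]) measurable
    have "0 \<le> M * N2 \<psi>" by (simp add: M_def)
    from L2_bound[OF m b this] show ?thesis by simp
  qed
  show ?thesis by (rule that[of M]) (use * in \<open>auto simp: M_def\<close>)
qed

text \<open>The support condition enters here: on [-a, a], where the remainder was set to 0, the
  product of the full kernel with \<psi> vanishes almost everywhere.\<close>

lemma Kop_dker_split:
  assumes a: "0 < a" and k: "0 < k" and \<theta>: "0 < \<theta>" "\<theta> < pi / 2"
    and \<psi>: "\<psi> \<in> L2" "AE x in lborel. x \<in> {-a<..<a} \<longrightarrow> \<psi> x = 0"
    and R: "\<And>t. a < t \<Longrightarrow> rker a k \<theta> t \<in> L2"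
  shows "Kop a (dker a k \<theta>) \<psi> t = Kop a (sker a k) \<psi> t + Kop a (rker a k \<theta>) \<psi> t"
proof (cases "a < t")
  case True
  have i: "integrable lborel (\<lambda>s. sker a k t s * \<psi> s)" "integrable lborel (\<lambda>s. rker a k \<theta> t s * \<psi> s)"
    "integrable lborel (\<lambda>s. dker a k \<theta> t s * \<psi> s)"
    by (intro L2_mult(1) sker_L2[OF k True] R[OF True] dker_L2[OF a k \<theta> True] \<psi>)+
  have "(LINT s|lborel. dker a k \<theta> t s * \<psi> s) = (LINT s|lborel. sker a k t s * \<psi> s + rker a k \<theta> t s * \<psi> s)"
  proof (rule integral_cong_AE)
    show "AE s in lborel. dker a k \<theta> t s * \<psi> s = sker a k t s * \<psi> s + rker a k \<theta> t s * \<psi> s"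
      \<comment> \<open>The endpoints are removed as null sets: the support condition speaks of the
        open interval, the definition of \<open>rker\<close> of the closed one.\<close>
      using \<psi>(2) AE_lborel_singleton[of a] AE_lborel_singleton[of "- a"]
    proof eventually_elim
      case (elim s)
      then show ?case by (auto simp: rker_def sker_def indicator_def abs_le_iff algebra_simps)
    qed
  qed (use i in \<open>auto intro: borel_measurable_integrable\<close>)
  also have "\<dots> = (LINT s|lborel. sker a k t s * \<psi> s) + (LINT s|lborel. rker a k \<theta> t s * \<psi> s)"
    by (rule Bochner_Integration.integral_add[OF i(1,2)])
  finally show ?thesis using True by (simp add: Kop_def)
qed (simp add: Kop_def)

lemma corner_lift_compact:
  assumes a: "0 < a" and meas: "kernel_meas a \<kappa>" and c: "0 < c" "0 \<le> C"
    and le: "\<And>t s. a < t \<Longrightarrow> cmod (\<kappa> t s) \<le> C * exp (- c * ((t - a) + \<bar>s - a\<bar>))"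
    and cont: "\<And>t s. a < t \<Longrightarrow> ((\<lambda>t. \<kappa> t s) \<longlongrightarrow> \<kappa> t s) (at t)"
  shows "compact_op_on (vspace (L2_0 a)) (corner_lift (Kop a \<kappa>))"
  unfolding compact_op_on_def
proof (intro conjI allI impI)
  have KL: "\<kappa> t \<in> L2" if "a < t" for t by (rule kernel_exp_L2[OF meas c that le])
  have zero: "Kop a \<kappa> \<psi> t = 0" if "t \<le> a" for \<psi> t using that by (simp add: Kop_def)
  note KB = Kop_exp_bound(2,3)[OF meas c le]
  show "bounded_linear_on (vspace (L2_0 a)) (corner_lift (Kop a \<kappa>))"
    by (rule corner_lift_bounded_linear[where T = "Kop a \<kappa>", OF a KB(1) zero KB(2) _ Kop_linear[OF KL]]) auto
  fix \<Phi>s :: "nat \<Rightarrow> 4 \<Rightarrow> real \<Rightarrow> complex"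
  assume \<Phi>s: "\<forall>n. \<Phi>s n \<in> vspace (L2_0 a)" and "\<exists>B. \<forall>n. vnorm (\<Phi>s n) \<le> B"
  then obtain B where B: "\<And>n. vnorm (\<Phi>s n) \<le> B" by blast
  have L: "\<Phi>s n j \<in> L2" for n j using \<Phi>s by (auto simp: vspace_def L2_0_def)
  have N: "N2 (\<Phi>s n j) \<le> B\<^sup>2" for n j
  proof -
    have "N2 (\<Phi>s n j) \<le> (\<Sum>j\<in>UNIV. N2 (\<Phi>s n j))" by (rule member_le_sum) auto
    also have "\<dots> = (vnorm (\<Phi>s n))\<^sup>2" unfolding vnorm_N2 by (simp add: sum_nonneg)
    also have "\<dots> \<le> B\<^sup>2" using B[of n] by (intro power_mono) (auto simp: vnorm_N2 sum_nonneg)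
    finally show ?thesis .
  qed
  \<comment> \<open>The eight functions that the corner operator meets, two for each component, are
    indexed by one finite type, so a single subsequence serves all of them.\<close>
  define \<psi> where "\<psi> = (\<lambda>n (p :: 4 \<times> bool). if snd p then Sop (\<Phi>s n (fst p + 1)) else \<Phi>s n (fst p - 1))"
  have \<psi>: "\<psi> n p \<in> L2" "N2 (\<psi> n p) \<le> B\<^sup>2" for n p
    by (auto simp: \<psi>_def L2_Sop[OF L] L N)
  obtain r g where r: "strict_mono (r :: nat \<Rightarrow> nat)" and g: "\<And>p. g p \<in> L2" "\<And>p t. t \<le> a \<Longrightarrow> g p t = 0"
    and lim: "\<And>p. (\<lambda>n. N2 (\<lambda>t. Kop a \<kappa> (\<psi> (r n) p) t - g p t)) \<longlonglongrightarrow> 0"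
  proof (rule Kop_compact[where I = UNIV and \<psi> = \<psi> and B = "B\<^sup>2", OF meas c le cont countable_finite[OF finite] \<psi>], goal_cases)
    case 3
    show ?case by (rule 3(1)[OF 3(2) 3(3)[OF UNIV_I] 3(4)[OF UNIV_I] 3(5)[OF UNIV_I]])
  qed
  define \<Psi> where "\<Psi> = (\<lambda>j t. Sop (g (j, False)) t + g (j, True) t)"
  show "\<exists>r \<Psi>. strict_mono r \<and> \<Psi> \<in> vspace (L2_0 a) \<and>
      (\<lambda>n. vnorm (\<lambda>j x. corner_lift (Kop a \<kappa>) (\<Phi>s (r n)) j x - \<Psi> j x)) \<longlonglongrightarrow> 0"
  proof (intro exI conjI)
    show "strict_mono r" by (rule r)
    show "\<Psi> \<in> vspace (L2_0 a)"
      unfolding \<Psi>_def vspace_def using N2_disjoint(1)[OF a g(1) g(2) g(1) g(2)] by simp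
    let ?d = "\<lambda>n p t. Kop a \<kappa> (\<psi> (r n) p) t - g p t"
    have d: "?d n p \<in> L2" "t \<le> a \<Longrightarrow> ?d n p t = 0" for n p t
      by (intro L2_minus KB(1) \<psi>(1) g(1)) (simp_all add: g(2) zero)
    have "N2 (\<lambda>x. corner_lift (Kop a \<kappa>) (\<Phi>s (r n)) j x - \<Psi> j x) = N2 (?d n (j, False)) + N2 (?d n (j, True))" for n j
    proof -
      have "(\<lambda>x. corner_lift (Kop a \<kappa>) (\<Phi>s (r n)) j x - \<Psi> j x) = (\<lambda>x. Sop (?d n (j, False)) x + ?d n (j, True) x)"
        by (simp add: corner_lift_def \<Psi>_def \<psi>_def Sop_def fun_eq_iff)
      then show ?thesis using N2_disjoint(2)[OF a d d] by simp
    qed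
    moreover have "(\<lambda>n. sqrt (\<Sum>j\<in>UNIV. N2 (?d n (j, False)) + N2 (?d n (j, True)))) \<longlonglongrightarrow> sqrt (\<Sum>j\<in>(UNIV::4 set). 0 + 0)"
      by (intro tendsto_intros lim)
    ultimately show "(\<lambda>n. vnorm (\<lambda>j x. corner_lift (Kop a \<kappa>) (\<Phi>s (r n)) j x - \<Psi> j x)) \<longlonglongrightarrow> 0"
      by (simp add: vnorm_N2)
  qed
qed

theorem theorem3p7:
  fixes a k \<theta> :: real
  assumes "a > 0" and "k > 0" and "0 < \<theta>" and "\<theta> < pi / 2"
  shows "(\<exists>C. \<forall>\<Phi>\<in>vspace L2. DDop a k \<theta> \<Phi> \<in> vspace (L2_0 a) \<and>
                               vnorm (DDop a k \<theta> \<Phi>) \<le> C * vnorm \<Phi>)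
       \<and> (\<exists>A K. bounded_linear_on (vspace (L2_0 a)) A
              \<and> (\<forall>\<Phi>\<in>vspace (L2_0 a). vnorm (A \<Phi>) \<le> 1 / sqrt 2 * vnorm \<Phi>)
              \<and> compact_op_on (vspace (L2_0 a)) K
              \<and> (\<forall>\<Phi>\<in>vspace (L2_0 a). \<forall>j. AE t in lborel.
                     DDop a k \<theta> \<Phi> j t = A \<Phi> j t + K \<Phi> j t))"
proof (rule conjI)
  have zero: "Kop a \<kappa> \<psi> t = 0" if "t \<le> a" for \<kappa> \<psi> t using that by (simp add: Kop_def)
  have sub: "\<Phi> \<in> vspace L2" if "\<Phi> \<in> vspace (L2_0 a)" for \<Phi>
    using that by (auto simp: vspace_def L2_0_def)
  obtain M where M: "0 \<le> M" "\<And>\<psi>. \<psi> \<in> L2 \<Longrightarrow> Kop a (dker a k \<theta>) \<psi> \<in> L2"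
    "\<And>\<psi>. \<psi> \<in> L2 \<Longrightarrow> N2 (Kop a (dker a k \<theta>) \<psi>) \<le> M * N2 \<psi>"
  proof (rule Kop_dker_bound[OF assms], goal_cases)
    case 1
    show ?case by (rule 1(1)[OF 1(2-4)])
  qed
  show "\<exists>C. \<forall>\<Phi>\<in>vspace L2. DDop a k \<theta> \<Phi> \<in> vspace (L2_0 a) \<and> vnorm (DDop a k \<theta> \<Phi>) \<le> C * vnorm \<Phi>"
    unfolding DDop_eq_corner_lift
    using corner_lift_L2_0(1)[where T = "Kop a (dker a k \<theta>)", OF assms(1) M(2) zero]
      corner_lift_vnorm[where T = "Kop a (dker a k \<theta>)", OF assms(1) M(2) zero M(3) M(1)] by blast
  obtain C c where c: "0 < c" "0 \<le> C" and
    "\<And>t s. a < t \<Longrightarrow> cmod (dker a k \<theta> t s) \<le> C * ((t - a) / ((t - a)\<^sup>2 + (s - a)\<^sup>2)) + C * exp (- c * ((t - a) + \<bar>s - a\<bar>))" and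
    R: "\<And>t s. a < t \<Longrightarrow> cmod (rker a k \<theta> t s) \<le> C * exp (- c * ((t - a) + \<bar>s - a\<bar>))"
  proof (rule dker_bound[OF assms], goal_cases)
    case 1
    show ?case by (rule 1(1)[OF 1(2-5)])
  qed
  have RL: "rker a k \<theta> t \<in> L2" if "a < t" for t
    by (rule kernel_exp_L2[OF kernel_meas_rker[OF assms] c that R])
  note S = Kop_sker_bound[OF assms(2)]
  show "\<exists>A K. bounded_linear_on (vspace (L2_0 a)) A
              \<and> (\<forall>\<Phi>\<in>vspace (L2_0 a). vnorm (A \<Phi>) \<le> 1 / sqrt 2 * vnorm \<Phi>)
              \<and> compact_op_on (vspace (L2_0 a)) K
              \<and> (\<forall>\<Phi>\<in>vspace (L2_0 a). \<forall>j. AE t in lborel.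
                     DDop a k \<theta> \<Phi> j t = A \<Phi> j t + K \<Phi> j t)"
  proof (intro exI conjI ballI allI)
    have "N2 (Kop a (sker a k) \<psi>) \<le> 1 / 2 * N2 \<psi>" if "\<psi> \<in> L2" for \<psi>
      using S(2)[OF that, of a] N2_indicator_le[OF that, of "{a<..}"] by simp
    then show "bounded_linear_on (vspace (L2_0 a)) (corner_lift (Kop a (sker a k)))"
      by (intro corner_lift_bounded_linear[where T = "Kop a (sker a k)" and M = "1 / 2", OF assms(1) S(1) zero]
          Kop_linear sker_L2 assms(2)) auto
    \<comment> \<open>The factor 1/2 applies to the norm over s > a; hence 1 / sqrt 2 rather than
      the 1 that \<open>corner_lift_vnorm\<close> would give.\<close>
    show "vnorm (corner_lift (Kop a (sker a k)) \<Phi>) \<le> 1 / sqrt 2 * vnorm \<Phi>" if "\<Phi> \<in> vspace (L2_0 a)" for \<Phi>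
      using corner_lift_vnorm_half[where T = "Kop a (sker a k)", OF assms(1) S(1) zero S(2) _ sub[OF that]]
      by (simp add: real_sqrt_divide)
    show "compact_op_on (vspace (L2_0 a)) (corner_lift (Kop a (rker a k \<theta>)))"
      by (rule corner_lift_compact[OF assms(1) kernel_meas_rker[OF assms] c R rker_tendsto[OF assms]])
    fix \<Phi> j assume \<Phi>: "\<Phi> \<in> vspace (L2_0 a)"
    have L: "\<Phi> i \<in> L2" "AE x in lborel. x \<in> {-a<..<a} \<longrightarrow> \<Phi> i x = 0" for i
      using \<Phi> by (auto simp: vspace_def L2_0_def)
    \<comment> \<open>Reflection maps (-a, a) to itself and null sets to null sets, so
      \<open>Sop\<close> keeps the support condition.\<close>
    have Sz: "AE x in lborel. x \<in> {-a<..<a} \<longrightarrow> Sop (\<Phi> i) x = 0" for i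
      using AE_borel_affine[of "-1" "\<lambda>x. x \<in> {-a<..<a} \<longrightarrow> \<Phi> i x = 0" 0] L(2)[of i] L2_measurable[OF L(1)[of i]]
      by (auto simp: Sop_def)
    note D = Kop_dker_split[OF assms L RL] Kop_dker_split[OF assms L2_Sop(1)[OF L(1)] Sz RL]
    show "AE t in lborel. DDop a k \<theta> \<Phi> j t = corner_lift (Kop a (sker a k)) \<Phi> j t + corner_lift (Kop a (rker a k \<theta>)) \<Phi> j t"
      by (intro AE_I2) (simp add: DDop_eq_corner_lift corner_lift_def Sop_def[of "Kop _ _ _"] D)
  qed
qed

end
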